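(* Let $1<c<2$ and let $s\in\mathbb{C}$ with $0<\operatorname{Re}(s)<1$. Then $$\xi(s)=1-\frac{\pi^{1/4}}{2\Gamma(3/4)}-\int_{c-i\infty}^{c+i\infty}\frac{dt}{2\pi i}\,\frac{\xi(t)}{t}\left[\frac{2s(1-s)-t}{s(1-s)-t(1-t)}\right],$$ or, equivalently, $$\xi(s)=\frac12+\int_{c-i\infty}^{c+i\infty}\frac{dt}{2\pi i}\,\frac{\xi(t)}{t}\left[\frac{1}{1-t}-\frac{2s(1-s)-t}{s(1-s)-t(1-t)}\right].$$
   Context: Riemann's function is $\xi(s)=(s-1)\pi^{-s/2}\Gamma(1+s/2)\zeta(s)$, where $\zeta$ is the Riemann zeta function; it extends to an entire function satisfying $\xi(1-s)=\xi(s)$. The integrals are taken along the vertical line $\operatorname{Re}(t)=c$, oriented upwards. *)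

theory Defs
  imports "HOL-Analysis.Analysis" "HOL-Complex_Analysis.Complex_Analysis"
begin

(* The analytic continuation of the Dirichlet series to the plane punctured at 1.  By the identity
   theorem it is unique there; its value at the pole 1 is left unspecified. *)
definition zeta :: "complex \<Rightarrow> complex" where
  "zeta = (SOME f. f holomorphic_on (- {1}) \<and>
             (\<forall>s. Re s > 1 \<longrightarrow> f s = (\<Sum>n. 1 / of_nat (Suc n) powr s)))"

(* The displayed formula has removable singularities at 1 (pole of zeta) and at -2, -4, ...
   (poles of Gamma); remove_sings fills them in by limits, which gives the entire function. *)
definition xi :: "complex \<Rightarrow> complex" where
  "xi = remove_sings (\<lambda>s. (s - 1) * of_real pi powr (- s / 2) * Gamma (1 + s / 2) * zeta s)"

(* Integrals along the upward line t = c + iy, -\<infinity> < y < \<infinity>, so that dt = \<i> dy.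
   The Bochner integral is 0 for non-integrable functions, hence the separate predicate. *)
definition vline_integrable :: "real \<Rightarrow> (complex \<Rightarrow> complex) \<Rightarrow> bool" where
  "vline_integrable c f \<longleftrightarrow> integrable lborel (\<lambda>y. f (Complex c y) * \<i>)"

definition vline_integral :: "real \<Rightarrow> (complex \<Rightarrow> complex) \<Rightarrow> complex" where
  "vline_integral c f = (LBINT y. f (Complex c y) * \<i>)"

end

theory Submission
  imports Defs "HOL-Probability.Characteristic_Functions" "HOL-Probability.Sinc_Integral"
    "HOL-Real_Asymp.Real_Asymp"
begin

text \<open>
  Write \<open>P w\<close> for the Cauchy integral of \<open>xi t / (t - w)\<close> along the line \<open>Re t = c\<close>, divided by \<open>2 pi i\<close>.
  Shifting the line to \<open>1 - c\<close> and reflecting it by \<open>xi (1 - t) = xi t\<close> gives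
  \<open>P w + P (1 - w) = xi w\<close>.  In partial fractions the kernel of the first formula is
  \<open>2 / t - 1 / (t - s) - 1 / (t - (1 - s))\<close>, so its integral is \<open>2 P 0 - xi s\<close>, while
  \<open>P 0 + P 1 = xi 0 = 1 / 2\<close>, and by Mellin inversion
  \<open>P 0 - P 1 = - (\<Sum>n\<ge>1. exp (- pi n\<^sup>2)) = (1 - theta3 1) / 2\<close>.
  The value \<open>theta3 1 = pi powr (1/4) / Gamma (3/4)\<close> comes from the arithmetic-geometric mean:
  the duplication formulas say that \<open>x \<mapsto> 2 x\<close> is an AGM step for \<open>theta3\<^sup>2\<close> and \<open>theta4\<^sup>2\<close>,
  the elliptic integral is invariant under such steps, and the inversion formula of \<open>theta3\<close>
  makes \<open>x = 1\<close> the lemniscatic case, where the integral is a Beta value.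
\<close>

subsection \<open>The Poisson summation formula\<close>

text \<open>The second formula needs only \<open>P s + P (1 - s) = xi s\<close> and
  \<open>P 0 + P 1 = 1 / 2\<close>. The constant of the first one involves \<open>P 0\<close> alone,
  hence also the difference \<open>P 0 - P 1\<close>; only there does \<open>theta3 1\<close> enter.
  \<open>zeta\<close> is an arbitrary choice and \<open>xi\<close> a limit at removable
  singularities, so neither can be computed with directly. An explicit entire function
  \<open>Xi\<close> is built from the theta series, with symmetry and value at 0 visible in its
  formula, and is identified with \<open>xi\<close> afterwards. Theta is used in the variable
  \<open>u\<close> with \<open>x = exp (2 * u)\<close>: Mellin transforms become Fourier integrals,
  \<open>x -> 1 / x\<close> becomes \<open>u -> - u\<close>, and inversion at \<open>x = 1\<close>
  is Fourier inversion at 0. The inversion of \<open>theta3\<close> serves twice, for the symmetry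
  of \<open>Xi\<close> and for the lemniscatic point. It comes from Poisson summation, proved
  without convergence theory of Fourier series: after one division the partial sums telescope, and
  Bessel's inequality removes the boundary terms.\<close>

lemma gaussian_fourier:
  fixes a b :: real
  assumes a: "a > 0"
  shows "has_bochner_integral lborel (\<lambda>y. of_real (exp (- (a * y\<^sup>2))) * cis (b * y))
           (of_real (sqrt (pi / a) * exp (- (b\<^sup>2 / (4 * a)))))"
proof -
  \<comment> \<open>The transform is the characteristic function of the standard normal law at
    frequency \<open>b / sqrt (2 * a)\<close>; the substitution \<open>v = sqrt (2 * a) * y\<close>
    turns density and phase into the stated integrand.\<close>
  let ?n = "\<lambda>v. std_normal_density v *\<^sub>R cis (b / sqrt (2 * a) * v)"
  have int: "integrable lborel ?n"
    by (rule Bochner_Integration.integrable_bound[OF integrable_normal_density[of 1 0]])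
       (auto simp: normal_density_nonneg cis_conv_exp)
  have "char std_normal_distribution (b / sqrt (2 * a)) = integral\<^sup>L lborel ?n"
    unfolding char_def by (subst integral_density) (auto simp: cis_conv_exp)
  hence "has_bochner_integral lborel ?n (of_real (exp (- ((b / sqrt (2 * a))\<^sup>2) / 2)))"
    using int by (simp add: has_bochner_integral_iff char_std_normal_distribution)
  hence "has_bochner_integral lborel (\<lambda>y. ?n (0 + sqrt (2 * a) * y))
           (of_real (exp (- ((b / sqrt (2 * a))\<^sup>2) / 2)) /\<^sub>R \<bar>sqrt (2 * a)\<bar>)"
    using a by (subst (asm) lborel_has_bochner_integral_real_affine_iff[of "sqrt (2 * a)" _ _ 0]) auto
  hence "has_bochner_integral lborel (\<lambda>y. of_real (sqrt (2 * pi)) * ?n (0 + sqrt (2 * a) * y))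
           (of_real (sqrt (2 * pi)) * (of_real (exp (- ((b / sqrt (2 * a))\<^sup>2) / 2)) /\<^sub>R \<bar>sqrt (2 * a)\<bar>))"
    by (rule has_bochner_integral_mult_right)
  moreover have "(\<lambda>y. of_real (sqrt (2 * pi)) * ?n (0 + sqrt (2 * a) * y)) =
      (\<lambda>y. of_real (exp (- (a * y\<^sup>2))) * cis (b * y))"
    using a by (auto simp: std_normal_density_def power_mult_distrib scaleR_conv_of_real)
  moreover have "of_real (sqrt (2 * pi)) * (of_real (exp (- ((b / sqrt (2 * a))\<^sup>2) / 2)) /\<^sub>R \<bar>sqrt (2 * a)\<bar>)
     = complex_of_real (sqrt (pi / a) * exp (- (b\<^sup>2 / (4 * a))))"
    using a by (simp add: scaleR_conv_of_real power_divide real_sqrt_mult real_sqrt_divide field_simps)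
  ultimately show ?thesis by simp
qed

text \<open>Expand the nonnegative integral of |g - S|^2, where S is the projection onto the
  \<open>e k\<close>: orthonormality leaves the right side minus the left side. Only integrability
  of products is assumed, so no space of square integrable functions appears. It serves to show that
  Fourier coefficients tend to 0.\<close>

lemma bessel_inequality:
  fixes g :: "'a \<Rightarrow> complex" and e :: "'b \<Rightarrow> 'a \<Rightarrow> complex"
  assumes K: "finite K"
    and g: "integrable M (\<lambda>x. g x * cnj (g x))"
    and ge: "\<And>k. k \<in> K \<Longrightarrow> integrable M (\<lambda>x. g x * cnj (e k x))"
    and e: "\<And>k l. k \<in> K \<Longrightarrow> l \<in> K \<Longrightarrow> has_bochner_integral M (\<lambda>x. e k x * cnj (e l x)) (of_bool (k = l))"
  shows "(\<Sum>k\<in>K. (cmod (integral\<^sup>L M (\<lambda>x. g x * cnj (e k x))))\<^sup>2) \<le> integral\<^sup>L M (\<lambda>x. (cmod (g x))\<^sup>2)"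
proof -
  define c where "c k = integral\<^sup>L M (\<lambda>x. g x * cnj (e k x))" for k
  define S where "S x = (\<Sum>k\<in>K. c k * e k x)" for x
  have hg: "has_bochner_integral M (\<lambda>x. g x * cnj (g x)) (of_real (integral\<^sup>L M (\<lambda>x. (cmod (g x))\<^sup>2)))"
    using g by (simp add: has_bochner_integral_iff complex_norm_square[symmetric] del: of_real_power
        flip: integral_of_real)
  have hc: "has_bochner_integral M (\<lambda>x. g x * cnj (e k x)) (c k)" if "k \<in> K" for k
    using ge[OF that] by (simp add: has_bochner_integral_iff c_def)
  have hc': "has_bochner_integral M (\<lambda>x. cnj (g x) * e k x) (cnj (c k))" if "k \<in> K" for k
    using has_bochner_integral_bounded_linear[OF bounded_linear_cnj hc[OF that]] by simp
  have "has_bochner_integral M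
      (\<lambda>x. g x * cnj (g x) - (\<Sum>k\<in>K. cnj (c k) * (g x * cnj (e k x))) - (\<Sum>k\<in>K. c k * (cnj (g x) * e k x))
          + (\<Sum>k\<in>K. \<Sum>l\<in>K. c k * cnj (c l) * (e k x * cnj (e l x))))
      (of_real (integral\<^sup>L M (\<lambda>x. (cmod (g x))\<^sup>2)) - (\<Sum>k\<in>K. cnj (c k) * c k) - (\<Sum>k\<in>K. c k * cnj (c k))
          + (\<Sum>k\<in>K. \<Sum>l\<in>K. c k * cnj (c l) * of_bool (k = l)))"
    by (intro has_bochner_integral_add has_bochner_integral_diff has_bochner_integral_sum
        has_bochner_integral_mult_right hg hc hc' e)
  also have "(\<lambda>x. g x * cnj (g x) - (\<Sum>k\<in>K. cnj (c k) * (g x * cnj (e k x))) - (\<Sum>k\<in>K. c k * (cnj (g x) * e k x))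
          + (\<Sum>k\<in>K. \<Sum>l\<in>K. c k * cnj (c l) * (e k x * cnj (e l x)))) = (\<lambda>x. of_real ((cmod (g x - S x))\<^sup>2))"
  proof
    fix x
    have 1: "(\<Sum>k\<in>K. cnj (c k) * (g x * cnj (e k x))) = g x * cnj (S x)"
      by (simp add: S_def sum_distrib_left mult_ac)
    have 2: "(\<Sum>k\<in>K. c k * (cnj (g x) * e k x)) = cnj (g x) * S x"
      by (simp add: S_def sum_distrib_left mult_ac)
    have 3: "(\<Sum>k\<in>K. \<Sum>l\<in>K. c k * cnj (c l) * (e k x * cnj (e l x))) = S x * cnj (S x)"
      by (simp add: S_def sum_product mult_ac)
    show "g x * cnj (g x) - (\<Sum>k\<in>K. cnj (c k) * (g x * cnj (e k x))) - (\<Sum>k\<in>K. c k * (cnj (g x) * e k x))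
          + (\<Sum>k\<in>K. \<Sum>l\<in>K. c k * cnj (c l) * (e k x * cnj (e l x))) = of_real ((cmod (g x - S x))\<^sup>2)"
      unfolding 1 2 3 complex_norm_square complex_cnj_diff by (simp add: algebra_simps)
  qed
  also have "of_real (integral\<^sup>L M (\<lambda>x. (cmod (g x))\<^sup>2)) - (\<Sum>k\<in>K. cnj (c k) * c k) - (\<Sum>k\<in>K. c k * cnj (c k))
          + (\<Sum>k\<in>K. \<Sum>l\<in>K. c k * cnj (c l) * of_bool (k = l))
     = complex_of_real (integral\<^sup>L M (\<lambda>x. (cmod (g x))\<^sup>2) - (\<Sum>k\<in>K. (cmod (c k))\<^sup>2))"
  proof -
    have "(\<Sum>k\<in>K. \<Sum>l\<in>K. c k * cnj (c l) * of_bool (k = l)) = (\<Sum>k\<in>K. c k * cnj (c k))"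
      using K by (intro sum.cong refl) (simp add: of_bool_def if_distrib cong: if_cong)
    moreover have "(\<Sum>k\<in>K. c k * cnj (c k)) = of_real (\<Sum>k\<in>K. (cmod (c k))\<^sup>2)"
      by (simp only: of_real_sum complex_norm_square)
    ultimately show ?thesis by (simp add: mult.commute)
  qed
  finally have "has_bochner_integral M (\<lambda>x. Re (of_real ((cmod (g x - S x))\<^sup>2)))
      (Re (of_real (integral\<^sup>L M (\<lambda>x. (cmod (g x))\<^sup>2) - (\<Sum>k\<in>K. (cmod (c k))\<^sup>2))))"
    by (rule has_bochner_integral_bounded_linear[OF bounded_linear_Re])
  from has_bochner_integral_integral_eq[OF this, unfolded Re_complex_of_real, symmetric]
  have "0 \<le> integral\<^sup>L M (\<lambda>x. (cmod (g x))\<^sup>2) - (\<Sum>k\<in>K. (cmod (c k))\<^sup>2)"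
    by (simp only:) (rule Bochner_Integration.integral_nonneg, rule zero_le_power2)
  thus ?thesis by (simp add: c_def)
qed

text \<open>The cosine vanishes at pi / 2, so the mean value theorem on the whole interval is too
  weak. On half the interval both cos and sin y / y are at least sqrt 2 / 2, and the double angle
  formula multiplies these two bounds.\<close>

lemma sin_ge_half:
  fixes x :: real
  assumes "0 \<le> x" "x \<le> pi / 2"
  shows "x / 2 \<le> sin x"
proof -
  define y where "y = x / 2"
  have y: "0 \<le> y" "y \<le> pi / 4" using assms by (auto simp: y_def)
  have c: "sqrt 2 / 2 \<le> cos z" if "0 \<le> z" "z \<le> pi / 4" for z
    using cos_monotone_0_pi_le[of z "pi / 4"] that by (simp add: cos_45)
  have "y * (sqrt 2 / 2) \<le> sin y"
  proof (cases "y = 0")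
    case False
    then obtain z where "0 < z" "z < y" "sin y - sin 0 = (y - 0) * cos z"
      using MVT2[of 0 y sin cos] y by (auto intro: DERIV_sin)
    thus ?thesis using c[of z] y by (auto intro: mult_left_mono)
  qed auto
  hence "(y * (sqrt 2 / 2)) * (sqrt 2 / 2) \<le> sin y * cos y"
    using c[of y] y by (intro mult_mono) (auto intro: sin_ge_zero)
  moreover have "(y * (sqrt 2 / 2)) * (sqrt 2 / 2) = x / 4"
    by (simp add: y_def mult.assoc)
  ultimately have "x / 4 \<le> sin y * cos y" by simp
  thus ?thesis using sin_double[of y] by (simp add: y_def)
qed

text \<open>The zero of cis (2 pi y) - 1 at 0 is simple and the only one in a period. Hence a
  function that vanishes at 0 with a Lipschitz bound there stays bounded after division by
  it.\<close>

lemma cis_minus_1_ge: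
  fixes y :: real
  assumes "\<bar>y\<bar> \<le> 1 / 2"
  shows "\<bar>y\<bar> \<le> cmod (cis (2 * pi * y) - 1)"
proof -
  have "cmod (cis (2 * pi * y) - 1) = 2 * \<bar>sin (pi * y)\<bar>"
    using dist_exp_i_1[of "2 * pi * y"] by (simp add: cis_conv_exp)
  also have "\<dots> \<ge> 2 * sin (pi * \<bar>y\<bar>)"
    by (cases "y \<ge> 0") auto
  also have "2 * sin (pi * \<bar>y\<bar>) \<ge> 2 * (pi * \<bar>y\<bar> / 2)"
    by (intro mult_left_mono sin_ge_half) (use assms in auto)
  also have "2 * (pi * \<bar>y\<bar> / 2) \<ge> 1 * \<bar>y\<bar>"
    using pi_gt3 mult_right_mono[of 1 pi "\<bar>y\<bar>"] by simp
  finally show ?thesis by simp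
qed

text \<open>The periodization \<open>f\<close> of \<open>h\<close> has Fourier coefficients
  \<open>hhat\<close>, and the claim is that its Fourier series converges to \<open>f 0\<close> at
  0. The quadratic decay of \<open>h\<close> makes the periodization converge uniformly, that of
  \<open>h'\<close> makes it Lipschitz at 0, and the latter suffices for pointwise
  convergence.\<close>

lemma poisson_summation:
  fixes h h' :: "real \<Rightarrow> real" and C :: real
  assumes deriv: "\<And>t. (h has_real_derivative h' t) (at t)"
    and h: "\<And>t. \<bar>h t\<bar> \<le> C / (1 + t\<^sup>2)"
    and h': "\<And>t. \<bar>h' t\<bar> \<le> C / (1 + t\<^sup>2)"
    and hhat: "\<And>k::int. has_bochner_integral lborel (\<lambda>y. of_real (h y) * cis (- (2 * pi * k * y))) (hhat k)"
  shows "(\<lambda>N. \<Sum>k=-int N..int N. hhat k) \<longlonglongrightarrow> of_real (h 0 + (\<Sum>n. h (Suc n) + h (- real (Suc n))))"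
proof -
  define I :: "real set" where "I = {-1/2..<1/2}"
  define M where "M = restrict_space lborel I"
  have I [measurable]: "I \<in> sets borel" "I \<in> sets lborel" by (auto simp: I_def)
  have spM: "space M = I" by (simp add: M_def space_restrict_space)
  have C: "C \<ge> 0" using h[of 0] by simp
  have emM: "emeasure M (space M) = 1"
    unfolding spM by (simp add: M_def emeasure_restrict_space) (simp add: I_def)
  have ps: "prob_space M" by (rule prob_spaceI[OF emM])
  interpret M: prob_space M by (rule ps)
  define F where "F N y = h y + (\<Sum>n<N. h (y + Suc n) + h (y - Suc n))" for N :: nat and y
  \<comment> \<open>Dominates a pair of translates by n + 1 and - (n + 1): two terms, each losing
    the factor 4 of \<open>near\<close>.\<close>
  define S where "S n = 8 * C / (1 + (real (Suc n))\<^sup>2)" for n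
  have S_half: "S n / 2 = 4 * C / (1 + (real (Suc n))\<^sup>2)" for n
  proof -
    have "S n = 2 * (4 * C / (1 + (real (Suc n))\<^sup>2))" unfolding S_def by simp
    thus ?thesis by linarith
  qed
  have summable_S: "summable S"
  proof (rule summable_comparison_test')
    show "summable (\<lambda>n. 8 * C * (1 / (real n + 1)\<^sup>2))"
      using summable_mult[OF sums_summable[OF inverse_squares_sums], of "8 * C"] by (simp add: add.commute)
    show "norm (S n) \<le> 8 * C * (1 / (real n + 1)\<^sup>2)" for n
    proof -
      have "0 < (1 + real n)\<^sup>2" by simp
      thus ?thesis using C unfolding S_def
        by (auto simp: add.commute simp del: zero_less_power2 intro!: divide_left_mono mult_pos_pos add_pos_pos)
    qed
  qed
  have near: "1 / (1 + (t + y)\<^sup>2) \<le> 4 / (1 + t\<^sup>2)" if "\<bar>y\<bar> \<le> 1 / 2" for t y :: real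
  proof -
    \<comment> \<open>Completing the square in t; the remainder 3 - 4/3 y^2 is positive because |y|
      is at most 1/2.\<close>
    have "4 * (1 + (t + y)\<^sup>2) - (1 + t\<^sup>2) = 3 * (t + 4/3 * y)\<^sup>2 + 3 - 4/3 * y\<^sup>2"
      by (simp add: power2_eq_square algebra_simps)
    moreover have "y\<^sup>2 \<le> (1/2)\<^sup>2" using that power_mono[of "\<bar>y\<bar>" "1/2" 2] by simp
    moreover have "(1/2)\<^sup>2 = (1/4 :: real)" by (simp add: power2_eq_square)
    moreover have "0 \<le> (t + 4/3 * y)\<^sup>2" by simp
    ultimately have "1 + t\<^sup>2 \<le> 4 * (1 + (t + y)\<^sup>2)" by linarith
    thus ?thesis by (simp add: divide_simps add_nonneg_pos add_pos_nonneg)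
  qed
  have lip: "\<bar>h (t + y) - h t\<bar> \<le> 4 * C / (1 + t\<^sup>2) * \<bar>y\<bar>" if y: "\<bar>y\<bar> \<le> 1 / 2" for t y
  proof -
    have "\<bar>h (t + y) - h t\<bar> \<le> 4 * C / (1 + t\<^sup>2) * \<bar>t + y - t\<bar>"
      unfolding real_norm_def[symmetric]
    proof (rule field_differentiable_bound[of "cball t (1/2)" h h'])
      show "(h has_field_derivative h' z) (at z within cball t (1/2))" for z
        using deriv by (rule has_field_derivative_at_within)
      fix z assume "z \<in> cball t (1/2)"
      hence "\<bar>z - t\<bar> \<le> 1 / 2" by (auto simp: dist_real_def abs_minus_commute)
      hence "C * (1 / (1 + (t + (z - t))\<^sup>2)) \<le> C * (4 / (1 + t\<^sup>2))"
        using C by (intro mult_left_mono near) auto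
      thus "norm (h' z) \<le> 4 * C / (1 + t\<^sup>2)" using h'[of z] by (simp add: mult.commute)
    next
      show "t + y \<in> cball t (1/2)" "t \<in> cball t (1/2)" using y by (auto simp: dist_real_def)
    qed (rule convex_cball)
    thus ?thesis by simp
  qed
  have bd: "\<bar>h (t + y)\<bar> \<le> 4 * C / (1 + t\<^sup>2)" if y: "\<bar>y\<bar> \<le> 1 / 2" for t y
    using mult_left_mono[OF near[OF y, of t] C] h[of "t + y"] by (simp add: mult.commute)
  have term_bd: "\<bar>h (y + Suc n) + h (y - Suc n)\<bar> \<le> S n" if "y \<in> I" for y n
  proof -
    have "\<bar>y\<bar> \<le> 1 / 2" using that by (auto simp: I_def)
    from bd[OF this, of "real (Suc n)"] bd[OF this, of "- real (Suc n)"]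
    have "\<bar>h (y + Suc n)\<bar> \<le> S n / 2" "\<bar>h (y - Suc n)\<bar> \<le> S n / 2"
      by (simp_all only: S_half power2_minus add.commute[of _ y] diff_conv_add_uminus)
    thus ?thesis by linarith
  qed
  have term_lip: "\<bar>(h (y + Suc n) + h (y - Suc n)) - (h (real (Suc n)) + h (- real (Suc n)))\<bar> \<le> S n * \<bar>y\<bar>" if "y \<in> I" for y n
  proof -
    have "\<bar>y\<bar> \<le> 1 / 2" using that by (auto simp: I_def)
    from lip[OF this, of "real (Suc n)"] lip[OF this, of "- real (Suc n)"]
    have "\<bar>h (y + Suc n) - h (real (Suc n))\<bar> \<le> S n / 2 * \<bar>y\<bar>"
      "\<bar>h (y - Suc n) - h (- real (Suc n))\<bar> \<le> S n / 2 * \<bar>y\<bar>"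
      by (simp_all only: S_half power2_minus add.commute[of _ y] diff_conv_add_uminus)
    thus ?thesis by linarith
  qed
  define f where "f y = h y + (\<Sum>n. h (y + Suc n) + h (y - Suc n))" for y
  have F_lim: "(\<lambda>N. F N y) \<longlonglongrightarrow> f y" if "y \<in> I" for y
    unfolding F_def f_def using term_bd[OF that] summable_S
    by (intro tendsto_intros summable_LIMSEQ summable_comparison_test'[OF summable_S, of 0]) auto
  have F_bd: "\<bar>F N y\<bar> \<le> 4 * C + suminf S" if "y \<in> I" for N y
  proof -
    have "\<bar>h y\<bar> \<le> 4 * C" using bd[of y 0] that by (auto simp: I_def)
    moreover have "\<bar>\<Sum>n<N. h (y + Suc n) + h (y - Suc n)\<bar> \<le> (\<Sum>n<N. S n)"
      by (intro order.trans[OF sum_abs] sum_mono term_bd that)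
    moreover have "(\<Sum>n<N. S n) \<le> suminf S"
      by (intro sum_le_suminf summable_S) (use C in \<open>auto simp: S_def\<close>)
    ultimately show ?thesis unfolding F_def by linarith
  qed
  \<comment> \<open>The constant does not depend on N, so the bound passes to the limit
    \<open>f\<close>, whose differentiability is never discussed.\<close>
  have F_lip: "\<bar>F N y - F N 0\<bar> \<le> (4 * C + suminf S) * \<bar>y\<bar>" if y: "y \<in> I" for N y
  proof -
    have "\<bar>y\<bar> \<le> 1 / 2" using that by (auto simp: I_def)
    from lip[OF this, of 0] have "\<bar>h y - h 0\<bar> \<le> 4 * C * \<bar>y\<bar>" by simp
    moreover have "\<bar>\<Sum>n<N. (h (y + Suc n) + h (y - Suc n)) - (h (real (Suc n)) + h (- real (Suc n)))\<bar> \<le> (\<Sum>n<N. S n * \<bar>y\<bar>)"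
      by (intro order.trans[OF sum_abs] sum_mono term_lip that)
    moreover have "(\<Sum>n<N. S n) * \<bar>y\<bar> \<le> suminf S * \<bar>y\<bar>"
      by (intro mult_right_mono sum_le_suminf summable_S) (use C in \<open>auto simp: S_def\<close>)
    ultimately show ?thesis
      unfolding F_def by (simp add: sum_subtractf algebra_simps sum_distrib_left)
  qed
  have f_lip: "\<bar>f y - f 0\<bar> \<le> (4 * C + suminf S) * \<bar>y\<bar>" if y: "y \<in> I" for y
  proof (rule tendsto_upperbound)
    show "(\<lambda>N. \<bar>F N y - F N 0\<bar>) \<longlonglongrightarrow> \<bar>f y - f 0\<bar>"
      by (intro tendsto_rabs tendsto_diff F_lim y) (simp add: I_def)
    show "\<forall>\<^sub>F N in sequentially. \<bar>F N y - F N 0\<bar> \<le> (4 * C + suminf S) * \<bar>y\<bar>"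
      by (intro always_eventually allI F_lip y)
  qed simp
  have cont_h: "continuous_on UNIV h"
    using deriv DERIV_isCont continuous_at_imp_continuous_on by blast
  have [measurable]: "h \<in> borel_measurable borel"
    using cont_h by (rule borel_measurable_continuous_onI)
  have meas_f [measurable]: "f \<in> borel_measurable borel" unfolding f_def by measurable
  have meas_e [measurable]: "(\<lambda>y. cis (g y)) \<in> borel_measurable N" if [measurable]: "g \<in> borel_measurable N" for g and N :: "'z measure"
    unfolding cis_conv_exp by measurable
  have bM [measurable_dest]: "g \<in> borel_measurable M" if "g \<in> borel_measurable borel" for g :: "real \<Rightarrow> complex"
    using that unfolding M_def by (simp add: measurable_restrict_space1)
  have [measurable]: "cnj \<in> borel_measurable borel"
    by (intro borel_measurable_continuous_onI continuous_intros)
  define e where "e k y = cis (2 * pi * of_int k * y)" for k :: int and y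
  have intM: "integrable M g" if "g \<in> borel_measurable borel" "\<And>y. y \<in> I \<Longrightarrow> cmod (g y) \<le> B" for g B
    by (rule M.integrable_const_bound[of _ B]) (use that in \<open>auto simp: spM intro!: bM\<close>)
  have M_int: "integral\<^sup>L M g = (LBINT y. indicator I y *\<^sub>R g y)" for g :: "real \<Rightarrow> complex"
    unfolding M_def by (subst integral_restrict_space) (auto simp: I_def)

  have orth: "has_bochner_integral M (\<lambda>y. e k y * cnj (e l y)) (of_bool (k = l))" for k l
  proof (cases "k = l")
    case True
    have "e k y * cnj (e k y) = 1" for y
      by (simp add: e_def flip: complex_norm_square)
    with True show ?thesis
      by (simp add: has_bochner_integral_iff M.prob_space)
  next
    case False
    define d where "d = 2 * pi * of_int (k - l)"
    have d: "d \<noteq> 0" using False by (simp add: d_def)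
    have e: "e k y * cnj (e l y) = cis (d * y)" for y
      by (simp add: e_def d_def cis_cnj cis_mult algebra_simps)
    have "((\<lambda>y. cis (d * y)) has_integral (cis (d * (1/2)) / (\<i> * d) - cis (d * (-1/2)) / (\<i> * d))) {-1/2..1/2}"
    proof (rule fundamental_theorem_of_calculus)
      fix x :: real
      have "((\<lambda>z. exp (\<i> * d * z) / (\<i> * d)) has_field_derivative exp (\<i> * d * of_real x)) (at (of_real x))"
        using d by (auto intro!: derivative_eq_intros)
      from has_vector_derivative_real_field[OF this]
      show "((\<lambda>y. cis (d * y) / (\<i> * d)) has_vector_derivative cis (d * x)) (at x within {- 1/2..1/2})"
        by (simp add: cis_conv_exp mult.assoc)
    qed simp
    moreover have "cis (d * (1/2)) = cis (d * (-1/2))"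
    proof -
      have "cis (d * (1/2)) = cis (d * (-1/2) + 2 * pi * of_int (k - l))" by (simp add: d_def algebra_simps)
      also have "\<dots> = cis (d * (-1/2))" by (subst cis_mult[symmetric]) (simp add: cis_multiple_2pi)
      finally show ?thesis .
    qed
    ultimately have "((\<lambda>y. cis (d * y)) has_integral 0) {-1/2..1/2}" by simp
    moreover have "set_integrable lborel {-1/2..1/2} (\<lambda>y. cis (d * y))"
      by (rule borel_integrable_atLeastAtMost') (auto simp: cis_conv_exp intro!: continuous_intros)
    ultimately have "set_lebesgue_integral lborel {-1/2..1/2} (\<lambda>y. cis (d * y)) = 0"
      by (metis has_integral_iff set_borel_integral_eq_integral(2))
    moreover have "(LBINT y. indicator I y *\<^sub>R cis (d * y)) = set_lebesgue_integral lborel {-1/2..1/2} (\<lambda>y. cis (d * y))"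
      unfolding set_lebesgue_integral_def
      by (intro integral_cong_AE) (auto simp: I_def intro!: AE_I[where N="{1/2}"] split: split_indicator)
    ultimately have "integral\<^sup>L M (\<lambda>y. cis (d * y)) = 0" by (simp add: M_int)
    moreover have "integrable M (\<lambda>y. cis (d * y))" by (rule intM[of _ 1]) auto
    ultimately show ?thesis using False by (simp add: has_bochner_integral_iff e)
  qed

  \<comment> \<open>Unfolding: the translates of the half-open interval tile the line.\<close>
  have coeff_f: "integral\<^sup>L M (\<lambda>y. of_real (f y) * cnj (e k y)) = hhat k" for k
  proof (rule LIMSEQ_unique)
    show "(\<lambda>N. integral\<^sup>L M (\<lambda>y. of_real (F N y) * cnj (e k y))) \<longlonglongrightarrow> integral\<^sup>L M (\<lambda>y. of_real (f y) * cnj (e k y))"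
    proof (rule integral_dominated_convergence)
      show "integrable M (\<lambda>_. 4 * C + suminf S)" by simp
      show "AE y in M. (\<lambda>N. of_real (F N y) * cnj (e k y)) \<longlonglongrightarrow> of_real (f y) * cnj (e k y)"
        by (intro AE_I2 tendsto_mult tendsto_of_real F_lim tendsto_const) (simp add: spM)
      show "AE y in M. norm (of_real (F N y) * cnj (e k y)) \<le> 4 * C + suminf S" for N
        using F_bd by (intro AE_I2) (simp add: spM norm_mult e_def)
      show "(\<lambda>y. of_real (F N y) * cnj (e k y)) \<in> borel_measurable M" for N
        unfolding F_def e_def by (intro bM) measurable
      show "(\<lambda>y. of_real (f y) * cnj (e k y)) \<in> borel_measurable M"
        unfolding e_def by (intro bM) measurable
    qed
    define H where "H y = of_real (h y) * cnj (e k y)" for y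
    have "has_bochner_integral lborel H (hhat k)"
      using hhat[of k] unfolding H_def[abs_def] e_def cis_cnj .
    hence intH: "integrable lborel H" and integral_H: "integral\<^sup>L lborel H = hhat k"
      by (auto simp only: has_bochner_integral_iff)
    have H_shift: "H (y + of_int n) = of_real (h (y + of_int n)) * cnj (e k y)" for y n
    proof -
      have "e k (y + of_int n) = e k y * cis (2 * pi * of_int (k * n))"
        by (simp add: e_def cis_mult algebra_simps)
      also have "\<dots> = e k y" by (simp only: cis_multiple_2pi Ints_of_int mult_1_right)
      finally show ?thesis by (simp add: H_def)
    qed
    have piece: "has_bochner_integral lborel (\<lambda>y. indicator I y *\<^sub>R H (y + t)) (LBINT y. indicator I (y - t) *\<^sub>R H y)" for t
    proof -
      have "integrable lborel (\<lambda>y. indicator I (y - t) *\<^sub>R H y)"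
        by (rule Bochner_Integration.integrable_bound[OF intH]) (use intH in \<open>auto split: split_indicator\<close>)
      hence "has_bochner_integral lborel (\<lambda>y. indicator I (y - t) *\<^sub>R H y) (LBINT y. indicator I (y - t) *\<^sub>R H y)"
        by (simp add: has_bochner_integral_iff)
      from lborel_has_bochner_integral_real_affine_iff[of 1 _ _ t, THEN iffD1, OF _ this]
      show ?thesis by (simp add: add_ac)
    qed
    have "integral\<^sup>L M (\<lambda>y. of_real (F N y) * cnj (e k y)) = (LBINT y. indicator {- real N - 1/2..<real N + 1/2} y *\<^sub>R H y)" for N
    proof -
      have FN: "of_real (F N y) * cnj (e k y) = H (y + 0) + (\<Sum>n<N. H (y + real (Suc n)) + H (y + - real (Suc n)))" for y
        using H_shift[of y "int (Suc _)"] H_shift[of y "- int (Suc _)"]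
        by (simp del: of_nat_Suc add: F_def H_def[of y] sum_distrib_right sum_distrib_left distrib_right)
      have intI: "integrable lborel (\<lambda>y. indicator I (y - t) *\<^sub>R H y)" for t
        by (rule Bochner_Integration.integrable_bound[OF intH]) (use intH in \<open>auto split: split_indicator\<close>)
      have "has_bochner_integral lborel (\<lambda>y. indicator I y *\<^sub>R H (y + 0) +
          (\<Sum>n<N. indicator I y *\<^sub>R H (y + real (Suc n)) + indicator I y *\<^sub>R H (y + - real (Suc n))))
          ((LBINT y. indicator I (y - 0) *\<^sub>R H y) + (\<Sum>n<N. (LBINT y. indicator I (y - real (Suc n)) *\<^sub>R H y)
             + (LBINT y. indicator I (y - - real (Suc n)) *\<^sub>R H y)))"
        by (intro has_bochner_integral_add has_bochner_integral_sum piece)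
      hence "integral\<^sup>L M (\<lambda>y. of_real (F N y) * cnj (e k y)) =
        (LBINT y. indicator I (y - 0) *\<^sub>R H y) + (\<Sum>n<N. (LBINT y. indicator I (y - real (Suc n)) *\<^sub>R H y)
             + (LBINT y. indicator I (y - - real (Suc n)) *\<^sub>R H y))"
        unfolding M_int FN by (simp add: has_bochner_integral_iff scaleR_right_distrib scaleR_right.sum)
      also have "\<dots> = (LBINT y. indicator I (y - 0) *\<^sub>R H y + (\<Sum>n<N. indicator I (y - real (Suc n)) *\<^sub>R H y
             + indicator I (y - - real (Suc n)) *\<^sub>R H y))"
        using intI[of 0] intI[of "real (Suc _)"] intI[of "- real (Suc _)"] 
        by (simp add: Bochner_Integration.integral_add Bochner_Integration.integral_sum del: of_nat_Suc)
      also have "(\<lambda>y. indicator I (y - 0) *\<^sub>R H y + (\<Sum>n<N. indicator I (y - real (Suc n)) *\<^sub>R H y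
             + indicator I (y - - real (Suc n)) *\<^sub>R H y)) = (\<lambda>y. indicator {- real N - 1/2..<real N + 1/2} y *\<^sub>R H y)"
      proof
        fix y
        have "indicator I y + (\<Sum>n<N. indicator I (y - real (Suc n)) + indicator I (y + real (Suc n)))
            = (indicator {-real N-1/2..<real N+1/2} y :: real)"
          by (induction N) (auto simp: I_def split: split_indicator)
        from this[symmetric] show "indicator I (y - 0) *\<^sub>R H y + (\<Sum>n<N. indicator I (y - real (Suc n)) *\<^sub>R H y
             + indicator I (y - - real (Suc n)) *\<^sub>R H y) = indicator {- real N - 1/2..<real N + 1/2} y *\<^sub>R H y"
          by (simp add: scaleR_left.add scaleR_left.sum del: of_nat_Suc)
      qed
      finally show ?thesis .
    qed
    moreover have "(\<lambda>N::nat. LBINT y. indicator {- real N - 1/2..<real N + 1/2} y *\<^sub>R H y) \<longlonglongrightarrow> integral\<^sup>L lborel H"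
    proof (rule integral_dominated_convergence[where w = "\<lambda>y. norm (H y)"])
      show "AE y in lborel. (\<lambda>N::nat. indicator {- real N - 1/2..<real N + 1/2} y *\<^sub>R H y) \<longlonglongrightarrow> H y"
      proof (rule AE_I2, rule tendsto_eventually)
        fix y :: real
        obtain N0 :: nat where N0: "\<bar>y\<bar> < real N0" using reals_Archimedean2 by blast
        show "\<forall>\<^sub>F N::nat in sequentially. indicator {- real N - 1/2..<real N + 1/2} y *\<^sub>R H y = H y"
          using eventually_ge_at_top[of N0] by eventually_elim (use N0 in \<open>auto split: split_indicator\<close>)
      qed
      show "integrable lborel (\<lambda>y. norm (H y))" using intH by (rule integrable_norm)
      show "H \<in> borel_measurable lborel" using intH by (rule borel_measurable_integrable)
      thus "(\<lambda>y. indicator {- real N - 1/2..<real N + 1/2} y *\<^sub>R H y) \<in> borel_measurable lborel" for N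
        by measurable
      show "AE y in lborel. norm (indicator {- real N - 1/2..<real N + 1/2} y *\<^sub>R H y) \<le> norm (H y)" for N
        by (rule AE_I2) (simp split: split_indicator)
    qed
    ultimately show "(\<lambda>N. integral\<^sup>L M (\<lambda>y. of_real (F N y) * cnj (e k y))) \<longlonglongrightarrow> hhat k"
      by (simp only: integral_H)
  qed

  \<comment> \<open>Dividing by \<open>e 1 - 1\<close> turns the Fourier series of \<open>f - f 0\<close> into a telescoping sum.\<close>
  define g where "g y = of_real (f y - f 0) / (e 1 y - 1)" for y
  define B where "B = 4 * C + suminf S"
  have B: "B \<ge> 0" using C summable_S by (auto simp: B_def S_def intro!: add_nonneg_nonneg suminf_nonneg)
  have g_bd: "cmod (g y) \<le> B" if y: "y \<in> I" for y
  proof (cases "y = 0")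
    case False
    have "\<bar>y\<bar> \<le> cmod (e 1 y - 1)" using cis_minus_1_ge[of y] y by (auto simp: e_def I_def)
    hence "cmod (g y) \<le> B * \<bar>y\<bar> / \<bar>y\<bar>"
      unfolding g_def norm_divide using f_lip[OF y] False
      by (intro frac_le) (auto simp: B_def simp flip: of_real_diff)
    thus ?thesis using False by simp
  qed (use B in \<open>simp add: g_def\<close>)
  have meas_g [measurable]: "g \<in> borel_measurable borel"
    unfolding g_def e_def by measurable
  have meas_ek [measurable]: "e k \<in> borel_measurable borel" for k unfolding e_def by measurable
  define c where "c k = integral\<^sup>L M (\<lambda>y. g y * cnj (e k y))" for k
  have int_g: "integrable M (\<lambda>y. g y * cnj (e k y))" for k
    by (rule intM[of _ B], measurable) (use g_bd in \<open>auto simp: norm_mult e_def\<close>)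
  have f_bd: "\<bar>f y\<bar> \<le> B" if y: "y \<in> I" for y
  proof (rule tendsto_upperbound)
    show "(\<lambda>N. \<bar>F N y\<bar>) \<longlonglongrightarrow> \<bar>f y\<bar>" by (intro tendsto_rabs F_lim y)
    show "\<forall>\<^sub>F N in sequentially. \<bar>F N y\<bar> \<le> B"
      unfolding B_def by (intro always_eventually allI F_bd y)
  qed simp
  have meas_fe: "(\<lambda>y. of_real (f y) * cnj (e k y)) \<in> borel_measurable borel" for k
    by measurable
  have norm_fe: "cmod (of_real (f y) * cnj (e k y)) \<le> B" if "y \<in> I" for y k
    using f_bd[OF that] by (simp add: norm_mult e_def)
  have int_f: "integrable M (\<lambda>y. of_real (f y) * cnj (e k y))" for k
    by (rule intM[OF meas_fe norm_fe])
  have coeff: "hhat k - of_real (f 0) * of_bool (k = 0) = c (k - 1) - c k" for k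
  proof -
    have "of_real (f y) * cnj (e k y) - of_real (f 0) * (e 0 y * cnj (e k y)) = g y * cnj (e (k - 1) y) - g y * cnj (e k y)"
      if "y \<in> I" for y
    proof -
      have k: "cnj (e (k - 1) y) = e 1 y * cnj (e k y)"
        by (simp add: e_def cis_cnj cis_mult algebra_simps)
      \<comment> \<open>At y = 0 the quotient is 0 by the convention for division by zero, and both
        sides of the product identity vanish.\<close>
      have g: "g y * (e 1 y - 1) = of_real (f y - f 0)"
      proof (cases "y = 0")
        case True
        thus ?thesis by (simp only: e_def) simp
      next
        case False
        have "\<bar>y\<bar> \<le> 1 / 2" using that by (auto simp: I_def)
        from cis_minus_1_ge[OF this] False have "e 1 y - 1 \<noteq> 0" by (auto simp: e_def)
        thus ?thesis by (simp add: g_def)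
      qed
      have "e 0 y = 1" by (simp add: e_def)
      hence "of_real (f y) * cnj (e k y) - of_real (f 0) * (e 0 y * cnj (e k y)) = of_real (f y - f 0) * cnj (e k y)"
        by (simp only: of_real_diff left_diff_distrib mult_1)
      also have "\<dots> = g y * (e 1 y * cnj (e k y)) - g y * cnj (e k y)"
        unfolding g[symmetric] by (simp add: algebra_simps)
      finally show ?thesis unfolding k .
    qed
    hence 1: "integral\<^sup>L M (\<lambda>y. of_real (f y) * cnj (e k y) - of_real (f 0) * (e 0 y * cnj (e k y))) =
        integral\<^sup>L M (\<lambda>y. g y * cnj (e (k - 1) y) - g y * cnj (e k y))"
      by (intro Bochner_Integration.integral_cong) (auto simp: spM)
    have 2: "integral\<^sup>L M (\<lambda>y. g y * cnj (e (k - 1) y) - g y * cnj (e k y)) = c (k - 1) - c k" using int_g by (simp add: c_def)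
    have 3: "integral\<^sup>L M (\<lambda>y. of_real (f y) * cnj (e k y) - of_real (f 0) * (e 0 y * cnj (e k y))) =
        hhat k - of_real (f 0) * of_bool (0 = k)"
      using orth[of 0 k] unfolding has_bochner_integral_iff
      by (subst Bochner_Integration.integral_diff[OF int_f]) (simp_all only: integrable_mult_right integral_mult_right_zero coeff_f)
    show ?thesis using 3[symmetric] by (simp only: 1 2 eq_commute[of 0 k])
  qed
  \<comment> \<open>A Riemann-Lebesgue lemma for the bounded function \<open>g\<close>: Bessel
    bounds the partial sums of the squared coefficients along any injective enumeration. It is
    applied along both ends of the integers.\<close>
  have c_lim: "(\<lambda>n. c (\<phi> n)) \<longlonglongrightarrow> 0" if inj: "inj \<phi>" for \<phi> :: "nat \<Rightarrow> int"
  proof -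
    have "summable (\<lambda>n. (cmod (c (\<phi> n)))\<^sup>2)"
    proof (rule summableI_nonneg_bounded)
      fix N
      have "(\<Sum>n<N. (cmod (c (\<phi> n)))\<^sup>2) = (\<Sum>k\<in>\<phi> ` {..<N}. (cmod (c k))\<^sup>2)"
        by (subst sum.reindex) (use inj in \<open>auto intro: inj_on_subset\<close>)
      also have "\<dots> \<le> integral\<^sup>L M (\<lambda>x. (cmod (g x))\<^sup>2)"
        unfolding c_def
      proof (rule bessel_inequality)
        show "integrable M (\<lambda>x. g x * cnj (g x))"
          by (rule intM[of _ "B * B"], measurable) (use g_bd in \<open>auto simp: norm_mult intro!: mult_mono B\<close>)
      qed (simp, rule int_g, rule orth)
      finally show "(\<Sum>n<N. (cmod (c (\<phi> n)))\<^sup>2) \<le> integral\<^sup>L M (\<lambda>x. (cmod (g x))\<^sup>2)" .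
    qed auto
    from tendsto_real_sqrt[OF summable_LIMSEQ_zero[OF this]]
    show ?thesis by (simp add: tendsto_norm_zero_iff)
  qed
  \<comment> \<open>The lower boundary index is -N - 1, since the coefficient at k contributes
    \<open>c (k - 1)\<close>; the term \<open>f 0\<close> comes from k = 0.\<close>
  have "(\<Sum>k=-int N..int N. hhat k) = of_real (f 0) + c (- int (Suc N)) - c (int N)" for N
  proof (induction N)
    case 0
    show ?case using coeff[of 0] by (simp add: algebra_simps)
  next
    case (Suc N)
    have "{-int (Suc N)..int (Suc N)} = insert (- int (Suc N)) (insert (int (Suc N)) {-int N..int N})"
      by auto
    hence "(\<Sum>k=-int (Suc N)..int (Suc N). hhat k) = hhat (- int (Suc N)) + (hhat (int (Suc N)) + (\<Sum>k=-int N..int N. hhat k))"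
      by simp
    moreover have "hhat (- int (Suc N)) = c (- int (Suc (Suc N))) - c (- int (Suc N))"
      "hhat (int (Suc N)) = c (int N) - c (int (Suc N))"
      using coeff[of "- int (Suc N)"] coeff[of "int (Suc N)"] by (simp_all add: algebra_simps)
    ultimately show ?case using Suc by (simp only:) simp
  qed
  moreover have "(\<lambda>N. of_real (f 0) + c (- int (Suc N)) - c (int N)) \<longlonglongrightarrow> of_real (f 0) + 0 - 0"
    using c_lim[of "\<lambda>N. - int (Suc N)"] c_lim[of int]
    by (intro tendsto_add tendsto_diff tendsto_const) (simp_all add: inj_def)
  ultimately show ?thesis by (simp add: f_def)
qed

subsection \<open>The theta function and its duplication formulas\<close>

lemma summable_inverse_Suc_squares: "summable (\<lambda>n. 1 / (real (Suc n))\<^sup>2)"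
  using sums_summable[OF inverse_squares_sums] by (simp add: add.commute)

lemma exp_minus_le_inverse:
  fixes x :: real
  assumes "x > 0"
  shows "exp (- x) \<le> 1 / x"
proof -
  have "x \<le> exp x" using exp_ge_add_one_self[of x] by linarith
  thus ?thesis using assms by (simp add: exp_minus field_simps)
qed

lemma summable_gaussian:
  fixes c :: real
  assumes "c > 0"
  shows "summable (\<lambda>n. exp (- (c * (real (Suc n))\<^sup>2)))"
proof (rule summable_comparison_test')
  show "summable (\<lambda>n. 1 / c * (1 / (real (Suc n))\<^sup>2))"
    by (rule summable_mult[OF summable_inverse_Suc_squares])
  show "norm (exp (- (c * (real (Suc n))\<^sup>2))) \<le> 1 / c * (1 / (real (Suc n))\<^sup>2)" for n
    using exp_minus_le_inverse[of "c * (real (Suc n))\<^sup>2"] assms by (simp del: of_nat_Suc)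
qed

text \<open>Links two forms of the theta series: the unordered sum over the integers, which can be
  rearranged, and the series over positive n, which can be estimated.\<close>

lemma has_sum_int_even:
  fixes f :: "int \<Rightarrow> real"
  assumes even: "\<And>n. f (- n) = f n"
    and summ: "summable (\<lambda>n. norm (f (int (Suc n))))"
  shows "(f has_sum (f 0 + 2 * (\<Sum>n. f (int (Suc n))))) UNIV"
proof -
  define S where "S = (\<Sum>n. f (int (Suc n)))"
  have "(\<lambda>n. f (int (Suc n))) sums S"
    unfolding S_def by (rule summable_sums[OF summable_norm_cancel[OF summ]])
  hence S: "((\<lambda>n. f (int (Suc n))) has_sum S) UNIV"
    by (rule norm_summable_imp_has_sum[OF summ])
  have pos: "(f has_sum S) (range (\<lambda>n. int (Suc n)))"
    by (subst has_sum_reindex) (use S in \<open>auto simp: inj_def o_def\<close>)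
  have neg: "(f has_sum S) (range (\<lambda>n. - int (Suc n)))"
    by (subst has_sum_reindex) (use S in \<open>auto simp: inj_def o_def even simp del: of_nat_Suc\<close>)
  have zero: "(f has_sum f 0) {0}"
    using has_sum_finite[of "{0}" f] by simp
  have "(f has_sum (f 0 + (S + S))) ({0} \<union> (range (\<lambda>n. int (Suc n)) \<union> range (\<lambda>n. - int (Suc n))))"
    by (intro has_sum_Un_disjoint zero pos neg) auto
  also have "{0} \<union> (range (\<lambda>n. int (Suc n)) \<union> range (\<lambda>n. - int (Suc n))) = (UNIV :: int set)"
  proof (intro set_eqI iffI UNIV_I)
    fix k :: int
    show "k \<in> {0} \<union> (range (\<lambda>n. int (Suc n)) \<union> range (\<lambda>n. - int (Suc n)))"
    proof (cases k rule: int_cases3)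
      case (pos n)
      then obtain m where "n = Suc m" by (cases n) auto
      with pos show ?thesis by auto
    next
      case (neg n)
      then obtain m where "n = Suc m" by (cases n) auto
      with neg show ?thesis by auto
    qed auto
  qed
  finally show ?thesis by (simp add: S_def)
qed

text \<open>Unordered summability of real families is absolute, so the product family is summable
  over the grid. This writes products of theta values as sums over a planar lattice.\<close>

lemma has_sum_times:
  fixes f :: "'a \<Rightarrow> real" and g :: "'b \<Rightarrow> real"
  assumes f: "(f has_sum a) A" and g: "(g has_sum b) B"
  shows "((\<lambda>(x, y). f x * g y) has_sum (a * b)) (A \<times> B)"
proof (rule has_sum_SigmaI)
  show "((\<lambda>y. case (x, y) of (x, y) \<Rightarrow> f x * g y) has_sum (f x * b)) B" for x
    using has_sum_cmult_right[OF g, of "f x"] by simp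
  show "((\<lambda>x. f x * b) has_sum (a * b)) A"
    by (rule has_sum_cmult_left[OF f])
  have f': "(\<lambda>x. \<bar>f x\<bar>) summable_on A" and g': "(\<lambda>y. \<bar>g y\<bar>) summable_on B"
    using f g summable_on_iff_abs_summable_on_real[of f A] summable_on_iff_abs_summable_on_real[of g B]
    by (auto simp: summable_on_def)
  have "(\<lambda>p. norm (case p of (x, y) \<Rightarrow> f x * g y)) summable_on A \<times> B"
    unfolding Infinite_Sum.abs_summable_on_Sigma_iff
  proof (intro conjI ballI)
    show "(\<lambda>y. norm (case (x, y) of (x, y) \<Rightarrow> f x * g y)) summable_on B" for x
      using summable_on_cmult_right[OF g', of "\<bar>f x\<bar>"] by (simp add: abs_mult)
    have "(\<lambda>x. \<bar>f x\<bar> * (\<Sum>\<^sub>\<infinity>y\<in>B. \<bar>g y\<bar>)) summable_on A"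
      by (rule summable_on_cmult_left[OF f'])
    moreover have "(\<Sum>\<^sub>\<infinity>y\<in>B. norm (case (x, y) of (x, y) \<Rightarrow> f x * g y)) = \<bar>f x\<bar> * (\<Sum>\<^sub>\<infinity>y\<in>B. \<bar>g y\<bar>)" for x
      using infsum_cmult_right'[of "\<bar>f x\<bar>" "\<lambda>y. \<bar>g y\<bar>" B] by (simp add: abs_mult)
    moreover have "0 \<le> (\<Sum>\<^sub>\<infinity>y\<in>B. \<bar>g y\<bar>)" by (rule infsum_nonneg) simp
    ultimately show "(\<lambda>x. norm (\<Sum>\<^sub>\<infinity>y\<in>B. norm (case (x, y) of (x, y) \<Rightarrow> f x * g y))) summable_on A"
      by (simp add: abs_mult)
  qed
  thus "(\<lambda>(x, y). f x * g y) summable_on A \<times> B"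
    by (rule Infinite_Sum.abs_summable_summable)
qed

text \<open>Jacobi's theta constant with nome q = exp (- pi x). The unordered sum is chosen because
  products are rearranged over pairs of integers.\<close>

definition theta3 :: "real \<Rightarrow> real" where
  "theta3 x = (\<Sum>\<^sub>\<infinity>n::int. exp (- (pi * x * (of_int n)\<^sup>2)))"

definition theta4 :: "real \<Rightarrow> real" where
  "theta4 x = (\<Sum>\<^sub>\<infinity>n::int. (if even n then 1 else -1) * exp (- (pi * x * (of_int n)\<^sup>2)))"

lemma theta3_has_sum_sums:
  assumes "x > 0"
  shows "((\<lambda>n::int. exp (- (pi * x * (of_int n)\<^sup>2))) has_sum
           (1 + 2 * (\<Sum>n. exp (- (pi * x * (real (Suc n))\<^sup>2))))) UNIV"
  using has_sum_int_even[of "\<lambda>n::int. exp (- (pi * x * (of_int n)\<^sup>2))"]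
    summable_gaussian[of "pi * x"] assms by simp

lemma theta3_has_sum:
  "x > 0 \<Longrightarrow> ((\<lambda>n::int. exp (- (pi * x * (of_int n)\<^sup>2))) has_sum theta3 x) UNIV"
  using theta3_has_sum_sums unfolding theta3_def by (metis infsumI)

lemma theta3_eq:
  "x > 0 \<Longrightarrow> theta3 x = 1 + 2 * (\<Sum>n. exp (- (pi * x * (real (Suc n))\<^sup>2)))"
  using theta3_has_sum_sums unfolding theta3_def by (metis infsumI)

lemma theta4_has_sum:
  assumes "x > 0"
  shows "((\<lambda>n::int. (if even n then 1 else -1) * exp (- (pi * x * (of_int n)\<^sup>2))) has_sum theta4 x) UNIV"
proof -
  define f where "f n = (if even n then 1 else -1) * exp (- (pi * x * (of_int n)\<^sup>2))" for n :: int
  have norm_f: "norm (f n) = exp (- (pi * x * (of_int n)\<^sup>2))" for n by (simp add: f_def abs_mult)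
  have f: "(f has_sum (f 0 + 2 * (\<Sum>n. f (int (Suc n))))) UNIV"
  proof (rule has_sum_int_even)
    show "f (- n) = f n" for n by (simp add: f_def)
    show "summable (\<lambda>n. norm (f (int (Suc n))))"
      unfolding norm_f of_int_of_nat_eq by (rule summable_gaussian) (use assms in auto)
  qed
  have "theta4 x = infsum f UNIV" by (simp only: theta4_def f_def[abs_def])
  with f have "(f has_sum theta4 x) UNIV" by (simp only: infsumI[OF f])
  thus ?thesis by (simp only: f_def[abs_def])
qed

lemma theta3_pos: "x > 0 \<Longrightarrow> theta3 x > 0"
  using theta3_eq[of x] suminf_nonneg[OF summable_gaussian[of "pi * x"]]
  by (simp add: add_pos_nonneg del: of_nat_Suc)

text \<open>The crude bound exp (- z) <= 1 / z replaces the series by the Basel sum pi^2 / 6. It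
  suffices for the limit at infinity and for the decay of \<open>psi\<close>.\<close>

lemma theta3_bound:
  assumes "x > 0"
  shows "\<bar>theta3 x - 1\<bar> \<le> pi / (3 * x)"
proof -
  have "(\<Sum>n. exp (- (pi * x * (real (Suc n))\<^sup>2))) \<le> (\<Sum>n. 1 / (pi * x) * (1 / (real (Suc n))\<^sup>2))"
  proof (intro suminf_le summable_gaussian summable_mult summable_inverse_Suc_squares)
    show "exp (- (pi * x * (real (Suc n))\<^sup>2)) \<le> 1 / (pi * x) * (1 / (real (Suc n))\<^sup>2)" for n
      using exp_minus_le_inverse[of "pi * x * (real (Suc n))\<^sup>2"] assms by (simp del: of_nat_Suc)
  qed (use assms in auto)
  also have "\<dots> = 1 / (pi * x) * (pi\<^sup>2 / 6)"
    using sums_mult[OF inverse_squares_sums, of "1 / (pi * x)"] by (simp add: sums_iff add.commute)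
  also have "\<dots> = pi / (6 * x)" using assms by (simp add: power2_eq_square)
  finally have "2 * (\<Sum>n. exp (- (pi * x * (real (Suc n))\<^sup>2))) \<le> pi / (3 * x)"
    by (simp add: field_simps)
  moreover have "0 \<le> (\<Sum>n. exp (- (pi * x * (real (Suc n))\<^sup>2)))"
    by (intro suminf_nonneg summable_gaussian) (use assms in auto)
  ultimately show ?thesis unfolding theta3_eq[OF assms] by simp
qed

lemma theta3_tendsto: "(theta3 \<longlongrightarrow> 1) at_top"
proof -
  have "((\<lambda>x. theta3 x - 1) \<longlongrightarrow> 0) at_top"
  proof (rule Lim_null_comparison)
    show "\<forall>\<^sub>F x in at_top. norm (theta3 x - 1) \<le> pi / 3 * inverse x"
      using eventually_gt_at_top[of 0]
    proof eventually_elim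
      case (elim x)
      thus ?case using theta3_bound[OF elim] by (simp add: inverse_eq_divide)
    qed
    show "((\<lambda>x. pi / 3 * inverse x) \<longlongrightarrow> 0) at_top"
      by (intro tendsto_mult_right_zero tendsto_inverse_0_at_top filterlim_ident)
  qed
  thus ?thesis by (simp add: LIM_zero_iff)
qed

text \<open>Poisson summation for the Gaussian exp (- pi x t^2), whose Fourier transform at k is
  sqrt (1 / x) exp (- pi k^2 / x).\<close>

theorem theta3_inversion:
  assumes x: "x > 0"
  shows "theta3 (1 / x) = sqrt x * theta3 x"
proof -
  define a where "a = pi * x"
  have a: "a > 0" using x by (simp add: a_def)
  \<comment> \<open>Chosen so that m (1 + t^2) <= 1 + (a / 2) t^2 <= exp ((a / 2) t^2). Squaring
    gives decay of order (1 + t^2)^(-2), which leaves room for the factor t in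
    \<open>h'\<close>.\<close>
  define m where "m = min 1 (a / 2)"
  have m: "m > 0" "m \<le> 1" "m \<le> a / 2" using a by (auto simp: m_def)
  define h where "h t = exp (- (a * t\<^sup>2))" for t :: real
  define h' where "h' t = - (2 * a * t) * exp (- (a * t\<^sup>2))" for t :: real
  have sq: "exp (- (a * t\<^sup>2)) \<le> 1 / (m\<^sup>2 * (1 + t\<^sup>2)\<^sup>2)" for t :: real
  proof -
    have "m * (1 + t\<^sup>2) \<le> 1 + a / 2 * t\<^sup>2"
      using m mult_right_mono[of m "a / 2" "t\<^sup>2"] by (simp add: distrib_left)
    also have "\<dots> \<le> exp (a / 2 * t\<^sup>2)" by (rule exp_ge_add_one_self)
    finally have "(m * (1 + t\<^sup>2))\<^sup>2 \<le> (exp (a / 2 * t\<^sup>2))\<^sup>2"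
      using m by (intro power_mono) auto
    also have "\<dots> = exp (a * t\<^sup>2)" by (simp flip: exp_double)
    finally have *: "m\<^sup>2 * (1 + t\<^sup>2)\<^sup>2 \<le> exp (a * t\<^sup>2)" by (simp add: power_mult_distrib)
    have "0 < m\<^sup>2 * (1 + t\<^sup>2)\<^sup>2" using m by (intro mult_pos_pos zero_less_power add_pos_nonneg) auto
    from le_imp_inverse_le[OF * this] show ?thesis by (simp add: exp_minus divide_inverse)
  qed
  \<comment> \<open>One constant for both bounds: 1 / m^2 serves \<open>h\<close>, and 2 a / m^2
    serves \<open>h'\<close>.\<close>
  define C where "C = (1 + 2 * a) / m\<^sup>2"
  have pos: "0 < 1 + t\<^sup>2" for t :: real by (intro add_pos_nonneg) auto
  have hC: "\<bar>h t\<bar> \<le> C / (1 + t\<^sup>2)" for t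
  proof -
    have "1 + t\<^sup>2 \<le> (1 + t\<^sup>2)\<^sup>2" by (rule self_le_power) auto
    hence "1 / (m\<^sup>2 * (1 + t\<^sup>2)\<^sup>2) \<le> 1 / (m\<^sup>2 * (1 + t\<^sup>2))"
      using m pos[of t] by (intro divide_left_mono mult_left_mono mult_pos_pos) auto
    also have "\<dots> = (1 / m\<^sup>2) / (1 + t\<^sup>2)" by simp
    also have "\<dots> \<le> C / (1 + t\<^sup>2)"
      unfolding C_def using m a pos[of t] by (intro divide_right_mono) auto
    finally show ?thesis using sq[of t] by (simp add: h_def)
  qed
  have h'C: "\<bar>h' t\<bar> \<le> C / (1 + t\<^sup>2)" for t
  proof -
    have t: "\<bar>t\<bar> \<le> 1 + t\<^sup>2"
      using zero_le_power2[of "\<bar>t\<bar> - 1/2"] by (simp add: power2_diff) (simp add: power2_eq_square)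
    have "\<bar>h' t\<bar> = (2 * a * \<bar>t\<bar>) * exp (- (a * t\<^sup>2))" using a by (simp add: h'_def abs_mult)
    also have "\<dots> \<le> (2 * a * (1 + t\<^sup>2)) * (1 / (m\<^sup>2 * (1 + t\<^sup>2)\<^sup>2))"
      using t a by (intro mult_mono sq mult_left_mono) auto
    also have "\<dots> = (2 * a / m\<^sup>2) / (1 + t\<^sup>2)"
      using pos[of t] m by (simp add: power2_eq_square)
    also have "\<dots> \<le> C / (1 + t\<^sup>2)"
      unfolding C_def using m a pos[of t] by (intro divide_right_mono) auto
    finally show ?thesis .
  qed
  define g where "g k = sqrt (1 / x) * exp (- (pi * (1 / x) * k\<^sup>2))" for k :: real
  have "(\<lambda>N. \<Sum>k=-int N..int N. complex_of_real (g (of_int k))) \<longlonglongrightarrow> of_real (h 0 + (\<Sum>n. h (Suc n) + h (- real (Suc n))))"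
  proof (rule poisson_summation[of h h' C])
    show "(h has_real_derivative h' t) (at t)" for t
      unfolding h_def h'_def by (auto intro!: derivative_eq_intros)
    show "has_bochner_integral lborel (\<lambda>y. of_real (h y) * cis (- (2 * pi * of_int k * y))) (of_real (g (of_int k)))" for k
    proof -
      have "pi / a = 1 / x" using x by (simp add: a_def)
      moreover have "(- (2 * pi * of_int k))\<^sup>2 / (4 * a) = pi * (1 / x) * (real_of_int k)\<^sup>2"
        using x by (simp add: a_def power2_eq_square)
      ultimately show ?thesis
        using gaussian_fourier[OF a, of "- (2 * pi * of_int k)"] by (simp add: h_def g_def)
    qed
  qed (use hC h'C in auto)
  moreover have "h 0 + (\<Sum>n. h (Suc n) + h (- real (Suc n))) = theta3 x"
    using suminf_mult[OF summable_gaussian[OF a], of 2] by (simp add: theta3_eq[OF x] h_def a_def del: of_nat_Suc)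
  moreover have "(\<Sum>k=-int N..int N. g (of_int k)) = g 0 + 2 * (\<Sum>n<N. g (real (Suc n)))" for N
  proof (induction N)
    case (Suc N)
    have "{-int (Suc N)..int (Suc N)} = insert (- int (Suc N)) (insert (int (Suc N)) {-int N..int N})"
      by auto
    hence "(\<Sum>k=-int (Suc N)..int (Suc N). g (of_int k)) =
        g (of_int (- int (Suc N))) + (g (of_int (int (Suc N))) + (\<Sum>k=-int N..int N. g (of_int k)))"
      by simp
    moreover have "g (of_int (- int (Suc N))) = g (real (Suc N))" "g (of_int (int (Suc N))) = g (real (Suc N))"
      by (simp_all add: g_def del: of_nat_Suc)
    ultimately show ?case using Suc by simp
  qed simp
  ultimately have "(\<lambda>N. complex_of_real (g 0 + 2 * (\<Sum>n<N. g (real (Suc n))))) \<longlonglongrightarrow> of_real (theta3 x)"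
    by (simp only: of_real_sum[symmetric])
  hence 1: "(\<lambda>N. g 0 + 2 * (\<Sum>n<N. g (real (Suc n)))) \<longlonglongrightarrow> theta3 x"
    by (simp only: tendsto_of_real_iff)
  have summ: "summable (\<lambda>n. exp (- (pi * (1 / x) * (real (Suc n))\<^sup>2)))"
    by (rule summable_gaussian) (use x in auto)
  have "(\<lambda>N. g 0 + 2 * (\<Sum>n<N. g (real (Suc n)))) \<longlonglongrightarrow> g 0 + 2 * (sqrt (1 / x) * (\<Sum>n. exp (- (pi * (1 / x) * (real (Suc n))\<^sup>2))))"
    unfolding g_def sum_distrib_left[symmetric]
    by (intro tendsto_intros summable_LIMSEQ summ)
  also have "g 0 + 2 * (sqrt (1 / x) * (\<Sum>n. exp (- (pi * (1 / x) * (real (Suc n))\<^sup>2)))) = sqrt (1 / x) * theta3 (1 / x)"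
    using x by (subst theta3_eq) (auto simp: g_def algebra_simps)
  finally have "sqrt (1 / x) * theta3 (1 / x) = theta3 x"
    using 1 LIMSEQ_unique by blast
  thus ?thesis using x by (simp add: real_sqrt_divide field_simps)
qed

text \<open>In the sum of both series the odd terms cancel and the even ones double; n = 2 k turns x
  into 4 x.\<close>

lemma theta4_eq_theta3:
  assumes x: "x > 0"
  shows "theta4 x = 2 * theta3 (4 * x) - theta3 x"
proof -
  define q where "q n = exp (- (pi * x * (of_int n)\<^sup>2))" for n :: int
  have "((\<lambda>n::int. (if even n then 1 else -1) * q n + q n) has_sum (theta4 x + theta3 x)) UNIV"
    unfolding q_def by (intro has_sum_add theta4_has_sum theta3_has_sum x)
  hence "((\<lambda>n::int. 2 * q n) has_sum (theta4 x + theta3 x)) (range (\<lambda>n. 2 * n))"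
    by (subst (asm) has_sum_cong_neutral[where T = "range (\<lambda>n::int. 2 * n)" and g = "\<lambda>n. 2 * q n"])
       (auto elim!: evenE)
  hence "((\<lambda>n::int. 2 * q (2 * n)) has_sum (theta4 x + theta3 x)) UNIV"
    by (subst (asm) has_sum_reindex) (auto simp: inj_def o_def)
  moreover have "q (2 * n) = exp (- (pi * (4 * x) * (of_int n)\<^sup>2))" for n
    by (simp add: q_def power_mult_distrib)
  ultimately have "((\<lambda>n::int. 2 * exp (- (pi * (4 * x) * (of_int n)\<^sup>2))) has_sum (theta4 x + theta3 x)) UNIV"
    by simp
  moreover have "((\<lambda>n::int. 2 * exp (- (pi * (4 * x) * (of_int n)\<^sup>2))) has_sum (2 * theta3 (4 * x))) UNIV"
    using x by (intro has_sum_cmult_right theta3_has_sum) auto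
  ultimately show ?thesis using has_sum_unique by fastforce
qed

text \<open>Both formulas rest on the bijection \<open>(a, b) \<mapsto> (a + b, a - b)\<close> onto the pairs of equal parity.\<close>

lemma has_sum_even_lattice:
  fixes f g :: "int \<times> int \<Rightarrow> real"
  assumes "(f has_sum S) UNIV"
    and "\<And>m n. odd (m + n) \<Longrightarrow> f (m, n) = 0"
  shows "((\<lambda>(a, b). f (a + b, a - b)) has_sum S) UNIV"
proof -
  have inj: "inj (\<lambda>(a, b). (a + b, a - b :: int))" by (auto simp: inj_def)
  have "(f has_sum S) (range (\<lambda>(a, b). (a + b, a - b)))"
  proof (subst has_sum_cong_neutral[where T = UNIV and g = f])
    fix p :: "int \<times> int"
    assume p: "p \<in> UNIV - range (\<lambda>(a, b). (a + b, a - b))"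
    obtain m n where mn: "p = (m, n)" by (cases p)
    have "odd (m + n)"
    proof
      assume "even (m + n)"
      then obtain a where a: "m + n = 2 * a" by (elim evenE)
      hence "p = (\<lambda>(a, b). (a + b, a - b)) (a, m - a)" by (simp add: mn)
      hence "p \<in> range (\<lambda>(a, b). (a + b, a - b))" by (rule range_eqI)
      with p show False by simp
    qed
    thus "f p = 0" using assms(2) mn by simp
  qed (use assms in auto)
  thus ?thesis by (subst (asm) has_sum_reindex[OF inj]) (simp add: o_def case_prod_unfold)
qed

text \<open>The arithmetic mean half of the AGM step. The combined weight 1 + (-1)^(m + n) is 2 on
  pairs of equal parity and 0 elsewhere, and (a + b)^2 + (a - b)^2 = 2 a^2 + 2 b^2 doubles
  x.\<close>

lemma theta3_theta4_squares:
  assumes x: "x > 0"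
  shows "(theta3 x)\<^sup>2 + (theta4 x)\<^sup>2 = 2 * (theta3 (2 * x))\<^sup>2"
proof -
  define q where "q x n = exp (- (pi * x * (of_int n)\<^sup>2))" for x and n :: int
  define s :: "int \<Rightarrow> real" where "s n = (if even n then 1 else -1)" for n
  have 3: "(q x has_sum theta3 x) UNIV" if "x > 0" for x
    using theta3_has_sum[OF that] by (simp add: q_def[abs_def])
  have 4: "((\<lambda>n. s n * q x n) has_sum theta4 x) UNIV"
    using theta4_has_sum[OF x] by (simp add: q_def[abs_def] s_def[abs_def])
  have "((\<lambda>p. (case p of (m, n) \<Rightarrow> q x m * q x n) + (case p of (m, n) \<Rightarrow> (s m * q x m) * (s n * q x n)))
      has_sum (theta3 x * theta3 x + theta4 x * theta4 x)) (UNIV \<times> UNIV)"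
    by (intro has_sum_add has_sum_times 3 4 x)
  hence "((\<lambda>(m, n). (1 + s m * s n) * (q x m * q x n)) has_sum (theta3 x * theta3 x + theta4 x * theta4 x)) UNIV"
    by (simp add: case_prod_unfold algebra_simps)
  from has_sum_even_lattice[OF this]
  have "((\<lambda>(a, b). (1 + s (a + b) * s (a - b)) * (q x (a + b) * q x (a - b))) has_sum (theta3 x * theta3 x + theta4 x * theta4 x)) UNIV"
    by (simp add: s_def case_prod_unfold)
  moreover have "(1 + s (a + b) * s (a - b)) * (q x (a + b) * q x (a - b)) = 2 * (q (2 * x) a * q (2 * x) b)" for a b
  proof -
    have "q x (a + b) * q x (a - b) = q (2 * x) a * q (2 * x) b"
      by (simp add: q_def power2_eq_square algebra_simps flip: exp_add)
    moreover have "s (a + b) * s (a - b) = 1" by (simp add: s_def)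
    ultimately show ?thesis by simp
  qed
  ultimately have "((\<lambda>(a, b). 2 * (q (2 * x) a * q (2 * x) b)) has_sum (theta3 x * theta3 x + theta4 x * theta4 x)) UNIV"
    by simp
  moreover have "((\<lambda>p. 2 * (case p of (a, b) \<Rightarrow> q (2 * x) a * q (2 * x) b)) has_sum (2 * (theta3 (2 * x) * theta3 (2 * x)))) (UNIV \<times> UNIV)"
    using x by (intro has_sum_cmult_right has_sum_times 3) auto
  ultimately show ?thesis using has_sum_unique by (fastforce simp: power2_eq_square case_prod_unfold)
qed

text \<open>The geometric mean half. The product alone carries the weight (-1)^n, which does not
  vanish off the even lattice; adding the product in the other order gives (-1)^m + (-1)^n, which
  does, and which equals 2 (-1)^a (-1)^b at m = a + b, n = a - b.\<close>

lemma theta3_times_theta4: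
  assumes x: "x > 0"
  shows "theta3 x * theta4 x = (theta4 (2 * x))\<^sup>2"
proof -
  define q where "q x n = exp (- (pi * x * (of_int n)\<^sup>2))" for x and n :: int
  define s :: "int \<Rightarrow> real" where "s n = (if even n then 1 else -1)" for n
  have 3: "(q x has_sum theta3 x) UNIV"
    using theta3_has_sum[OF x] by (simp add: q_def[abs_def])
  have 4: "((\<lambda>n. s n * q x n) has_sum theta4 x) UNIV" if "x > 0" for x
    using theta4_has_sum[OF that] by (simp add: q_def[abs_def] s_def[abs_def])
  have "((\<lambda>p. (case p of (m, n) \<Rightarrow> q x m * (s n * q x n)) + (case p of (m, n) \<Rightarrow> (s m * q x m) * q x n))
      has_sum (theta3 x * theta4 x + theta4 x * theta3 x)) (UNIV \<times> UNIV)"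
    by (intro has_sum_add has_sum_times 3 4 x)
  hence "((\<lambda>(m, n). (s m + s n) * (q x m * q x n)) has_sum (theta3 x * theta4 x + theta4 x * theta3 x)) UNIV"
    by (simp add: case_prod_unfold algebra_simps)
  from has_sum_even_lattice[OF this]
  have "((\<lambda>(a, b). (s (a + b) + s (a - b)) * (q x (a + b) * q x (a - b))) has_sum (theta3 x * theta4 x + theta4 x * theta3 x)) UNIV"
    by (simp add: s_def case_prod_unfold)
  moreover have "(s (a + b) + s (a - b)) * (q x (a + b) * q x (a - b)) = 2 * ((s a * q (2 * x) a) * (s b * q (2 * x) b))" for a b
  proof -
    have "q x (a + b) * q x (a - b) = q (2 * x) a * q (2 * x) b"
      by (simp add: q_def power2_eq_square algebra_simps flip: exp_add)
    moreover have "s (a + b) + s (a - b) = 2 * (s a * s b)" by (simp add: s_def)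
    ultimately show ?thesis by simp
  qed
  ultimately have "((\<lambda>(a, b). 2 * ((s a * q (2 * x) a) * (s b * q (2 * x) b))) has_sum (theta3 x * theta4 x + theta4 x * theta3 x)) UNIV"
    by simp
  moreover have "((\<lambda>p. 2 * (case p of (a, b) \<Rightarrow> (s a * q (2 * x) a) * (s b * q (2 * x) b))) has_sum (2 * (theta4 (2 * x) * theta4 (2 * x)))) (UNIV \<times> UNIV)"
    using x by (intro has_sum_cmult_right has_sum_times 4) auto
  ultimately show ?thesis using has_sum_unique by (fastforce simp: power2_eq_square case_prod_unfold)
qed

lemma theta4_tendsto: "(theta4 \<longlongrightarrow> 1) at_top"
proof -
  have "((\<lambda>x. 2 * theta3 (4 * x) - theta3 x) \<longlongrightarrow> 2 * 1 - 1) at_top"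
    by (intro tendsto_intros theta3_tendsto filterlim_compose[OF theta3_tendsto]
        filterlim_tendsto_pos_mult_at_top[OF tendsto_const] filterlim_ident) auto
  hence "((\<lambda>x. 2 * theta3 (4 * x) - theta3 x) \<longlongrightarrow> 1) at_top" by simp
  thus ?thesis
    by (rule Lim_transform_eventually)
       (use eventually_gt_at_top[of 0] in \<open>eventually_elim, simp add: theta4_eq_theta3\<close>)
qed

text \<open>By \<open>theta3_times_theta4\<close> a zero at x propagates to every 2^n x, against the
  limit 1 at infinity.\<close>

lemma theta4_nonzero:
  assumes x: "x > 0"
  shows "theta4 x \<noteq> 0"
proof
  assume "theta4 x = 0"
  hence "theta4 (2 ^ n * x) = 0" for n
  proof (induction n)
    case (Suc n)
    thus ?case using theta3_times_theta4[of "2 ^ n * x"] x by (simp add: mult.assoc)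
  qed simp
  moreover have "(\<lambda>n. theta4 (2 ^ n * x)) \<longlonglongrightarrow> 1"
    by (rule filterlim_compose[OF theta4_tendsto])
       (use x in real_asymp)
  ultimately show False by (simp add: LIMSEQ_const_iff)
qed

subsection \<open>The arithmetic-geometric mean\<close>

text \<open>For positive a and b, x = b tan phi turns the integral over the line into Gauss's
  integral of 1 / sqrt (a^2 cos^2 phi + b^2 sin^2 phi) over (- pi / 2, pi / 2), classically pi
  divided by the arithmetic-geometric mean of a and b.\<close>

definition agm_integrand :: "real \<Rightarrow> real \<Rightarrow> real \<Rightarrow> real" where
  "agm_integrand a b x = 1 / sqrt ((x\<^sup>2 + a\<^sup>2) * (x\<^sup>2 + b\<^sup>2))"

definition agm_integral :: "real \<Rightarrow> real \<Rightarrow> real" where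
  "agm_integral a b = (LBINT x. agm_integrand a b x)"

lemma has_bochner_integral_inverse_square_plus:
  fixes m :: real
  assumes m: "m > 0"
  shows "has_bochner_integral lborel (\<lambda>x. 1 / (x\<^sup>2 + m\<^sup>2)) (pi / m)"
proof -
  have "has_bochner_integral lborel (\<lambda>x::real. inverse (1 + x\<^sup>2)) pi"
    using integrable_inverse_1_plus_square LBINT_inverse_1_plus_square
    by (simp add: has_bochner_integral_iff set_integrable_def interval_lebesgue_integral_def set_lebesgue_integral_def)
  hence "has_bochner_integral lborel (\<lambda>x. inverse (1 + (0 + 1 / m * x)\<^sup>2)) (pi /\<^sub>R \<bar>1 / m\<bar>)"
    using m by (subst (asm) lborel_has_bochner_integral_real_affine_iff[of "1 / m" _ _ 0]) auto
  hence "has_bochner_integral lborel (\<lambda>x. 1 / m\<^sup>2 * inverse (1 + (0 + 1 / m * x)\<^sup>2)) (1 / m\<^sup>2 * (pi /\<^sub>R \<bar>1 / m\<bar>))"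
    by (rule has_bochner_integral_mult_right)
  moreover have "1 / m\<^sup>2 * inverse (1 + (0 + 1 / m * x)\<^sup>2) = 1 / (x\<^sup>2 + m\<^sup>2)" for x
  proof -
    have "m\<^sup>2 * (1 + (1 / m * x)\<^sup>2) = x\<^sup>2 + m\<^sup>2" using m by (simp add: field_simps power2_eq_square)
    moreover have "1 / m\<^sup>2 * inverse (1 + (0 + 1 / m * x)\<^sup>2) = 1 / (m\<^sup>2 * (1 + (1 / m * x)\<^sup>2))"
      by (simp add: divide_simps)
    ultimately show ?thesis by simp
  qed
  moreover have "1 / m\<^sup>2 * (pi /\<^sub>R \<bar>1 / m\<bar>) = pi / m"
    using m by (simp add: power2_eq_square)
  ultimately show ?thesis by simp
qed

section \<open>Monotonicity and elementary bounds of the elliptic integral\<close>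

lemma agm_integrand_mono:
  assumes "0 < c" "c \<le> a" "0 < d" "d \<le> b"
  shows "agm_integrand a b x \<le> agm_integrand c d x"
  unfolding agm_integrand_def using assms
  by (intro divide_left_mono real_sqrt_le_mono mult_mono add_left_mono power_mono mult_pos_pos real_sqrt_gt_zero add_nonneg_pos) auto

lemma agm_integrand_same: "agm_integrand m m x = 1 / (x\<^sup>2 + m\<^sup>2)"
  unfolding agm_integrand_def by (simp add: power2_eq_square[symmetric])

lemma agm_integrand_nonneg: "0 \<le> agm_integrand a b x"
  unfolding agm_integrand_def by simp

lemma borel_measurable_agm_integrand [measurable]: "agm_integrand a b \<in> borel_measurable borel"
  unfolding agm_integrand_def by measurable

lemma integrable_agm_integrand:
  assumes "a > 0" "b > 0"
  shows "integrable lborel (agm_integrand a b)"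
proof (rule Bochner_Integration.integrable_bound)
  show "integrable lborel (\<lambda>x. 1 / (x\<^sup>2 + (min a b)\<^sup>2))"
    using has_bochner_integral_inverse_square_plus[of "min a b"] assms by (auto simp: has_bochner_integral_iff)
  show "AE x in lborel. norm (agm_integrand a b x) \<le> norm (1 / (x\<^sup>2 + (min a b)\<^sup>2))"
    using agm_integrand_mono[of "min a b" a "min a b" b] agm_integrand_nonneg assms
    by (intro AE_I2) (simp add: agm_integrand_same)
qed measurable

text \<open>The integrand decreases in both parameters, and for equal parameters m it is the Cauchy
  density up to a factor, with integral pi / m.\<close>

lemma agm_integral_upper:
  assumes "m > 0" "m \<le> a" "m \<le> b"
  shows "agm_integral a b \<le> pi / m"
proof -
  have "agm_integral a b \<le> (LBINT x. 1 / (x\<^sup>2 + m\<^sup>2))"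
    unfolding agm_integral_def
  proof (rule integral_mono)
    show "integrable lborel (\<lambda>x. 1 / (x\<^sup>2 + m\<^sup>2))"
      using has_bochner_integral_inverse_square_plus[OF assms(1)] by (simp add: has_bochner_integral_iff)
    show "agm_integrand a b x \<le> 1 / (x\<^sup>2 + m\<^sup>2)" for x
      using agm_integrand_mono[of m a m b] assms by (simp add: agm_integrand_same)
  qed (use assms in \<open>auto intro: integrable_agm_integrand\<close>)
  thus ?thesis using has_bochner_integral_inverse_square_plus[OF assms(1)] by (simp add: has_bochner_integral_iff)
qed

lemma agm_integral_lower:
  assumes "a > 0" "b > 0" "a \<le> M" "b \<le> M"
  shows "pi / M \<le> agm_integral a b"
proof -
  have M: "M > 0" using assms by linarith
  have "(LBINT x. 1 / (x\<^sup>2 + M\<^sup>2)) \<le> agm_integral a b"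
    unfolding agm_integral_def
  proof (rule integral_mono)
    show "integrable lborel (\<lambda>x. 1 / (x\<^sup>2 + M\<^sup>2))"
      using has_bochner_integral_inverse_square_plus[OF M] by (simp add: has_bochner_integral_iff)
    show "1 / (x\<^sup>2 + M\<^sup>2) \<le> agm_integrand a b x" for x
      using agm_integrand_mono[of a M b M] assms by (simp add: agm_integrand_same)
  qed (use assms in \<open>auto intro: integrable_agm_integrand\<close>)
  thus ?thesis using has_bochner_integral_inverse_square_plus[OF M] by (simp add: has_bochner_integral_iff)
qed

text \<open>The substitutions below are increasing maps on the positive half-line, so the even
  integrand is reduced to it.\<close>

lemma agm_integral_half:
  assumes "a > 0" "b > 0"
  shows "agm_integral a b = 2 * (LBINT x:{0<..}. agm_integrand a b x)"
proof -
  have int: "integrable lborel (\<lambda>x. indicator {0..} x *\<^sub>R agm_integrand a b x)"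
    by (rule Bochner_Integration.integrable_bound[OF integrable_agm_integrand[OF assms]])
       (auto split: split_indicator)
  have "has_bochner_integral lborel (agm_integrand a b) (2 *\<^sub>R (LBINT x. indicator {0..} x *\<^sub>R agm_integrand a b x))"
    by (rule has_bochner_integral_even_function)
       (use int in \<open>auto simp: has_bochner_integral_iff agm_integrand_def\<close>)
  moreover have "(LBINT x. indicator {0..} x *\<^sub>R agm_integrand a b x) = (LBINT x:{0<..}. agm_integrand a b x)"
    unfolding set_lebesgue_integral_def
    by (rule integral_discrete_difference[where X="{0}"]) (auto split: split_indicator)
  ultimately show ?thesis by (simp add: has_bochner_integral_iff agm_integral_def)
qed

lemma agm_integral_scale:
  assumes "t > 0"
  shows "agm_integral (t * a) (t * b) = agm_integral a b / t"
proof -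
  have "agm_integral (t * a) (t * b) = \<bar>t\<bar> *\<^sub>R (LBINT x. agm_integrand (t * a) (t * b) (0 + t * x))"
    unfolding agm_integral_def by (rule lborel_integral_real_affine) (use assms in auto)
  also have "(\<lambda>x. agm_integrand (t * a) (t * b) (0 + t * x)) = (\<lambda>x. 1 / t\<^sup>2 * agm_integrand a b x)"
  proof
    fix x
    have "((t * x)\<^sup>2 + (t * a)\<^sup>2) * ((t * x)\<^sup>2 + (t * b)\<^sup>2) = (t\<^sup>2)\<^sup>2 * ((x\<^sup>2 + a\<^sup>2) * (x\<^sup>2 + b\<^sup>2))"
      by (simp add: power2_eq_square algebra_simps)
    thus "agm_integrand (t * a) (t * b) (0 + t * x) = 1 / t\<^sup>2 * agm_integrand a b x"
      unfolding agm_integrand_def by (simp only: add_0 real_sqrt_mult real_sqrt_abs) simp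
  qed
  finally show ?thesis using assms by (simp add: agm_integral_def power2_eq_square)
qed

text \<open>Newman's substitution \<open>t = (x - a b / x) / 2\<close>.\<close>

lemma agm_integral_step:
  assumes a: "a > 0" and b: "b > 0"
  shows "agm_integral ((a + b) / 2) (sqrt (a * b)) = agm_integral a b"
proof -
  define f where "f = agm_integrand ((a + b) / 2) (sqrt (a * b))"
  define g where "g x = (x - a * b / x) / 2" for x :: real
  define g' where "g' x = (1 + a * b / x\<^sup>2) / 2" for x :: real
  have ab: "a * b > 0" using a b by simp
  have fg: "f (g x) * g' x = 2 * agm_integrand a b x" if x: "x > 0" for x
  proof -
    \<comment> \<open>With 4 x^2 (g x)^2 = (x^2 - a b)^2, adding (a + b)^2 x^2 gives (x^2 + a^2)
      (x^2 + b^2), while adding 4 a b x^2 gives the perfect square (x^2 + a b)^2. The derivative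
      \<open>g'\<close> contains the same factor x^2 + a b and cancels its root.\<close>
    have 1: "(g x)\<^sup>2 + ((a + b) / 2)\<^sup>2 = (x\<^sup>2 + a\<^sup>2) * (x\<^sup>2 + b\<^sup>2) / (2 * x)\<^sup>2"
      using x by (simp add: g_def field_simps power2_eq_square)
    have 2: "(g x)\<^sup>2 + (sqrt (a * b))\<^sup>2 = ((x\<^sup>2 + a * b) / (2 * x))\<^sup>2"
      using x ab by (simp add: g_def field_simps power2_eq_square)
    have pos: "0 < x\<^sup>2 + a * b" "0 < (x\<^sup>2 + a\<^sup>2) * (x\<^sup>2 + b\<^sup>2)"
      using x a b by (auto intro!: add_pos_pos mult_pos_pos)
    have "f (g x) = 1 / (sqrt ((x\<^sup>2 + a\<^sup>2) * (x\<^sup>2 + b\<^sup>2)) / (2 * x) * ((x\<^sup>2 + a * b) / (2 * x)))"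
    proof -
      have "sqrt ((2 * x)\<^sup>2) = 2 * x" using x by (simp only: real_sqrt_abs)
      hence "sqrt ((x\<^sup>2 + a\<^sup>2) * (x\<^sup>2 + b\<^sup>2) / (2 * x)\<^sup>2) = sqrt ((x\<^sup>2 + a\<^sup>2) * (x\<^sup>2 + b\<^sup>2)) / (2 * x)"
        by (simp only: real_sqrt_divide)
      moreover have "sqrt (((x\<^sup>2 + a * b) / (2 * x))\<^sup>2) = (x\<^sup>2 + a * b) / (2 * x)"
        using x pos by (simp only: real_sqrt_abs) simp
      ultimately show ?thesis
        unfolding f_def agm_integrand_def 1 2 real_sqrt_mult[of "_ / _"] by (simp only:)
    qed
    moreover have "g' x = (x\<^sup>2 + a * b) / (2 * x\<^sup>2)"
      using x by (simp add: g'_def field_simps)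
    ultimately show ?thesis
      using x pos by (simp add: agm_integrand_def power2_eq_square)
  qed
  have int0: "set_integrable lborel {0<..} (agm_integrand a b)"
    unfolding set_integrable_def by (rule integrable_mult_indicator[OF _ integrable_agm_integrand[OF a b]]) simp
  have int: "set_integrable lborel (einterval 0 \<infinity>) (\<lambda>x. f (g x) * g' x)"
  proof -
    have "set_integrable lborel {0<..} (\<lambda>x. 2 * agm_integrand a b x)"
      using int0 by simp
    also have "?this \<longleftrightarrow> set_integrable lborel {0<..} (\<lambda>x. f (g x) * g' x)"
      by (rule set_integrable_cong) (auto simp: fg)
    finally show ?thesis by (simp add: zero_ereal_def)
  qed
  have cont_f: "isCont f x" for x
    unfolding f_def agm_integrand_def using a b ab
    by (intro continuous_intros) (auto simp: add_nonneg_eq_0_iff)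
  have "(LBINT x=-\<infinity>..\<infinity>. f x) = (LBINT x=0..\<infinity>. f (g x) * g' x)"
  proof (rule interval_integral_substitution_nonneg(2))
    show "DERIV g x :> g' x" if "0 < ereal x" for x
      unfolding g_def g'_def using that
      by (auto intro!: derivative_eq_intros simp: power2_eq_square)
    show "isCont g' x" if "0 < ereal x" for x
      unfolding g'_def using that by (auto intro!: continuous_intros)
    show "0 \<le> g' x" for x using ab by (simp add: g'_def)
    show "0 \<le> f (g x)" for x by (simp add: f_def agm_integrand_nonneg)
    show "((ereal \<circ> g \<circ> real_of_ereal) \<longlongrightarrow> - \<infinity>) (at_right 0)"
      unfolding zero_ereal_def ereal_tendsto_simps g_def using ab by real_asymp
    show "((ereal \<circ> g \<circ> real_of_ereal) \<longlongrightarrow> \<infinity>) (at_left \<infinity>)"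
      unfolding ereal_tendsto_simps g_def using ab by real_asymp
  qed (use int cont_f in auto)
  also have "\<dots> = (LBINT x:{0<..}. f (g x) * g' x)"
    by (simp add: interval_lebesgue_integral_0_infty)
  also have "\<dots> = (LBINT x:{0<..}. 2 * agm_integrand a b x)"
    by (rule set_lebesgue_integral_cong) (auto simp: fg)
  also have "\<dots> = agm_integral a b"
    using agm_integral_half[OF a b] by simp
  also have "(LBINT x=-\<infinity>..\<infinity>. f x) = agm_integral ((a + b) / 2) (sqrt (a * b))"
    by (simp add: interval_lebesgue_integral_def set_lebesgue_integral_def f_def agm_integral_def)
  finally show ?thesis .
qed

text \<open>The substitution \<open>w = 1 - 1 / (1 + x\<^sup>2)\<^sup>2\<close> leads to the Beta integral.\<close>

lemma agm_integral_lemniscate: "agm_integral (sqrt 2) 1 = Beta (1 / 2) (1 / 4) / 2"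
proof -
  define f where "f w = w powr (1/2 - 1) * (1 - w) powr (1/4 - 1)" for w :: real
  define g where "g x = 1 - 1 / (1 + x\<^sup>2)\<^sup>2" for x :: real
  define g' where "g' x = 4 * x / (1 + x\<^sup>2) ^ 3" for x :: real
  have pos: "0 < 1 + x\<^sup>2" for x :: real by (intro add_pos_nonneg) auto
  have g01: "0 < g x" "g x < 1" if "x > 0" for x
  proof -
    have "1 < (1 + x\<^sup>2)\<^sup>2" using that by (intro one_less_power) auto
    hence "1 / (1 + x\<^sup>2)\<^sup>2 < 1" by (subst divide_less_eq_1_pos) auto
    thus "0 < g x" by (simp only: g_def)
    show "g x < 1" using pos[of x] by (simp add: g_def)
  qed
  have fg: "f (g x) * g' x = 4 * agm_integrand (sqrt 2) 1 x" if x: "x > 0" for x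
  proof -
    define u where "u = 1 + x\<^sup>2"
    have u: "u > 1" using x by (simp add: u_def)
    \<comment> \<open>Here u^2 - 1 = (u - 1) (u + 1) = x^2 (x^2 + 2): the factor x^2 + 2 belongs to
      the parameter sqrt 2, and u = x^2 + 1 to the parameter 1.\<close>
    have "g x = x\<^sup>2 * (x\<^sup>2 + 2) / u\<^sup>2"
      using u by (simp add: g_def u_def[symmetric] field_simps) (simp add: u_def power2_eq_square power4_eq_xxxx algebra_simps)
    hence "sqrt (g x) = x * sqrt (x\<^sup>2 + 2) / u"
      using x u by (simp add: real_sqrt_divide real_sqrt_mult)
    hence 1: "g x powr (1/2 - 1) = u / (x * sqrt (x\<^sup>2 + 2))"
    proof -
      have "g x powr (1/2 - 1) = g x powr - (1/2)" by simp
      also have "\<dots> = inverse (sqrt (g x))"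
        using g01[OF x] by (simp only: powr_minus powr_half_sqrt less_imp_le)
      also have "\<dots> = u / (x * sqrt (x\<^sup>2 + 2))"
        unfolding \<open>sqrt (g x) = _\<close> by simp
      finally show ?thesis .
    qed
    have "1 - g x = u powr - 2"
      using u powr_minus[of u 2] by (simp add: g_def u_def[symmetric] divide_inverse)
    hence "(1 - g x) powr (1/4 - 1) = (u powr - 2) powr (- 3 / 4)" by simp
    also have "\<dots> = u powr (1 + 1 / 2)" unfolding powr_powr by simp
    also have "\<dots> = u * sqrt u" using u by (subst powr_add) (simp add: powr_half_sqrt)
    finally have 2: "(1 - g x) powr (1/4 - 1) = u * sqrt u" .
    have 3: "sqrt u * sqrt u = u" using u by simp
    have "f (g x) * g' x = u / (x * sqrt (x\<^sup>2 + 2)) * (u * sqrt u) * (4 * x / u ^ 3)"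
      unfolding f_def 1 2 g'_def u_def[symmetric] ..
    also have "\<dots> = 4 * sqrt u / (u * sqrt (x\<^sup>2 + 2))"
      using x u by (simp add: field_simps power3_eq_cube)
    also have "\<dots> = 4 / (sqrt u * sqrt (x\<^sup>2 + 2))"
    proof -
      define v where "v = sqrt u"
      have "v > 0" using u by (simp add: v_def)
      hence "4 * v / (v * v * sqrt (x\<^sup>2 + 2)) = 4 / (v * sqrt (x\<^sup>2 + 2))" by simp
      thus ?thesis using 3 by (simp only: v_def)
    qed
    also have "\<dots> = 4 * agm_integrand (sqrt 2) 1 x"
      by (simp add: agm_integrand_def u_def real_sqrt_mult add.commute)
    finally show ?thesis .
  qed
  have int0: "set_integrable lborel {0<..} (agm_integrand (sqrt 2) 1)"
    unfolding set_integrable_def by (rule integrable_mult_indicator[OF _ integrable_agm_integrand]) auto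
  have int: "set_integrable lborel (einterval 0 \<infinity>) (\<lambda>x. f (g x) * g' x)"
  proof -
    have "set_integrable lborel {0<..} (\<lambda>x. 4 * agm_integrand (sqrt 2) 1 x)"
      using int0 by simp
    also have "?this \<longleftrightarrow> set_integrable lborel {0<..} (\<lambda>x. f (g x) * g' x)"
      by (rule set_integrable_cong) (auto simp: fg)
    finally show ?thesis by (simp add: zero_ereal_def)
  qed
  have "(LBINT x=0..1. f x) = (LBINT x=0..\<infinity>. f (g x) * g' x)"
  proof (rule interval_integral_substitution_nonneg(2))
    show "DERIV g x :> g' x" if "0 < ereal x" for x
    proof -
      have nz: "1 + x\<^sup>2 \<noteq> 0" using pos[of x] by linarith
      have "((\<lambda>x. 1 / (1 + x\<^sup>2)) has_real_derivative (0 * (1 + x\<^sup>2) - 1 * (2 * x)) / ((1 + x\<^sup>2) * (1 + x\<^sup>2))) (at x)"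
        by (rule DERIV_divide) (use nz in \<open>auto intro!: derivative_eq_intros\<close>)
      from DERIV_diff[OF DERIV_const[of 1] DERIV_power[OF this, of 2]]
      show ?thesis unfolding g_def g'_def by (simp add: power_one_over power3_eq_cube)
    qed
    show "isCont f (g x)" if "0 < ereal x" for x
      unfolding f_def using g01[of x] that by (auto intro!: continuous_intros)
    show "isCont g' x" for x
      unfolding g'_def using pos[of x] by (auto intro!: continuous_intros)
    show "0 \<le> g' x" if "0 \<le> ereal x" for x using that pos[of x] by (auto simp: g'_def)
    show "0 \<le> f (g x)" for x by (simp add: f_def)
    show "((ereal \<circ> g \<circ> real_of_ereal) \<longlongrightarrow> 0) (at_right 0)"
      unfolding zero_ereal_def ereal_tendsto_simps g_def by (auto intro!: tendsto_eq_intros)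
    show "((ereal \<circ> g \<circ> real_of_ereal) \<longlongrightarrow> 1) (at_left \<infinity>)"
      unfolding one_ereal_def ereal_tendsto_simps g_def by real_asymp
  qed (use int in auto)
  also have "\<dots> = (LBINT x:{0<..}. f (g x) * g' x)"
    by (simp add: interval_lebesgue_integral_0_infty)
  also have "\<dots> = (LBINT x:{0<..}. 4 * agm_integrand (sqrt 2) 1 x)"
    by (rule set_lebesgue_integral_cong) (auto simp: fg)
  also have "\<dots> = 2 * agm_integral (sqrt 2) 1"
    using agm_integral_half[of "sqrt 2" 1] by simp
  also have "(LBINT x=0..1. f x) = integral {0..1} f"
    using interval_integral_eq_integral[of 0 1 f] integrable_Beta[of "1/2" "1/4"]
    by (simp add: f_def[abs_def] zero_ereal_def one_ereal_def)
  also have "\<dots> = Beta (1/2) (1/4)"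
    using has_integral_Beta_real[of "1/2" "1/4"] unfolding f_def by (intro integral_unique) simp
  finally show ?thesis by simp
qed

text \<open>The squeeze between pi / max and pi / min takes the place of continuity of the integral
  in its parameters.\<close>

lemma agm_integral_limit:
  assumes pos: "\<And>n. a n > 0" "\<And>n. b n > 0"
    and lim: "a \<longlonglongrightarrow> 1" "b \<longlonglongrightarrow> 1"
    and const: "\<And>n. agm_integral (a n) (b n) = I"
  shows "I = pi"
proof (rule antisym)
  have "(\<lambda>n. pi / min (a n) (b n)) \<longlonglongrightarrow> pi / min 1 1"
    by (intro tendsto_intros lim) auto
  moreover have "I \<le> pi / min (a n) (b n)" for n
    unfolding const[of n, symmetric] using pos[of n] by (intro agm_integral_upper) auto
  ultimately show "I \<le> pi"
    by (intro tendsto_lowerbound[where f = "\<lambda>n. pi / min (a n) (b n)"]) auto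
  have "(\<lambda>n. pi / max (a n) (b n)) \<longlonglongrightarrow> pi / max 1 1"
    by (intro tendsto_intros lim) auto
  moreover have "pi / max (a n) (b n) \<le> I" for n
    unfolding const[of n, symmetric] using pos[of n] by (intro agm_integral_lower) auto
  ultimately show "pi \<le> I"
    by (intro tendsto_upperbound[where f = "\<lambda>n. pi / max (a n) (b n)"]) auto
qed

text \<open>The value pi is that of the integral at (1, 1), the limit of the squared theta values
  along x, 2 x, 4 x and so on.\<close>

lemma agm_integral_theta:
  assumes x: "x > 0"
  shows "agm_integral ((theta3 x)\<^sup>2) ((theta4 x)\<^sup>2) = pi"
proof (rule agm_integral_limit[where a = "\<lambda>n. (theta3 (2 ^ n * x))\<^sup>2" and b = "\<lambda>n. (theta4 (2 ^ n * x))\<^sup>2"])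
  have x': "2 ^ n * x > 0" for n using x by simp
  have lim: "filterlim (\<lambda>n. 2 ^ n * x) at_top sequentially" using x by real_asymp
  show "(theta3 (2 ^ n * x))\<^sup>2 > 0" for n using theta3_pos[OF x', of n] by simp
  show "(theta4 (2 ^ n * x))\<^sup>2 > 0" for n using theta4_nonzero[OF x', of n] by simp
  show "(\<lambda>n. (theta3 (2 ^ n * x))\<^sup>2) \<longlonglongrightarrow> 1"
    using tendsto_power[OF filterlim_compose[OF theta3_tendsto lim], of 2] by simp
  show "(\<lambda>n. (theta4 (2 ^ n * x))\<^sup>2) \<longlonglongrightarrow> 1"
    using tendsto_power[OF filterlim_compose[OF theta4_tendsto lim], of 2] by simp
  show "agm_integral ((theta3 (2 ^ n * x))\<^sup>2) ((theta4 (2 ^ n * x))\<^sup>2) = agm_integral ((theta3 x)\<^sup>2) ((theta4 x)\<^sup>2)" for n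
  proof (induction n)
    case (Suc n)
    define y where "y = 2 ^ n * x"
    have y: "y > 0" using x by (simp add: y_def)
    have "(theta3 (2 * y))\<^sup>2 = ((theta3 y)\<^sup>2 + (theta4 y)\<^sup>2) / 2"
      using theta3_theta4_squares[OF y] by simp
    moreover have "(theta4 (2 * y))\<^sup>2 = sqrt ((theta3 y)\<^sup>2 * (theta4 y)\<^sup>2)"
    proof -
      \<comment> \<open>The root of the product of squares determines the product only up to sign;
        the sign is settled because the product is itself a square.\<close>
      have "0 \<le> theta3 y * theta4 y" unfolding theta3_times_theta4[OF y] by simp
      hence "sqrt ((theta3 y)\<^sup>2 * (theta4 y)\<^sup>2) = theta3 y * theta4 y"
        by (simp flip: power_mult_distrib)
      thus ?thesis using theta3_times_theta4[OF y] by simp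
    qed
    moreover have "(theta3 y)\<^sup>2 > 0" "(theta4 y)\<^sup>2 > 0"
      using theta3_pos[OF y] theta4_nonzero[OF y] by auto
    ultimately have "agm_integral ((theta3 (2 * y))\<^sup>2) ((theta4 (2 * y))\<^sup>2) = agm_integral ((theta3 y)\<^sup>2) ((theta4 y)\<^sup>2)"
      by (simp only: agm_integral_step)
    thus ?case using Suc by (simp add: y_def mult.assoc)
  qed simp
qed

theorem theta3_1: "theta3 1 = pi powr (1 / 4) / Gamma (3 / 4)"
proof -
  \<comment> \<open>Inversion at 2 and \<open>theta4_eq_theta3\<close> at 1/2 (where 4 x = 2)
    express both theta values at 1/2 by \<open>B\<close>. Duplication from 1/2 to 1 then makes
    \<open>B\<close> cancel from the ratio of the squares at 1, which turns out to be sqrt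
    2.\<close>
  define B where "B = theta3 2"
  have B: "B > 0" by (simp add: B_def theta3_pos)
  have 3: "theta3 (1 / 2) = sqrt 2 * B"
    using theta3_inversion[of 2] by (simp add: B_def)
  have 4: "theta4 (1 / 2) = (2 - sqrt 2) * B"
    using theta4_eq_theta3[of "1/2"] by (simp add: 3 B_def algebra_simps)
  have sq3: "(theta3 1)\<^sup>2 = ((theta3 (1 / 2))\<^sup>2 + (theta4 (1 / 2))\<^sup>2) / 2"
    using theta3_theta4_squares[of "1/2"] by simp
  have sq4: "(theta4 1)\<^sup>2 = theta3 (1 / 2) * theta4 (1 / 2)"
    using theta3_times_theta4[of "1/2"] by simp
  define r :: real where "r = sqrt 2"
  have r: "r * r = 2" by (simp add: r_def)
  have "(theta3 1)\<^sup>2 = (r * r + (2 - r) * (2 - r)) / 2 * B\<^sup>2"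
    unfolding sq3 3 4 by (simp add: r_def power2_eq_square field_simps)
  also have "(r * r + (2 - r) * (2 - r)) / 2 = 4 - 2 * r"
    using r by (simp add: algebra_simps diff_divide_distrib)
  also have "4 - 2 * r = r * (r * (2 - r))"
    using r by (simp add: algebra_simps)
  also have "\<dots> * B\<^sup>2 = sqrt 2 * (theta4 1)\<^sup>2"
    unfolding sq4 3 4 by (simp add: r_def power2_eq_square)
  finally have rel: "(theta3 1)\<^sup>2 = (theta4 1)\<^sup>2 * sqrt 2" by (simp only: mult.commute)
  \<comment> \<open>The integral is homogeneous of degree -1, so the scale \<open>t\<close> factors
    out, and comparison with pi determines it.\<close>
  define t where "t = (theta4 1)\<^sup>2"
  have t: "t > 0" using theta4_nonzero[of 1] by (simp add: t_def)
  have "pi = agm_integral (t * sqrt 2) (t * 1)"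
    using agm_integral_theta[of 1] by (simp add: rel t_def)
  also have "\<dots> = Beta (1 / 2) (1 / 4) / 2 / t"
    using t by (simp only: agm_integral_scale agm_integral_lemniscate)
  finally have "t = Beta (1 / 2) (1 / 4) / (2 * pi)" using t by (simp add: field_simps)
  hence "(theta3 1)\<^sup>2 = sqrt 2 * Beta (1 / 2) (1 / 4) / (2 * pi)"
    unfolding rel t_def[symmetric] by simp
  also have "Beta (1 / 2) (1 / 4) = sqrt pi * Gamma (1 / 4) / Gamma (3 / 4 :: real)"
    by (simp add: Beta_def Gamma_one_half_real)
  also have "Gamma (1 / 4 :: real) = pi * sqrt 2 / Gamma (3 / 4)"
  proof -
    have "complex_of_real (Gamma (1 / 4) * Gamma (3 / 4)) = of_real (pi / sin (pi / 4))"
      using Gamma_reflection_complex[of "of_real (1/4)"]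
      by (simp flip: Gamma_complex_of_real sin_of_real)
    hence "Gamma (1 / 4) * Gamma (3 / 4) = pi / sin (pi / 4)" by (simp only: of_real_eq_iff)
    also have "\<dots> = pi * sqrt 2" by (simp add: sin_45 field_simps)
    finally show ?thesis
      using Gamma_real_pos[of "3/4"] by (subst eq_divide_eq) auto
  qed
  finally have "(theta3 1)\<^sup>2 = sqrt pi / (Gamma (3 / 4))\<^sup>2"
    by (simp add: field_simps power2_eq_square)
  also have "sqrt pi = (pi powr (1 / 4))\<^sup>2"
    by (simp add: powr_half_sqrt[symmetric] flip: powr_numeral powr_powr) (simp add: powr_powr)
  finally have "(theta3 1)\<^sup>2 = (pi powr (1 / 4) / Gamma (3 / 4))\<^sup>2" by (simp add: power_divide)
  thus ?thesis
    using theta3_pos[of 1] Gamma_real_pos[of "3/4"] by (simp add: power2_eq_iff_nonneg)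
qed

subsection \<open>The Mellin transform of the theta series\<close>

lemma set_integrable_Gamma_integrand:
  assumes s: "Re s > 0"
  shows "set_integrable lborel {0<..} (\<lambda>t. complex_of_real t powr (s - 1) / of_real (exp t))"
    and "(LBINT t:{0<..}. complex_of_real t powr (s - 1) / of_real (exp t)) = Gamma s"
proof -
  define f where "f t = complex_of_real t powr (s - 1) / of_real (exp t)" for t
  have meas: "(\<lambda>t. indicator {0<..} t *\<^sub>R f t) \<in> borel_measurable lborel"
  proof -
    have "continuous_on {0<..} f"
      unfolding f_def by (intro continuous_intros) auto
    thus ?thesis
      by (simp add: borel_measurable_continuous_on_indicator)
  qed
  have abs: "set_integrable lebesgue {0<..} f"
    using absolutely_integrable_Gamma_integral'[OF s] by (simp add: f_def[abs_def])
  show "set_integrable lborel {0<..} f"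
    using abs integrable_completion[OF meas] by (simp add: set_integrable_def)
  have "(LBINT t:{0<..}. f t) = set_lebesgue_integral lebesgue {0<..} f"
    using integral_completion[OF meas] by (simp add: set_lebesgue_integral_def)
  also have "\<dots> = integral {0<..} f"
    using set_lebesgue_integral_eq_integral(2)[OF abs] .
  also have "\<dots> = Gamma s"
    using Gamma_integral_complex'[OF s] unfolding f_def by (rule integral_unique)
  finally show "(LBINT t:{0<..}. f t) = Gamma s" .
qed

text \<open>Euler's integral after the substitution \<open>u = ln t / 2\<close>.\<close>

lemma Gamma_log_integral:
  assumes s: "Re s > 0"
  shows "has_bochner_integral lborel (\<lambda>u. exp (s * of_real u) * of_real (exp (- exp (2 * u)))) (Gamma (s / 2) / 2)"
proof -
  define f where "f s u = exp (s * of_real u) * of_real (exp (- exp (2 * u)))" for s :: complex and u :: real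
  define g where "g x = ln x / 2" for x :: real
  define g' where "g' x = 1 / (2 * x)" for x :: real
  have g: "DERIV g x :> g' x" "isCont g' x" "0 \<le> g' x" if "0 < x" for x
    unfolding g_def g'_def using that by (auto intro!: derivative_eq_intros continuous_intros)
  have lim: "((ereal \<circ> g \<circ> real_of_ereal) \<longlongrightarrow> - \<infinity>) (at_right 0)"
    unfolding zero_ereal_def ereal_tendsto_simps g_def by real_asymp
  have lim': "((ereal \<circ> g \<circ> real_of_ereal) \<longlongrightarrow> \<infinity>) (at_left \<infinity>)"
    unfolding ereal_tendsto_simps g_def by real_asymp
  have fg: "g' x *\<^sub>R f s (g x) = (of_real x powr (s / 2 - 1) / of_real (exp x)) / 2" if x: "x > 0" for x s
  proof -
    have "of_real x powr (s / 2 - 1) = of_real x powr (s / 2) / complex_of_real x"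
      using x by (simp add: powr_diff)
    also have "of_real x powr (s / 2) = exp (s * of_real (g x))"
      using x by (simp add: powr_def g_def Ln_of_real)
    finally show ?thesis
      using x by (simp add: f_def g'_def g_def scaleR_conv_of_real exp_minus divide_simps)
  qed
  have int_g: "set_integrable lborel (einterval 0 \<infinity>) (\<lambda>x. g' x *\<^sub>R f s (g x))" if "Re s > 0" for s
  proof -
    have "set_integrable lborel {0<..} (\<lambda>x. (of_real x powr (s / 2 - 1) / of_real (exp x)) / 2)"
      by (intro set_integrable_divide set_integrable_Gamma_integrand(1)) (use that in simp)
    also have "?this \<longleftrightarrow> set_integrable lborel {0<..} (\<lambda>x. g' x *\<^sub>R f s (g x))"
      by (rule set_integrable_cong) (auto simp: fg)
    finally show ?thesis by (simp add: zero_ereal_def)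
  qed
  \<comment> \<open>The modulus of the integrand is the integrand at the real exponent
    \<open>r\<close>. For this nonnegative function the substitution itself yields integrability,
    which then dominates the complex case.\<close>
  define r where "r = Re s"
  define h where "h u = exp (r * u) * exp (- exp (2 * u))" for u :: real
  have fh: "f (of_real r) u = of_real (h u)" for u
    by (simp add: f_def h_def exp_of_real[symmetric] del: exp_of_real)
  have int_h: "set_integrable lborel (einterval (-\<infinity>) \<infinity>) h"
  proof (rule interval_integral_substitution_nonneg(1)[of 0 \<infinity> g g'])
    have "set_integrable lborel (einterval 0 \<infinity>) (\<lambda>x. Re (g' x *\<^sub>R f (of_real r) (g x)))"
      using int_g[of "of_real r"] s unfolding set_integrable_def
      by (auto dest!: integrable_Re simp: r_def mult.assoc)
    thus "set_integrable lborel (einterval 0 \<infinity>) (\<lambda>x. h (g x) * g' x)"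
      by (simp add: fh mult.commute)
    show "isCont h (g x)" for x unfolding h_def by (intro continuous_intros)
  qed (use g lim lim' in \<open>auto simp: h_def g'_def intro!: continuous_intros\<close>)
  hence int_h': "integrable lborel h" by (simp add: set_integrable_def)
  have int_f: "integrable lborel (f s)"
    by (rule Bochner_Integration.integrable_bound[OF int_h'])
       (auto simp: f_def[abs_def] h_def norm_mult r_def)
  have "(LBINT u=-\<infinity>..\<infinity>. f s u) = (LBINT x=0..\<infinity>. g' x *\<^sub>R f s (g x))"
  proof (rule interval_integral_substitution_integrable)
    show "set_integrable lborel (einterval (-\<infinity>) \<infinity>) (f s)"
      using int_f by (simp add: set_integrable_def)
    show "isCont (f s) (g x)" for x
      unfolding f_def by (intro continuous_intros)
    show "0 \<le> g' x" if "0 \<le> ereal x" for x using that by (simp add: g'_def)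
  qed (use g lim lim' int_g[OF s] in auto)
  also have "\<dots> = (LBINT x:{0<..}. (of_real x powr (s / 2 - 1) / of_real (exp x)) / 2)"
    unfolding interval_lebesgue_integral_0_infty
    by (rule set_lebesgue_integral_cong) (auto simp: fg)
  also have "\<dots> = Gamma (s / 2) / 2"
    unfolding set_integral_divide_zero using set_integrable_Gamma_integrand(2)[of "s / 2"] s by simp
  finally have "(LBINT u. f s u) = Gamma (s / 2) / 2"
    by (simp add: interval_lebesgue_integral_def set_lebesgue_integral_def)
  thus ?thesis using int_f by (simp add: has_bochner_integral_iff f_def[abs_def])
qed

text \<open>In Euler's integral the modulus of the integrand depends only on the real part. The
  integral is used at 2 z, since \<open>Gamma_log_integral\<close> produces Gamma (s / 2) /
  2.\<close>

lemma norm_Gamma_le: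
  assumes "Re z > 0"
  shows "norm (Gamma z) \<le> Gamma (Re z)"
proof -
  define F where "F s u = exp (s * of_real u) * of_real (exp (- exp (2 * u)))" for s :: complex and u :: real
  have F: "has_bochner_integral lborel (F s) (Gamma (s / 2) / 2)" if "Re s > 0" for s
    using Gamma_log_integral[OF that] by (simp add: F_def[abs_def])
  have "norm (integral\<^sup>L lborel (F (2 * z))) \<le> (LBINT u. norm (F (2 * z) u))"
    by (rule integral_norm_bound)
  also have "(\<lambda>u. norm (F (2 * z) u)) = (\<lambda>u. Re (F (2 * of_real (Re z)) u))"
    by (auto simp: F_def norm_mult fun_eq_iff Re_exp)
  also have "(LBINT u. Re (F (2 * of_real (Re z)) u)) = Re (integral\<^sup>L lborel (F (2 * of_real (Re z))))"
    using F[of "2 * of_real (Re z)"] assms by (intro integral_Re) (simp add: has_bochner_integral_iff)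
  also have "integral\<^sup>L lborel (F (2 * of_real (Re z))) = of_real (Gamma (Re z)) / 2"
    using has_bochner_integral_integral_eq[OF F[of "2 * of_real (Re z)"]] assms
    by (simp add: Gamma_complex_of_real)
  also have "integral\<^sup>L lborel (F (2 * z)) = Gamma z / 2"
    using has_bochner_integral_integral_eq[OF F[of "2 * z"]] assms by simp
  finally show ?thesis by (simp add: norm_divide)
qed

text \<open>Riemann's theta series, (theta3 (exp (2 u)) - 1) / 2, in the logarithmic
  variable.\<close>

definition psi :: "real \<Rightarrow> real" where
  "psi u = (\<Sum>n. exp (- (pi * exp (2 * u) * (real (Suc n))\<^sup>2)))"

lemma psi_theta3: "theta3 (exp (2 * u)) = 1 + 2 * psi u"
  by (simp add: theta3_eq psi_def)

lemma summable_psi: "summable (\<lambda>n. exp (- (pi * exp (2 * u) * (real (Suc n))\<^sup>2)))"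
  by (rule summable_gaussian) simp

lemma psi_nonneg: "psi u \<ge> 0"
  unfolding psi_def by (intro suminf_nonneg summable_psi) auto

text \<open>A crude rate, far from the true decay, but enough to keep exp (c u) psi u bounded for u
  >= 0 when c < 2.\<close>

lemma psi_le: "psi u \<le> exp (- (2 * u))"
proof -
  have "2 * psi u \<le> pi / (3 * exp (2 * u))"
    using theta3_bound[of "exp (2 * u)"] psi_nonneg[of u] by (simp add: psi_theta3)
  also have "\<dots> \<le> 2 / exp (2 * u)" using pi_less_4 by (simp add: divide_simps)
  finally show ?thesis by (simp add: exp_minus divide_inverse)
qed

lemma psi_reflect: "psi (- u) = exp u * psi u + (exp u - 1) / 2"
proof -
  have "theta3 (exp (2 * (- u))) = theta3 (1 / exp (2 * u))" by (simp add: exp_minus divide_inverse)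
  also have "\<dots> = sqrt (exp (2 * u)) * theta3 (exp (2 * u))" by (rule theta3_inversion) simp
  also have "sqrt (exp (2 * u)) = exp u" by (simp add: exp_double)
  finally show ?thesis unfolding psi_theta3 by (simp add: field_simps)
qed

lemma borel_measurable_psi [measurable]: "psi \<in> borel_measurable borel"
  unfolding psi_def[abs_def] by measurable

lemma continuous_psi: "isCont psi u"
proof -
  \<comment> \<open>Each term decreases in u, so on the half-line from \<open>a\<close> the terms at
    \<open>a\<close> dominate and the M-test applies.\<close>
  define a where "a = u - 1"
  have "uniform_limit {a..} (\<lambda>N u. \<Sum>n<N. exp (- (pi * exp (2 * u) * (real (Suc n))\<^sup>2))) psi sequentially"
    unfolding psi_def[abs_def]
    by (rule Weierstrass_m_test[OF _ summable_psi[of a]]) (simp add: mult_left_mono mult_right_mono)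
  moreover have "\<forall>\<^sub>F N in sequentially. continuous_on {a..} (\<lambda>u. \<Sum>n<N. exp (- (pi * exp (2 * u) * (real (Suc n))\<^sup>2)))"
    by (intro always_eventually allI continuous_intros)
  ultimately have "continuous_on {a..} psi"
    by (intro uniform_limit_theorem) auto
  hence "continuous_on {a<..} psi" by (rule continuous_on_subset) auto
  moreover have "u \<in> {a<..}" by (simp add: a_def)
  ultimately show ?thesis by (simp add: continuous_on_eq_continuous_at)
qed

text \<open>Riemann's integral for the completed zeta function, obtained by integrating
  \<open>psi\<close> term by term. The second claim records the convergence of the Dirichlet series
  of moduli, which is needed again for bounds on the line.\<close>

lemma psi_Mellin:
  assumes s: "Re s > 1"
  shows "has_bochner_integral lborel (\<lambda>u. exp (s * of_real u) * of_real (psi u))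
    (of_real pi powr (- s / 2) * Gamma (s / 2) / 2 * (\<Sum>n. 1 / of_nat (Suc n) powr s))"
    and "summable (\<lambda>n. 1 / real (Suc n) powr Re s)"
proof -
  define f where "f s n u = exp (s * of_real u) * complex_of_real (exp (- (pi * exp (2 * u) * (real (Suc n))\<^sup>2)))" for s n u
  have f: "has_bochner_integral lborel (f s n) (of_real pi powr (- s / 2) * Gamma (s / 2) / 2 * (1 / of_nat (Suc n) powr s))"
    if s: "Re s > 0" for s n
  proof -
    \<comment> \<open>The shift by \<open>c\<close>, the logarithm of sqrt pi (n + 1), turns exp (-
      exp (2 u)) into the n-th theta term; exp (- s c) then yields the power of pi and the Dirichlet
      term.\<close>
    define c where "c = ln pi / 2 + ln (real (Suc n))"
    have ec: "exp (2 * c) = pi * (real (Suc n))\<^sup>2"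
    proof -
      have "2 * c = ln pi + ln (real (Suc n)) + ln (real (Suc n))" by (simp add: c_def)
      thus ?thesis by (simp only: exp_add) (simp add: power2_eq_square del: of_nat_Suc)
    qed
    have "has_bochner_integral lborel (\<lambda>u. exp (s * of_real (c + 1 * u)) * of_real (exp (- exp (2 * (c + 1 * u))))) (Gamma (s / 2) / 2 /\<^sub>R \<bar>1\<bar>)"
      using Gamma_log_integral[OF s] by (subst (asm) lborel_has_bochner_integral_real_affine_iff[of 1 _ _ c]) auto
    hence "has_bochner_integral lborel (\<lambda>u. exp (- s * of_real c) * (exp (s * of_real (c + 1 * u)) * of_real (exp (- exp (2 * (c + 1 * u))))))
        (exp (- s * of_real c) * (Gamma (s / 2) / 2 /\<^sub>R \<bar>1\<bar>))"
      by (rule has_bochner_integral_mult_right)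
    also have "(\<lambda>u. exp (- s * of_real c) * (exp (s * of_real (c + 1 * u)) * of_real (exp (- exp (2 * (c + 1 * u)))))) = f s n"
    proof
      fix u
      have "exp (2 * (c + 1 * u)) = pi * exp (2 * u) * (real (Suc n))\<^sup>2"
        using ec by (simp add: distrib_left exp_add)
      moreover have "exp (- s * of_real c) * exp (s * of_real (c + 1 * u)) = exp (s * of_real u)"
        by (simp add: distrib_left flip: exp_add)
      ultimately show "exp (- s * of_real c) * (exp (s * of_real (c + 1 * u)) * of_real (exp (- exp (2 * (c + 1 * u))))) = f s n u"
        unfolding f_def mult.assoc[symmetric] by simp
    qed
    also have "exp (- s * of_real c) = of_real pi powr (- s / 2) * (1 / of_nat (Suc n) powr s)"
    proof -
      have "- s * of_real c = - s / 2 * of_real (ln pi) + - (s * of_real (ln (real (Suc n))))"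
        by (simp add: c_def algebra_simps)
      moreover have "of_real pi powr (- s / 2) = exp (- s / 2 * of_real (ln pi))"
        by (simp add: powr_def Ln_of_real)
      moreover have "of_nat (Suc n) powr s = exp (s * of_real (ln (real (Suc n))))"
        using Ln_of_real[of "real (Suc n)"] by (simp add: powr_def del: of_nat_Suc)
      ultimately show ?thesis
        by (simp only: exp_add exp_minus divide_inverse mult_1)
    qed
    finally show ?thesis by (simp add: mult_ac)
  qed
  define r where "r = Re s"
  have r: "r > 1" using s by (simp add: r_def)
  \<comment> \<open>The integrals of the norms are given by the same formula at the real exponent
    \<open>r\<close>. They are summable because r > 1, which justifies exchanging sum and
    integral.\<close>
  define A where "A = pi powr (- r / 2) * Gamma (r / 2) / 2"
  have norm_f: "(LBINT u. norm (f s n u)) = A * (1 / real (Suc n) powr r)" for n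
  proof -
    have "norm (f s n u) = Re (f (of_real r) n u)" for u
      by (simp add: f_def norm_mult r_def Re_exp)
    hence "(LBINT u. norm (f s n u)) = Re (integral\<^sup>L lborel (f (of_real r) n))"
      using f[of "of_real r" n] r by (simp add: integral_Re has_bochner_integral_iff)
    also have "integral\<^sup>L lborel (f (of_real r) n) = of_real (A * (1 / real (Suc n) powr r))"
    proof -
      have "complex_of_real pi powr (- of_real r / 2) = of_real (pi powr (- r / 2))"
        using powr_of_real[of pi "- r / 2"] by simp
      moreover have "Gamma (complex_of_real r / 2) = of_real (Gamma (r / 2))"
        using Gamma_complex_of_real[of "r / 2"] by simp
      moreover have "complex_of_nat (Suc n) powr of_real r = of_real (real (Suc n) powr r)"
        using powr_of_real[of "real (Suc n)" r] by (simp del: of_nat_Suc)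
      ultimately show ?thesis
        using f[of "of_real r" n] r by (simp add: has_bochner_integral_iff A_def del: of_nat_Suc)
    qed
    finally show ?thesis by simp
  qed
  have summ: "summable (\<lambda>n. 1 / real (Suc n) powr r)"
  proof -
    have "summable (\<lambda>n. real (Suc n) powr - r)"
      using r by (subst summable_Suc_iff) (simp add: summable_real_powr_iff)
    thus ?thesis by (simp add: powr_minus divide_inverse)
  qed
  thus "summable (\<lambda>n. 1 / real (Suc n) powr Re s)" by (simp only: r_def)
  have int: "integrable lborel (f s n)" for n
    using f[of s n] s by (simp add: has_bochner_integral_iff)
  have summ1: "AE u in lborel. summable (\<lambda>n. norm (f s n u))"
    using summable_psi by (intro AE_I2) (simp add: f_def norm_mult summable_mult)
  have summ2: "summable (\<lambda>n. LBINT u. norm (f s n u))"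
    unfolding norm_f by (rule summable_mult[OF summ])
  have sum_f: "(\<Sum>n. f s n u) = exp (s * of_real u) * of_real (psi u)" for u
    unfolding f_def psi_def using summable_psi[of u]
    by (subst suminf_mult) (auto simp: suminf_of_real summable_of_real simp del: of_nat_Suc of_real_exp)
  have "integrable lborel (\<lambda>u. exp (s * of_real u) * of_real (psi u))"
    using integrable_suminf[OF int summ1 summ2] by (simp add: sum_f)
  moreover have "(LBINT u. exp (s * of_real u) * of_real (psi u)) = of_real pi powr (- s / 2) * Gamma (s / 2) / 2 * (\<Sum>n. 1 / of_nat (Suc n) powr s)"
  proof -
    have int_eq: "integral\<^sup>L lborel (f s n) = of_real pi powr (- s / 2) * Gamma (s / 2) / 2 * (1 / of_nat (Suc n) powr s)" for n
      using f[of s n] s by (simp add: has_bochner_integral_iff)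
    have "summable (\<lambda>n. 1 / complex_of_nat (Suc n) powr s)"
    proof (rule summable_norm_cancel)
      show "summable (\<lambda>n. norm (1 / complex_of_nat (Suc n) powr s))"
        using summ norm_powr_real_powr[of "of_nat (Suc _)" s]
        by (simp add: norm_divide r_def norm_powr_real_powr del: of_nat_Suc)
    qed
    note summ3 = this
    have "(LBINT u. exp (s * of_real u) * of_real (psi u)) = (\<Sum>n. integral\<^sup>L lborel (f s n))"
      using integral_suminf[OF int summ1 summ2] by (simp only: sum_f)
    also have "\<dots> = (\<Sum>n. of_real pi powr (- s / 2) * Gamma (s / 2) / 2 * (1 / of_nat (Suc n) powr s))"
      by (simp only: int_eq)
    also have "\<dots> = of_real pi powr (- s / 2) * Gamma (s / 2) / 2 * (\<Sum>n. 1 / of_nat (Suc n) powr s)"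
      by (rule suminf_mult[OF summ3])
    finally show ?thesis .
  qed
  ultimately show "has_bochner_integral lborel (\<lambda>u. exp (s * of_real u) * of_real (psi u))
    (of_real pi powr (- s / 2) * Gamma (s / 2) / 2 * (\<Sum>n. 1 / of_nat (Suc n) powr s))"
    by (simp add: has_bochner_integral_iff)
qed

section \<open>Splitting the Mellin transform at u = 0\<close>

lemma has_bochner_integral_exp_halfline:
  fixes z :: complex
  assumes z: "Re z > 0"
  shows "set_integrable lborel {0<..} (\<lambda>u. exp (- z * of_real u))"
    and "(LBINT u:{0<..}. exp (- z * of_real u)) = 1 / z"
proof -
  have z0: "z \<noteq> 0" and r0: "Re z \<noteq> 0" using z by auto
  have lim: "((\<lambda>u. exp (- Re z * u)) \<longlongrightarrow> 0) at_top" using z by real_asymp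
  show int: "set_integrable lborel {0<..} (\<lambda>u. exp (- z * of_real u))"
    unfolding set_integrable_def
  proof (rule Bochner_Integration.integrable_bound)
    have "set_integrable lborel (einterval 0 \<infinity>) (\<lambda>u. exp (- Re z * u))"
    proof (rule interval_integral_FTC_nonneg(1)[where F = "\<lambda>u. - (exp (- Re z * u) / Re z)"])
      show "DERIV (\<lambda>u. - (exp (- Re z * u) / Re z)) u :> exp (- Re z * u)" for u
        by (auto intro!: derivative_eq_intros simp: r0)
      show "(((\<lambda>u. - (exp (- Re z * u) / Re z)) \<circ> real_of_ereal) \<longlongrightarrow> - (1 / Re z)) (at_right 0)"
        unfolding zero_ereal_def ereal_tendsto_simps by (auto intro!: tendsto_eq_intros simp: r0)
      show "(((\<lambda>u. - (exp (- Re z * u) / Re z)) \<circ> real_of_ereal) \<longlongrightarrow> 0) (at_left \<infinity>)"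
        unfolding ereal_tendsto_simps using tendsto_minus[OF tendsto_divide_zero[OF lim, of "Re z"]] by simp
    qed auto
    thus "integrable lborel (\<lambda>u. indicator {0<..} u *\<^sub>R exp (- Re z * u))"
      by (simp add: set_integrable_def zero_ereal_def)
    show "(\<lambda>u. indicator {0<..} u *\<^sub>R exp (- z * of_real u)) \<in> borel_measurable lborel" by measurable
    show "AE u in lborel. norm (indicator {0<..} u *\<^sub>R exp (- z * of_real u)) \<le> norm (indicator {0<..} u *\<^sub>R exp (- Re z * u))"
      by (intro AE_I2) (auto split: split_indicator)
  qed
  have "(LBINT u=0..\<infinity>. exp (- z * of_real u)) = 0 - (- (1 / z))"
  proof (rule interval_integral_FTC_integrable[where F = "\<lambda>u. - (exp (- z * of_real u) / z)"])
    show "((\<lambda>u. - (exp (- z * of_real u) / z)) has_vector_derivative exp (- z * of_real u)) (at u)" for u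
    proof -
      have "((\<lambda>w. - (exp (- z * w) / z)) has_field_derivative exp (- z * of_real u)) (at (of_real u))"
        by (auto intro!: derivative_eq_intros simp: z0)
      from has_vector_derivative_real_field[OF this] show ?thesis .
    qed
    show "isCont (\<lambda>u. exp (- z * of_real u)) u" for u by (intro continuous_intros)
    show "set_integrable lborel (einterval 0 \<infinity>) (\<lambda>u. exp (- z * of_real u))"
      using int by (simp add: zero_ereal_def)
    show "(((\<lambda>u. - (exp (- z * of_real u) / z)) \<circ> real_of_ereal) \<longlongrightarrow> - (1 / z)) (at_right 0)"
      unfolding zero_ereal_def ereal_tendsto_simps by (auto intro!: tendsto_eq_intros simp: z0)
    show "(((\<lambda>u. - (exp (- z * of_real u) / z)) \<circ> real_of_ereal) \<longlongrightarrow> 0) (at_left \<infinity>)"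
      unfolding ereal_tendsto_simps
    proof (rule tendsto_norm_zero_cancel)
      show "((\<lambda>u. norm (- (exp (- z * of_real u) / z))) \<longlongrightarrow> 0) at_top"
        using tendsto_divide_zero[OF lim, of "norm z"] by (simp add: norm_divide)
    qed
  qed simp
  thus "(LBINT u:{0<..}. exp (- z * of_real u)) = 1 / z"
    by (simp add: interval_lebesgue_integral_0_infty)
qed

text \<open>Restricting to u > 0, where \<open>psi\<close> decays faster than any exponential, gives
  a function that is entire in s.\<close>

definition half_Mellin :: "complex \<Rightarrow> complex" where
  "half_Mellin s = (LBINT u:{0<..}. exp (s * of_real u) * of_real (psi u))"

lemma set_integrable_half_Mellin:
  fixes s :: complex
  shows "set_integrable lborel {0<..} (\<lambda>u. exp (s * of_real u) * of_real (psi u))"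
proof -
  \<comment> \<open>Any exponent above 1 has a convergent integral over the whole line; on u > 0 a
    larger real exponent dominates.\<close>
  define r where "r = max (Re s) 2"
  have "integrable lborel (\<lambda>u. exp (of_real r * of_real u) * complex_of_real (psi u))"
    using psi_Mellin(1)[of "of_real r"] by (simp add: has_bochner_integral_iff r_def)
  thus ?thesis unfolding set_integrable_def
  proof (rule Bochner_Integration.integrable_bound)
    show "AE u in lborel. norm (indicator {0<..} u *\<^sub>R (exp (s * of_real u) * of_real (psi u)))
        \<le> norm (exp (of_real r * of_real u) * complex_of_real (psi u))"
      by (intro AE_I2) (auto simp: norm_mult r_def psi_nonneg intro!: mult_right_mono mult_right_mono split: split_indicator)
  qed measurable
qed

text \<open>Expand exp (s u) in powers of s and integrate term by term; the partial sums of moduli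
  are dominated by exp (|s| u) psi u, so the resulting power series converges on the whole
  plane.\<close>

lemma holomorphic_half_Mellin: "half_Mellin holomorphic_on UNIV"
proof -
  define a where "a j = (LBINT u:{0<..}. complex_of_real (u ^ j / fact j * psi u))" for j
  have sums: "(\<lambda>j. a j * (s - 0) ^ j) sums half_Mellin s" for s
  proof -
    define f where "f j u = indicator {0<..} u *\<^sub>R ((s * of_real u) ^ j /\<^sub>R fact j * of_real (psi u))" for j u
    define w where "w = (\<lambda>u. indicator {0<..} u *\<^sub>R (exp (of_real (norm s) * of_real u) * complex_of_real (psi u)))"
    have int_w: "integrable lborel w"
      using set_integrable_half_Mellin[of "of_real (norm s)"] by (simp add: set_integrable_def w_def)
    have part: "(\<Sum>j<N. norm (f j u)) \<le> norm (w u)" for N u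
    proof (cases "u > 0")
      case True
      have "(\<Sum>j<N. (norm s * u) ^ j /\<^sub>R fact j) \<le> (\<Sum>j. (norm s * u) ^ j /\<^sub>R fact j)"
        using True by (intro sum_le_suminf summable_exp_generic) auto
      also have "\<dots> = exp (norm s * u)" by (simp add: exp_def)
      finally have "(\<Sum>j<N. (norm s * u) ^ j /\<^sub>R fact j) * psi u \<le> exp (norm s * u) * psi u"
        by (rule mult_right_mono) (rule psi_nonneg)
      thus ?thesis using True psi_nonneg[of u]
        by (simp add: f_def w_def norm_mult norm_power sum_distrib_right sum_distrib_left divide_inverse mult_ac flip: of_real_mult)
    qed (auto simp: f_def w_def)
    have int_f: "integrable lborel (f j)" for j
    proof (rule Bochner_Integration.integrable_bound[OF int_w])
      show "f j \<in> borel_measurable lborel" unfolding f_def by measurable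
      have "norm (f j u) \<le> norm (w u)" for u
        using part[of u "Suc j"] sum_nonneg[of "{..<j}" "\<lambda>j. norm (f j u)"] by simp
      thus "AE u in lborel. norm (f j u) \<le> norm (w u)" by (intro AE_I2)
    qed
    have summ1: "AE u in lborel. summable (\<lambda>j. norm (f j u))"
    proof (rule AE_I2)
      show "summable (\<lambda>j. norm (f j u))" for u
        by (rule summableI_nonneg_bounded[OF _ part]) simp
    qed
    have summ2: "summable (\<lambda>j. LBINT u. norm (f j u))"
    proof (rule summableI_nonneg_bounded)
      fix N
      have "(\<Sum>j<N. LBINT u. norm (f j u)) = (LBINT u. \<Sum>j<N. norm (f j u))"
        using int_f by (intro Bochner_Integration.integral_sum[symmetric]) auto
      also have "\<dots> \<le> (LBINT u. norm (w u))"
        using int_f int_w part by (intro integral_mono) auto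
      finally show "(\<Sum>j<N. LBINT u. norm (f j u)) \<le> (LBINT u. norm (w u))" .
    qed auto
    have "(\<lambda>j. integral\<^sup>L lborel (f j)) sums (LBINT u. \<Sum>j. f j u)"
      by (rule sums_integral[OF int_f summ1 summ2])
    also have "(\<lambda>u. \<Sum>j. f j u) = (\<lambda>u. indicator {0<..} u *\<^sub>R (exp (s * of_real u) * of_real (psi u)))"
    proof
      fix u :: real
      have "(\<lambda>j. (s * of_real u) ^ j /\<^sub>R fact j) sums exp (s * of_real u)" by (rule exp_converges)
      from sums_scaleR_right[OF sums_mult2[OF this, of "of_real (psi u)"], of "indicator {0<..} u"]
      show "(\<Sum>j. f j u) = indicator {0<..} u *\<^sub>R (exp (s * of_real u) * of_real (psi u))"
        by (simp add: f_def sums_iff)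
    qed
    also have "(LBINT u. indicator {0<..} u *\<^sub>R (exp (s * of_real u) * of_real (psi u))) = half_Mellin s"
      by (simp add: half_Mellin_def set_lebesgue_integral_def)
    also have "(\<lambda>j. integral\<^sup>L lborel (f j)) = (\<lambda>j. a j * (s - 0) ^ j)"
    proof
      fix j
      have "f j = (\<lambda>u. (indicator {0<..} u *\<^sub>R complex_of_real (u ^ j / fact j * psi u)) * s ^ j)"
        by (auto simp: f_def power_mult_distrib scaleR_conv_of_real divide_inverse)
      thus "integral\<^sup>L lborel (f j) = a j * (s - 0) ^ j"
        by (simp only: a_def set_lebesgue_integral_def diff_zero integral_mult_left_zero)
    qed
    finally show ?thesis .
  qed
  have "half_Mellin holomorphic_on (\<Union>r\<in>UNIV. ball 0 r)"
    by (rule holomorphic_on_UN_open) (auto intro: power_series_holomorphic sums)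
  also have "(\<Union>r\<in>UNIV. ball (0::complex) r) = UNIV"
  proof (intro set_eqI iffI UNIV_I)
    fix x :: complex
    have "x \<in> ball 0 (norm x + 1)" by simp
    thus "x \<in> (\<Union>r\<in>UNIV. ball 0 r)" by blast
  qed
  finally show ?thesis .
qed

text \<open>On u > 0 the modulus of exp (s u) grows with Re s. The bound is uniform in Im s and is
  the source of all growth estimates inside the strip.\<close>

lemma norm_half_Mellin_le:
  assumes "Re s \<le> r"
  shows "norm (half_Mellin s) \<le> Re (half_Mellin (of_real r))"
proof -
  have "norm (half_Mellin s) \<le> (LBINT u. norm (indicator {0<..} u *\<^sub>R (exp (s * of_real u) * complex_of_real (psi u))))"
    unfolding half_Mellin_def set_lebesgue_integral_def by (rule integral_norm_bound)
  also have "\<dots> \<le> (LBINT u. Re (indicator {0<..} u *\<^sub>R (exp (of_real r * of_real u) * complex_of_real (psi u))))"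
    using set_integrable_half_Mellin[of s] set_integrable_half_Mellin[of "of_real r"] assms psi_nonneg
    unfolding set_integrable_def
    by (intro integral_mono integrable_norm integrable_Re)
       (auto simp: norm_mult Re_exp intro!: mult_right_mono split: split_indicator)
  also have "\<dots> = Re (half_Mellin (of_real r))"
    using set_integrable_half_Mellin[of "of_real r"]
    unfolding half_Mellin_def set_lebesgue_integral_def set_integrable_def by (rule integral_Re)
  finally show ?thesis .
qed

text \<open>Riemann's argument: fold u < 0 onto u > 0 and apply \<open>psi_reflect\<close>. The
  reflected theta part becomes \<open>half_Mellin (1 - s)\<close>, and the elementary part (exp u -
  1) / 2 produces the two pole terms.\<close>

lemma psi_Mellin_split:
  assumes s: "Re s > 1"
  shows "(LBINT u. exp (s * of_real u) * of_real (psi u)) =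
    half_Mellin s + half_Mellin (1 - s) + (1 / (s - 1) - 1 / s) / 2"
proof -
  define f where "f u = exp (s * of_real u) * complex_of_real (psi u)" for u
  have int: "integrable lborel f"
    using psi_Mellin(1)[OF s] by (simp add: f_def[abs_def] has_bochner_integral_iff)
  have int_pos: "integrable lborel (\<lambda>u. indicator {0<..} u *\<^sub>R f u)"
    and int_neg: "integrable lborel (\<lambda>u. indicator {..<0} u *\<^sub>R f u)"
    by (intro integrable_mult_indicator int; simp)+
  have "integral\<^sup>L lborel f = (LBINT u. indicator {0<..} u *\<^sub>R f u + indicator {..<0} u *\<^sub>R f u)"
    by (rule integral_discrete_difference[where X="{0}"]) (auto split: split_indicator)
  also have "\<dots> = half_Mellin s + (LBINT u. indicator {..<0} u *\<^sub>R f u)"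
    using int_pos int_neg by (simp add: half_Mellin_def set_lebesgue_integral_def f_def)
  also have "(LBINT u. indicator {..<0} u *\<^sub>R f u) = (LBINT u. indicator {0<..} u *\<^sub>R f (- u))"
    using lborel_integral_real_affine[of "-1" "\<lambda>u. indicator {..<0} u *\<^sub>R f u" 0]
    by (simp add: indicator_def)
  also have "\<dots> = (LBINT u:{0<..}. exp ((1 - s) * of_real u) * of_real (psi u)
      + (exp (- (s - 1) * of_real u) - exp (- s * of_real u)) / 2)"
    unfolding set_lebesgue_integral_def
  proof (rule Bochner_Integration.integral_cong[OF refl])
    fix u :: real
    have "exp ((1 - s) * of_real u) = exp (- s * of_real u) * exp (of_real u)"
      by (simp add: algebra_simps flip: exp_add)
    moreover have "exp (- (s - 1) * of_real u) = exp (- s * of_real u) * exp (of_real u)"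
      by (simp add: algebra_simps flip: exp_add)
    moreover have "f (- u) = exp (- s * of_real u) * (exp (of_real u) * of_real (psi u) + (exp (of_real u) - 1) / 2)"
      by (simp add: f_def psi_reflect flip: exp_of_real)
    ultimately show "indicator {0<..} u *\<^sub>R f (- u) = indicator {0<..} u *\<^sub>R (exp ((1 - s) * of_real u) * of_real (psi u)
      + (exp (- (s - 1) * of_real u) - exp (- s * of_real u)) / 2)"
      by (simp add: algebra_simps)
  qed
  also have "\<dots> = half_Mellin (1 - s) + (1 / (s - 1) - 1 / s) / 2"
  proof -
    have 1: "set_integrable lborel {0<..} (\<lambda>u. exp (- (s - 1) * of_real u))"
      "(LBINT u:{0<..}. exp (- (s - 1) * of_real u)) = 1 / (s - 1)"
      using has_bochner_integral_exp_halfline[of "s - 1"] s by auto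
    have 2: "set_integrable lborel {0<..} (\<lambda>u. exp (- s * of_real u))"
      "(LBINT u:{0<..}. exp (- s * of_real u)) = 1 / s"
      using has_bochner_integral_exp_halfline[of s] s by auto
    show ?thesis
      using set_integrable_half_Mellin[of "1 - s"] 1 2
      by (simp only: set_integral_add set_integral_diff set_integral_divide_zero set_integrable_divide half_Mellin_def)
  qed
  finally show ?thesis by (simp add: f_def[abs_def])
qed

text \<open>The split Mellin transform multiplied by s (s - 1): the two pole terms become the
  constant 1/2, and what remains is entire and symmetric under s -> 1 - s.\<close>

definition Xi :: "complex \<Rightarrow> complex" where
  "Xi s = 1 / 2 - s * (1 - s) * (half_Mellin s + half_Mellin (1 - s))"

lemma holomorphic_Xi: "Xi holomorphic_on A"
proof -
  have "Xi holomorphic_on UNIV"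
    unfolding Xi_def
    by (intro holomorphic_intros holomorphic_half_Mellin
        holomorphic_on_compose_gen[OF _ holomorphic_half_Mellin, unfolded o_def]) auto
  thus ?thesis by (rule holomorphic_on_subset) auto
qed

lemma Xi_reflect: "Xi (1 - s) = Xi s"
  by (simp add: Xi_def algebra_simps)

lemma Xi_0: "Xi 0 = 1 / 2"
  by (simp add: Xi_def)

lemma Xi_Mellin:
  assumes s: "Re s > 1"
  shows "Xi s = s * (s - 1) * (LBINT u. exp (s * of_real u) * of_real (psi u))"
proof -
  have nz: "s \<noteq> 0" "s - 1 \<noteq> 0" using s by auto
  have "s * (s - 1) * (1 / (s - 1) - 1 / s) = 1" using nz by (simp add: field_simps)
  hence "s * (s - 1) * ((1 / (s - 1) - 1 / s) / 2) = 1 / 2" by simp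
  thus ?thesis unfolding psi_Mellin_split[OF s] Xi_def by (simp add: distrib_left) (simp add: algebra_simps)
qed

section \<open>The continuation of zeta and the identification of xi\<close>

lemma zeta_series_continuation:
  "\<exists>f. f holomorphic_on (- {1}) \<and> (\<forall>s. Re s > 1 \<longrightarrow> f s = (\<Sum>n. 1 / of_nat (Suc n) powr s))
     \<and> (\<forall>s. s \<noteq> 1 \<longrightarrow> f s = Xi s * of_real pi powr (s / 2) * rGamma (1 + s / 2) / (s - 1))"
proof -
  \<comment> \<open>The defining formula of xi solved for zeta. With the entire reciprocal
    \<open>rGamma\<close> no poles of Gamma intervene, and only s = 1 is excluded.\<close>
  define f where "f s = Xi s * of_real pi powr (s / 2) * rGamma (1 + s / 2) / (s - 1)" for s
  have "f holomorphic_on (- {1})"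
    unfolding f_def by (intro holomorphic_intros holomorphic_Xi) auto
  moreover have "f s = (\<Sum>n. 1 / of_nat (Suc n) powr s)" if s: "Re s > 1" for s
  proof -
    define Z where "Z = (\<Sum>n. 1 / of_nat (Suc n) powr s)"
    have nz: "s \<noteq> 0" "s - 1 \<noteq> 0" using s by auto
    have "w \<notin> \<int>\<^sub>\<le>\<^sub>0" if "Re w > 0" for w :: complex using that by (auto elim!: nonpos_Ints_cases)
    from this[of "s / 2"] this[of "1 + s / 2"] have np: "s / 2 \<notin> \<int>\<^sub>\<le>\<^sub>0" "1 + s / 2 \<notin> \<int>\<^sub>\<le>\<^sub>0" using s by auto
    have "Xi s = s * (s - 1) * (of_real pi powr (- s / 2) * Gamma (s / 2) / 2 * Z)"
      using Xi_Mellin[OF s] psi_Mellin(1)[OF s] by (simp add: has_bochner_integral_iff Z_def)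
    also have "\<dots> = (s - 1) * of_real pi powr (- s / 2) * Gamma (1 + s / 2) * Z"
      using Gamma_plus1[of "s / 2"] np by (simp add: add.commute)
    finally have "f s = of_real pi powr (- s / 2) * of_real pi powr (s / 2) * (Gamma (1 + s / 2) * rGamma (1 + s / 2)) * Z"
      using nz by (simp add: f_def)
    also have "of_real pi powr (- s / 2) * of_real pi powr (s / 2) = (1 :: complex)"
      by (simp flip: powr_add)
    also have "Gamma (1 + s / 2) * rGamma (1 + s / 2) = 1"
      using np by (simp add: Gamma_def rGamma_eq_zero_iff)
    finally show ?thesis by (simp add: Z_def)
  qed
  ultimately show ?thesis unfolding f_def by blast
qed

text \<open>The continuation just built shows that the choice defining \<open>zeta\<close> is
  satisfiable; the identity theorem on the connected punctured plane then forces the chosen function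
  to agree with it.\<close>

lemma zeta_eq:
  assumes "s \<noteq> 1"
  shows "zeta s = Xi s * of_real pi powr (s / 2) * rGamma (1 + s / 2) / (s - 1)"
proof -
  obtain f where f: "f holomorphic_on (- {1})" "\<And>s. Re s > 1 \<Longrightarrow> f s = (\<Sum>n. 1 / of_nat (Suc n) powr s)"
    "\<And>s. s \<noteq> 1 \<Longrightarrow> f s = Xi s * of_real pi powr (s / 2) * rGamma (1 + s / 2) / (s - 1)"
    using zeta_series_continuation by blast
  have z: "zeta holomorphic_on (- {1}) \<and> (\<forall>s. Re s > 1 \<longrightarrow> zeta s = (\<Sum>n. 1 / of_nat (Suc n) powr s))"
    unfolding zeta_def by (rule someI[of _ f]) (use f in auto)
  have "zeta s = f s"
  proof (rule analytic_continuation_open[where s = "{s. Re s > 1}" and s' = "- {1}" and f = zeta and g = f and z = s])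
    show "open {s. Re s > 1}" by (rule open_halfspace_Re_gt)
    show "open (- {1 :: complex})" by auto
    show "{s. Re s > 1} \<noteq> {}" by (auto intro!: exI[of _ 2])
    show "connected (- {1 :: complex})" by (rule connected_punctured_universe) simp
    show "{s. Re s > 1} \<subseteq> - {1}" by auto
  qed (use f z assms in auto)
  thus ?thesis using f(3)[OF assms] by simp
qed

lemma xi_eq_Xi: "xi = Xi"
proof
  fix z :: complex
  define h where "h s = (s - 1) * of_real pi powr (- s / 2) * Gamma (1 + s / 2) * zeta s" for s
  \<comment> \<open>Excluding all integers avoids the point 1 and every pole of Gamma (1 + s / 2) at
    once. The integers are discrete, so \<open>h\<close> still agrees with \<open>Xi\<close> near
    every point, which determines the limit taken by \<open>remove_sings\<close>.\<close>
  have h: "h s = Xi s" if "s \<notin> \<int>" for s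
  proof -
    have s1: "s \<noteq> 1" using that by auto
    have np: "1 + s / 2 \<notin> \<int>\<^sub>\<le>\<^sub>0"
    proof
      assume "1 + s / 2 \<in> \<int>\<^sub>\<le>\<^sub>0"
      then obtain n where "1 + s / 2 = of_int n" by (auto elim!: nonpos_Ints_cases)
      hence "s = of_int (2 * n - 2)" by (simp add: field_simps)
      thus False using that by (metis Ints_of_int)
    qed
    have 1: "of_real pi powr (- s / 2) * of_real pi powr (s / 2) = (1 :: complex)"
      by (simp flip: powr_add)
    have 2: "Gamma (1 + s / 2) * rGamma (1 + s / 2) = 1"
      using np by (simp add: Gamma_def rGamma_eq_zero_iff)
    have "h s = (of_real pi powr (- s / 2) * of_real pi powr (s / 2)) * (Gamma (1 + s / 2) * rGamma (1 + s / 2)) * Xi s"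
      unfolding h_def zeta_eq[OF s1] using s1 by simp
    thus ?thesis unfolding 1 2 by simp
  qed
  have "\<forall>\<^sub>F s in at z. s \<notin> \<int>"
  proof -
    define Z where "Z = (of_int ` {k. of_int k \<noteq> z} :: complex set)"
    have "open (- Z)" unfolding Z_def using closed_of_int_image by blast
    moreover have "z \<in> - Z" by (auto simp: Z_def)
    ultimately have "\<forall>\<^sub>F s in at z. s \<in> - Z" by (rule eventually_at_in_open')
    moreover have "\<forall>\<^sub>F s in at z. s \<noteq> z" by (rule eventually_neq_at_within)
    ultimately show ?thesis
      by eventually_elim (auto simp: Z_def elim!: Ints_cases)
  qed
  hence "\<forall>\<^sub>F s in at z. Xi s = h s" by eventually_elim (simp add: h)
  moreover have "Xi \<midarrow>z\<rightarrow> Xi z"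
    using holomorphic_on_imp_continuous_on[OF holomorphic_Xi[of UNIV]]
    by (simp add: continuous_on_eq_continuous_at isCont_def)
  ultimately have "h \<midarrow>z\<rightarrow> Xi z" by (rule Lim_transform_eventually[rotated])
  hence "remove_sings h z = Xi z" by (rule remove_sings_eqI)
  thus "xi z = Xi z" unfolding xi_def h_def .
qed

subsection \<open>Fourier inversion and Cauchy integrals along a vertical line\<close>

text \<open>A damping factor exp (- b^2 y^2) permits Fubini and turns the integral of
  \<open>F\<close> into a Gaussian average of \<open>f\<close> concentrating at 0 as b tends to 0.
  Boundedness and continuity of \<open>f\<close> at 0 give the limit of the averages, integrability
  of \<open>F\<close> that of the damped integrals.\<close>

theorem fourier_inversion_at_0:
  fixes f :: "real \<Rightarrow> complex"
  assumes f: "integrable lborel f" and bd: "\<And>u. norm (f u) \<le> B" and cont: "isCont f 0"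
    and F: "\<And>y. F y = (LBINT u. f u * cis (y * u))" and int_F: "integrable lborel F"
  shows "integral\<^sup>L lborel F = 2 * pi * f 0"
proof -
  have [measurable]: "f \<in> borel_measurable borel" using f by simp
  have meas_cis [measurable]: "(\<lambda>y. cis (g y)) \<in> borel_measurable N" if [measurable]: "g \<in> borel_measurable N" for g and N :: "'z measure"
    unfolding cis_conv_exp by measurable
  define E where "E b y = exp (- (b\<^sup>2 * y\<^sup>2))" for b y :: real
  have [measurable]: "E b \<in> borel_measurable borel" for b unfolding E_def by measurable
  have int_E: "integrable lborel (E b)" if "b > 0" for b
  proof -
    have "integrable lborel (\<lambda>y. Re (of_real (exp (- (b\<^sup>2 * y\<^sup>2))) * cis (0 * y)))"
      using gaussian_fourier[of "b\<^sup>2" 0] that by (intro integrable_Re) (simp add: has_bochner_integral_iff)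
    thus ?thesis by (simp add: E_def[abs_def])
  qed
  \<comment> \<open>The Gaussian in y transforms into a Gaussian of width proportional to 2 b in u.
    After u = 2 b v the weight no longer depends on b, so b survives only in the argument of
    \<open>f\<close>.\<close>
  have key: "(LBINT y. F y * of_real (E b y)) = 2 * sqrt pi * (LBINT v. f (2 * b * v) * of_real (E 1 v))" if b: "b > 0" for b
  proof -
    have "(LBINT y. F y * of_real (E b y)) = (LBINT y. (LBINT u. f u * cis (y * u) * of_real (E b y)))"
      using f by (simp add: F)
    also have "\<dots> = (LBINT u. (LBINT y. f u * cis (y * u) * of_real (E b y)))"
    proof (rule lborel_pair.Fubini_integral[where f = "\<lambda>u y. f u * cis (y * u) * of_real (E b y)"])
      show "integrable (lborel \<Otimes>\<^sub>M lborel) (\<lambda>(u, y). f u * cis (y * u) * of_real (E b y))"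
      proof (rule lborel_pair.Fubini_integrable)
        show "(\<lambda>(u, y). f u * cis (y * u) * of_real (E b y)) \<in> borel_measurable (lborel \<Otimes>\<^sub>M lborel)"
          by measurable
        have "(\<lambda>u. LBINT y. norm (case (u, y) of (u, y) \<Rightarrow> f u * cis (y * u) * of_real (E b y))) =
            (\<lambda>u. norm (f u) * (LBINT y. E b y))"
          by (simp add: norm_mult E_def)
        thus "integrable lborel (\<lambda>u. LBINT y. norm (case (u, y) of (u, y) \<Rightarrow> f u * cis (y * u) * of_real (E b y)))"
          using f by simp
        show "AE u in lborel. integrable lborel (\<lambda>y. case (u, y) of (u, y) \<Rightarrow> f u * cis (y * u) * of_real (E b y))"
        proof (rule AE_I2)
          fix u
          have "integrable lborel (\<lambda>y. norm (f u) * E b y)" using int_E[OF b] by simp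
          thus "integrable lborel (\<lambda>y. case (u, y) of (u, y) \<Rightarrow> f u * cis (y * u) * of_real (E b y))"
            by (rule Bochner_Integration.integrable_bound) (auto simp: norm_mult E_def)
        qed
      qed
    qed
    also have "\<dots> = (LBINT u. (sqrt pi / b) *\<^sub>R (f u * of_real (exp (- (u\<^sup>2 / (4 * b\<^sup>2))))))"
    proof (rule Bochner_Integration.integral_cong[OF refl])
      fix u
      have "(LBINT y. f u * cis (y * u) * of_real (E b y)) = (LBINT y. f u * (of_real (exp (- (b\<^sup>2 * y\<^sup>2))) * cis (u * y)))"
        by (simp add: E_def mult_ac)
      also have "\<dots> = f u * (LBINT y. of_real (exp (- (b\<^sup>2 * y\<^sup>2))) * cis (u * y))"
        by (rule integral_mult_right_zero)
      also have "(LBINT y. of_real (exp (- (b\<^sup>2 * y\<^sup>2))) * cis (u * y)) = of_real (sqrt (pi / b\<^sup>2) * exp (- (u\<^sup>2 / (4 * b\<^sup>2))))"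
        using gaussian_fourier[of "b\<^sup>2" u] b has_bochner_integral_integral_eq by simp
      finally show "(LBINT y. f u * cis (y * u) * of_real (E b y)) = (sqrt pi / b) *\<^sub>R (f u * of_real (exp (- (u\<^sup>2 / (4 * b\<^sup>2)))))"
        using b by (simp add: real_sqrt_divide scaleR_conv_of_real)
    qed
    also have "\<dots> = (sqrt pi / b) *\<^sub>R (LBINT u. f u * of_real (exp (- (u\<^sup>2 / (4 * b\<^sup>2)))))"
      by simp
    also have "(LBINT u. f u * of_real (exp (- (u\<^sup>2 / (4 * b\<^sup>2))))) =
        \<bar>2 * b\<bar> *\<^sub>R (LBINT v. f (0 + 2 * b * v) * of_real (exp (- ((0 + 2 * b * v)\<^sup>2 / (4 * b\<^sup>2)))))"
      by (rule lborel_integral_real_affine) (use b in simp)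
    also have "(\<lambda>v. f (0 + 2 * b * v) * of_real (exp (- ((0 + 2 * b * v)\<^sup>2 / (4 * b\<^sup>2))))) = (\<lambda>v. f (2 * b * v) * of_real (E 1 v))"
      using b by (auto simp: E_def power_mult_distrib)
    finally show ?thesis using b by (simp add: scaleR_conv_of_real)
  qed
  define b where "b n = inverse (real (Suc n))" for n
  have b: "b n > 0" for n by (simp add: b_def)
  have b0: "b \<longlonglongrightarrow> 0" unfolding b_def by (rule LIMSEQ_inverse_real_of_nat)
  have "(\<lambda>n. LBINT y. F y * of_real (E (b n) y)) \<longlonglongrightarrow> (LBINT y. F y)"
  proof (rule integral_dominated_convergence)
    show "integrable lborel (\<lambda>y. norm (F y))" using int_F by simp
    show "F \<in> borel_measurable lborel" using int_F by simp
    thus "(\<lambda>y. F y * of_real (E (b n) y)) \<in> borel_measurable lborel" for n by measurable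
    show "AE y in lborel. (\<lambda>n. F y * of_real (E (b n) y)) \<longlonglongrightarrow> F y"
    proof (rule AE_I2)
      fix y
      have "(\<lambda>n. F y * of_real (exp (- ((b n)\<^sup>2 * y\<^sup>2)))) \<longlonglongrightarrow> F y * of_real (exp (- (0\<^sup>2 * y\<^sup>2)))"
        by (intro tendsto_intros b0)
      thus "(\<lambda>n. F y * of_real (E (b n) y)) \<longlonglongrightarrow> F y" by (simp add: E_def)
    qed
    show "AE y in lborel. norm (F y * of_real (E (b n) y)) \<le> norm (F y)" for n
      by (intro AE_I2) (simp add: norm_mult E_def mult_left_le)
  qed
  moreover have "(\<lambda>n. LBINT y. F y * of_real (E (b n) y)) \<longlonglongrightarrow> 2 * sqrt pi * (LBINT v. f 0 * of_real (E 1 v))"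
    unfolding key[OF b]
  proof (intro tendsto_mult_left integral_dominated_convergence)
    show "integrable lborel (\<lambda>v. B * E 1 v)" using int_E[of 1] by simp
    show "(\<lambda>v. f 0 * of_real (E 1 v)) \<in> borel_measurable lborel" by measurable
    show "(\<lambda>v. f (2 * b n * v) * of_real (E 1 v)) \<in> borel_measurable lborel" for n by measurable
    show "AE v in lborel. (\<lambda>n. f (2 * b n * v) * of_real (E 1 v)) \<longlonglongrightarrow> f 0 * of_real (E 1 v)"
    proof (rule AE_I2)
      fix v
      have "(\<lambda>n. 2 * b n * v) \<longlonglongrightarrow> 2 * 0 * v" by (intro tendsto_intros b0)
      hence "(\<lambda>n. f (2 * b n * v)) \<longlonglongrightarrow> f 0" using isCont_tendsto_compose[OF cont] by simp
      thus "(\<lambda>n. f (2 * b n * v) * of_real (E 1 v)) \<longlonglongrightarrow> f 0 * of_real (E 1 v)" by (intro tendsto_intros)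
    qed
    show "AE v in lborel. norm (f (2 * b n * v) * of_real (E 1 v)) \<le> B * E 1 v" for n
      using bd by (intro AE_I2) (simp add: norm_mult E_def mult_right_mono)
  qed
  ultimately have "(LBINT y. F y) = 2 * sqrt pi * (LBINT v. f 0 * of_real (E 1 v))"
    by (rule LIMSEQ_unique)
  also have "(LBINT v. f 0 * of_real (E 1 v)) = f 0 * of_real (sqrt pi)"
  proof -
    have "has_bochner_integral lborel (\<lambda>v. complex_of_real (E 1 v)) (of_real (sqrt pi))"
      using gaussian_fourier[of 1 0] by (simp add: E_def[abs_def])
    from has_bochner_integral_integral_eq[OF this] show ?thesis
      by (subst integral_mult_right_zero) (simp only:)
  qed
  finally show ?thesis by (simp add: mult_ac flip: of_real_mult)
qed

text \<open>On t = c + i y one has dt / (2 pi i) = dy / (2 pi), so the factor i has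
  cancelled.\<close>

definition line_Cauchy :: "real \<Rightarrow> (complex \<Rightarrow> complex) \<Rightarrow> complex \<Rightarrow> complex" where
  "line_Cauchy c f w = (LBINT y. f (Complex c y) / (Complex c y - w)) / (2 * of_real pi)"

lemma integrable_inverse_1_plus_square_real: "integrable lborel (\<lambda>y. K / (1 + y\<^sup>2 :: real))"
proof -
  have "integrable lborel (\<lambda>y. K * (1 / (y\<^sup>2 + 1\<^sup>2)))"
    using has_bochner_integral_inverse_square_plus[of 1] by (intro integrable_mult_right) (simp add: has_bochner_integral_iff)
  thus ?thesis by (simp add: add.commute)
qed

lemma integrable_line_decay:
  fixes f :: "complex \<Rightarrow> complex"
  assumes "continuous_on UNIV f" and "\<And>y. norm (f (Complex c y)) \<le> K / (1 + y\<^sup>2)"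
  shows "integrable lborel (\<lambda>y. f (Complex c y))"
proof (rule Bochner_Integration.integrable_bound[OF integrable_inverse_1_plus_square_real[of K]])
  have "continuous_on UNIV (\<lambda>y. f (Complex c y))"
    by (rule continuous_on_compose2[OF assms(1)]) (auto intro!: continuous_intros simp: Complex_eq)
  thus "(\<lambda>y. f (Complex c y)) \<in> borel_measurable lborel"
    using borel_measurable_continuous_onI by auto
  show "AE y in lborel. norm (f (Complex c y)) \<le> norm (K / (1 + y\<^sup>2))"
    by (intro AE_I2 order.trans[OF assms(2)]) (simp add: divide_right_mono)
qed

lemma integrable_line_Cauchy:
  fixes f :: "complex \<Rightarrow> complex"
  assumes cont: "continuous_on UNIV f" and bd: "\<And>y. norm (f (Complex c y)) \<le> K / (1 + y\<^sup>2)"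
    and w: "Re w \<noteq> c"
  shows "integrable lborel (\<lambda>y. f (Complex c y) / (Complex c y - w))"
proof (rule Bochner_Integration.integrable_bound)
  \<comment> \<open>The distance of w from the line bounds the denominator from below.\<close>
  define d where "d = \<bar>c - Re w\<bar>"
  have d: "d > 0" using w by (simp add: d_def)
  show "integrable lborel (\<lambda>y. norm (f (Complex c y)) / d)"
    using integrable_line_decay[OF cont bd] by simp
  have ne: "Complex c y - w \<noteq> 0" for y using w by (auto simp: complex_eq_iff)
  have "continuous_on UNIV (\<lambda>y. f (Complex c y) / (Complex c y - w))"
    by (intro continuous_intros continuous_on_compose2[OF cont] ballI ne)
       (auto intro!: continuous_intros simp: Complex_eq)
  thus "(\<lambda>y. f (Complex c y) / (Complex c y - w)) \<in> borel_measurable lborel"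
    using borel_measurable_continuous_onI by auto
  have "norm (f (Complex c y) / (Complex c y - w)) \<le> norm (f (Complex c y)) / d" for y
    unfolding norm_divide using d abs_Re_le_cmod[of "Complex c y - w"]
    by (intro divide_left_mono mult_pos_pos) (auto simp: d_def ne)
  thus "AE y in lborel. norm (f (Complex c y) / (Complex c y - w)) \<le> norm (norm (f (Complex c y)) / d)"
    using d by (intro AE_I2) simp
qed

text \<open>Passes from the finite segments that occur in contour integrals to the Lebesgue integral
  over the whole line.\<close>

lemma tendsto_symmetric_intervals:
  fixes h :: "real \<Rightarrow> complex"
  assumes h: "integrable lborel h" and cont: "continuous_on UNIV h"
  shows "(\<lambda>N::nat. integral {- real N..real N} h) \<longlonglongrightarrow> integral\<^sup>L lborel h"
proof -
  have "(\<lambda>N::nat. LBINT y. indicator {- real N..real N} y *\<^sub>R h y) \<longlonglongrightarrow> integral\<^sup>L lborel h"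
  proof (rule integral_dominated_convergence)
    show "integrable lborel (\<lambda>y. norm (h y))" using h by simp
    show "h \<in> borel_measurable lborel" using h by simp
    thus "(\<lambda>y. indicator {- real N..real N} y *\<^sub>R h y) \<in> borel_measurable lborel" for N by measurable
    show "AE y in lborel. norm (indicator {- real N..real N} y *\<^sub>R h y) \<le> norm (h y)" for N
      by (intro AE_I2) (simp split: split_indicator)
    show "AE y in lborel. (\<lambda>N. indicator {- real N..real N} y *\<^sub>R h y) \<longlonglongrightarrow> h y"
    proof (rule AE_I2, rule tendsto_eventually)
      fix y :: real
      obtain N0 :: nat where N0: "\<bar>y\<bar> < real N0" using reals_Archimedean2 by blast
      show "\<forall>\<^sub>F N::nat in sequentially. indicator {- real N..real N} y *\<^sub>R h y = h y"
        using eventually_ge_at_top[of N0] by eventually_elim (use N0 in \<open>auto split: split_indicator\<close>)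
    qed
  qed
  moreover have "(LBINT y. indicator {- real N..real N} y *\<^sub>R h y) = integral {- real N..real N} h" for N :: nat
  proof -
    have "set_integrable lborel {- real N..real N} h"
      by (rule borel_integrable_atLeastAtMost') (rule continuous_on_subset[OF cont], simp)
    from set_borel_integral_eq_integral(2)[OF this] show ?thesis
      by (simp add: set_lebesgue_integral_def)
  qed
  ultimately show ?thesis by simp
qed

text \<open>Cauchy's formula on a rectangle symmetric about 1/2. Reflection moves its left side onto
  the right one and the pole from w to 1 - w; the error is the contribution of the two horizontal
  sides, each of length 2 c - 1.\<close>

lemma cauchy_rectangle_symmetric:
  fixes f :: "complex \<Rightarrow> complex"
  assumes hol: "f holomorphic_on UNIV" and sym: "\<And>t. f (1 - t) = f t"
    and w: "1 - c < Re w" "Re w < c" and T: "\<bar>Im w\<bar> < T"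
    and B: "\<And>t. 1 - c \<le> Re t \<Longrightarrow> Re t \<le> c \<Longrightarrow> \<bar>Im t\<bar> = T \<Longrightarrow> norm (f t / (t - w)) \<le> B"
  shows "norm (integral {-T..T} (\<lambda>y. f (Complex c y) / (Complex c y - w)) +
      integral {-T..T} (\<lambda>y. f (Complex c y) / (Complex c y - (1 - w))) - 2 * pi * f w) \<le> 2 * B * (2 * c - 1)"
proof -
  define g where "g t = f t / (t - w)" for t
  define a1 where "a1 = Complex (1 - c) (- T)"
  define a2 where "a2 = Complex c (- T)"
  define a3 where "a3 = Complex c T"
  define a4 where "a4 = Complex (1 - c) T"
  have Tc: "T > 0" "c > 1/2" using T w by auto
  have rect: "rectpath a1 a3 = linepath a1 a2 +++ linepath a2 a3 +++ linepath a3 a4 +++ linepath a4 a1"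
    by (simp add: rectpath_def Let_def a1_def a2_def a3_def a4_def)
  have w_box: "w \<in> box a1 a3" using w T by (auto simp: in_box_complex_iff a1_def a3_def)
  have le: "Re a1 \<le> Re a3" "Im a1 \<le> Im a3" using Tc by (auto simp: a1_def a3_def)
  have img: "path_image (rectpath a1 a3) \<subseteq> UNIV - {w}"
    using path_image_rectpath_inter_box[OF le] w_box by blast
  have C: "(g has_contour_integral (2 * pi * \<i> * winding_number (rectpath a1 a3) w * f w)) (rectpath a1 a3)"
    unfolding g_def by (rule Cauchy_integral_formula_convex_simple[OF _ hol]) (use img in auto)
  hence total: "contour_integral (rectpath a1 a3) g = 2 * pi * \<i> * f w"
    using winding_number_rectpath[OF w_box] by (simp add: contour_integral_unique)
  have "g contour_integrable_on (rectpath a1 a3)" using C by (auto simp: contour_integrable_on_def)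
  hence ci: "g contour_integrable_on linepath a1 a2" "g contour_integrable_on linepath a2 a3"
    "g contour_integrable_on linepath a3 a4" "g contour_integrable_on linepath a4 a1"
    unfolding rect by (auto simp: contour_integrable_join)
  have split: "contour_integral (rectpath a1 a3) g = contour_integral (linepath a1 a2) g + (contour_integral (linepath a2 a3) g
      + (contour_integral (linepath a3 a4) g + contour_integral (linepath a4 a1) g))"
    unfolding rect using ci by (simp add: contour_integrable_join)
  have right: "contour_integral (linepath a2 a3) g = \<i> * integral {-T..T} (\<lambda>y. g (Complex c y))"
    by (rule contour_integral_linepath_same_Re) (use Tc in \<open>auto simp: a2_def a3_def\<close>)
  have "contour_integral (linepath a4 a1) g = - contour_integral (linepath a1 a4) g"
    using contour_integral_reversepath[of "linepath a1 a4" g] by simp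
  also have "contour_integral (linepath a1 a4) g = \<i> * integral {-T..T} (\<lambda>y. g (Complex (1 - c) y))"
    by (rule contour_integral_linepath_same_Re) (use Tc in \<open>auto simp: a1_def a4_def\<close>)
  \<comment> \<open>Changing y to - y makes the point 1 - t with t on the right side. The
    denominator 1 - t - w is the negative of t - (1 - w), and this sign cancels the one from the
    downward orientation.\<close>
  also have "integral {-T..T} (\<lambda>y. g (Complex (1 - c) y)) = integral {-T..T} (\<lambda>y. g (Complex (1 - c) (- y)))"
    using Henstock_Kurzweil_Integration.integral_reflect_real[of T "- T" "\<lambda>y. g (Complex (1 - c) y)"] by simp
  also have "(\<lambda>y. g (Complex (1 - c) (- y))) = (\<lambda>y. - (f (Complex c y) / (Complex c y - (1 - w))))"
  proof
    fix y
    have "Complex (1 - c) (- y) = 1 - Complex c y" by (simp add: complex_eq_iff)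
    hence "g (Complex (1 - c) (- y)) = f (Complex c y) / (- (Complex c y - (1 - w)))"
      by (simp add: g_def sym)
    thus "g (Complex (1 - c) (- y)) = - (f (Complex c y) / (Complex c y - (1 - w)))" by (simp only: divide_minus_right)
  qed
  finally have left: "contour_integral (linepath a4 a1) g = \<i> * integral {-T..T} (\<lambda>y. f (Complex c y) / (Complex c y - (1 - w)))"
    by simp
  have B0: "B \<ge> 0" using B[of "Complex c T"] Tc w by (auto intro: order_trans[OF norm_ge_zero])
  have hor: "norm (contour_integral (linepath (Complex p y) (Complex q y)) g) \<le> B * (2 * c - 1)"
    if "g contour_integrable_on linepath (Complex p y) (Complex q y)" "\<bar>y\<bar> = T" "{p, q} = {1 - c, c}" for p q y
  proof -
    have seg: "1 - c \<le> Re t \<and> Re t \<le> c \<and> Im t = y" if "t \<in> closed_segment (Complex p y) (Complex q y)" for t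
    proof -
      from that obtain u where u: "0 \<le> u" "u \<le> 1" "t = (1 - u) *\<^sub>R Complex p y + u *\<^sub>R Complex q y"
        by (auto simp: closed_segment_def)
      have pq: "1 - c \<le> p" "p \<le> c" "1 - c \<le> q" "q \<le> c" using \<open>{p, q} = {1 - c, c}\<close> Tc by (auto simp: doubleton_eq_iff)
      have "Re t = (1 - u) * p + u * q" "Im t = y"
        unfolding u(3) by (simp_all add: algebra_simps)
      moreover have "(1 - u) * p + u * q \<le> c" using u pq by (intro convex_bound_le) auto
      moreover have "(1 - u) * (- p) + u * (- q) \<le> - (1 - c)" using u pq by (intro convex_bound_le) auto
      ultimately show ?thesis by simp
    qed
    have "norm (contour_integral (linepath (Complex p y) (Complex q y)) g) \<le> B * norm (Complex q y - Complex p y)"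
      by (rule contour_integral_bound_linepath) (use that B0 B seg in \<open>auto simp: g_def\<close>)
    also have "norm (Complex q y - Complex p y) = 2 * c - 1"
      using \<open>{p, q} = {1 - c, c}\<close> Tc by (auto simp: doubleton_eq_iff cmod_def)
    finally show ?thesis .
  qed
  have h1: "norm (contour_integral (linepath a1 a2) g) \<le> B * (2 * c - 1)"
    unfolding a1_def a2_def by (rule hor) (use ci Tc in \<open>auto simp: a1_def a2_def\<close>)
  have h2: "norm (contour_integral (linepath a3 a4) g) \<le> B * (2 * c - 1)"
    unfolding a3_def a4_def by (rule hor) (use ci Tc in \<open>auto simp: a3_def a4_def\<close>)
  define V where "V = integral {-T..T} (\<lambda>y. f (Complex c y) / (Complex c y - w)) +
      integral {-T..T} (\<lambda>y. f (Complex c y) / (Complex c y - (1 - w))) - 2 * pi * f w"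
  have "\<i> * V = - (contour_integral (linepath a1 a2) g + contour_integral (linepath a3 a4) g)"
    using total unfolding split right left by (simp add: V_def g_def algebra_simps)
  hence "norm (\<i> * V) = norm (contour_integral (linepath a1 a2) g + contour_integral (linepath a3 a4) g)"
    by (simp only: norm_minus_cancel)
  also have "\<dots> \<le> 2 * B * (2 * c - 1)"
    using norm_triangle_ineq[of "contour_integral (linepath a1 a2) g" "contour_integral (linepath a3 a4) g"] h1 h2 by simp
  finally show ?thesis by (simp add: V_def norm_mult)
qed

text \<open>The centre 1/2 makes the Gaussian invariant under t -> 1 - t, so multiplying by it
  preserves the symmetry of f; in the strip the real part of (t - 1/2)^2 is governed by - (Im
  t)^2.\<close>

lemma norm_gaussian_strip:
  assumes "1 - c \<le> Re t" "Re t \<le> c" "0 \<le> e"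
  shows "norm (exp (of_real e * (t - 1 / 2)\<^sup>2)) \<le> exp (e * ((c - 1 / 2)\<^sup>2 - (Im t)\<^sup>2))"
proof -
  have "Re ((t - 1 / 2)\<^sup>2) = (Re t - 1 / 2)\<^sup>2 - (Im t)\<^sup>2"
    by (simp add: power2_eq_square)
  moreover have "(Re t - 1 / 2)\<^sup>2 \<le> (c - 1 / 2)\<^sup>2"
    using assms by (intro power2_le_iff_abs_le[THEN iffD2]) (auto simp: abs_le_iff)
  ultimately show ?thesis using assms(3) by (auto simp: norm_exp_eq_Re intro!: mult_left_mono)
qed

text \<open>The Gaussian factor makes the horizontal sides of the rectangle negligible; it is removed by
  dominated convergence afterwards, so that no decay of \<open>f\<close> inside the strip is needed.\<close>

theorem line_Cauchy_reflect:
  fixes f :: "complex \<Rightarrow> complex"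
  assumes hol: "f holomorphic_on UNIV" and sym: "\<And>t. f (1 - t) = f t"
    and strip: "\<And>t. 1 - c \<le> Re t \<Longrightarrow> Re t \<le> c \<Longrightarrow> norm (f t) \<le> K * (1 + norm t)\<^sup>2"
    and line: "\<And>y. norm (f (Complex c y)) \<le> K / (1 + y\<^sup>2)"
    and w: "1 - c < Re w" "Re w < c"
  shows "line_Cauchy c f w + line_Cauchy c f (1 - w) = f w"
proof -
  have c: "c > 1 / 2" using w by auto
  have K: "K \<ge> 0" using order_trans[OF norm_ge_zero line[of 0]] by simp
  define E where "E e t = exp (of_real e * (t - 1 / 2)\<^sup>2)" for e :: real and t :: complex
  \<comment> \<open>A bound in the strip for all Gaussians with parameter e in [0, 1]; it supplies
    the dominating function when e tends to 0.\<close>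
  define A where "A = exp ((c - 1 / 2)\<^sup>2)"
  have A: "A > 0" by (simp add: A_def)
  have E_A: "norm (E e t) \<le> A" if "1 - c \<le> Re t" "Re t \<le> c" "0 \<le> e" "e \<le> 1" for e t
  proof -
    have "e * ((c - 1 / 2)\<^sup>2 - (Im t)\<^sup>2) \<le> e * (c - 1 / 2)\<^sup>2"
      using that by (intro mult_left_mono) auto
    also have "\<dots> \<le> 1 * (c - 1 / 2)\<^sup>2" using that by (intro mult_right_mono) auto
    finally have "exp (e * ((c - 1 / 2)\<^sup>2 - (Im t)\<^sup>2)) \<le> A" by (simp add: A_def)
    thus ?thesis using norm_gaussian_strip[OF that(1,2,3)] unfolding E_def by linarith
  qed
  have contf: "continuous_on UNIV f" using hol by (rule holomorphic_on_imp_continuous_on)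
  define h where "h e w y = f (Complex c y) * E e (Complex c y) / (Complex c y - w)" for e w y
  have contE: "continuous_on UNIV (\<lambda>t. f t * E e t)" for e
    unfolding E_def by (intro continuous_intros contf)
  have lineE: "norm (f (Complex c y) * E e (Complex c y)) \<le> (K * A) / (1 + y\<^sup>2)" if "0 \<le> e" "e \<le> 1" for e y
  proof -
    have "norm (f (Complex c y) * E e (Complex c y)) \<le> (K / (1 + y\<^sup>2)) * A"
      unfolding norm_mult using c that K by (intro mult_mono line E_A) (auto intro!: divide_nonneg_nonneg)
    thus ?thesis by simp
  qed
  have int_h: "integrable lborel (h e v)" if "0 \<le> e" "e \<le> 1" "Re v \<noteq> c" for e v
    unfolding h_def using integrable_line_Cauchy[OF contE lineE[OF that(1,2)] that(3)] .
  have cont_h: "continuous_on UNIV (h e v)" if v: "Re v \<noteq> c" for e v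
  proof -
    have ne: "Complex c y - v \<noteq> 0" for y using v by (auto simp: complex_eq_iff)
    show ?thesis unfolding h_def
      by (intro continuous_intros continuous_on_compose2[OF contE] ballI ne)
         (auto intro!: continuous_intros simp: Complex_eq)
  qed
  \<comment> \<open>For fixed e > 0 the identity is exact: on the horizontal sides exp (- e T^2)
    beats the quadratic growth of f, and the error of the rectangle vanishes as its height
    grows.\<close>
  have step: "integral\<^sup>L lborel (h e w) + integral\<^sup>L lborel (h e (1 - w)) = 2 * pi * (f w * E e w)" if e: "0 < e" "e \<le> 1" for e
  proof -
    define X where "X N = integral {- real N..real N} (h e w) + integral {- real N..real N} (h e (1 - w)) - 2 * pi * (f w * E e w)" for N :: nat
    define B where "B T = K * (1 + c + T)\<^sup>2 * exp (e * ((c - 1 / 2)\<^sup>2 - T\<^sup>2)) / (T - \<bar>Im w\<bar>)" for T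
    have bound: "norm (X N) \<le> 2 * B (real N) * (2 * c - 1)" if N: "\<bar>Im w\<bar> < real N" for N
      unfolding X_def h_def
    proof (rule cauchy_rectangle_symmetric)
      show "(\<lambda>t. f t * E e t) holomorphic_on UNIV" unfolding E_def by (intro holomorphic_intros hol)
      show "f (1 - t) * E e (1 - t) = f t * E e t" for t
        by (simp add: sym E_def power2_eq_square algebra_simps)
      fix t assume t: "1 - c \<le> Re t" "Re t \<le> c" "\<bar>Im t\<bar> = real N"
      have "norm t \<le> c + real N"
        using cmod_le[of t] t c by (simp add: abs_le_iff)
      hence "norm (f t) \<le> K * (1 + c + real N)\<^sup>2"
        using strip[OF t(1,2)] K by (intro order_trans[OF strip[OF t(1,2)]] mult_left_mono power_mono) auto
      moreover have "norm (E e t) \<le> exp (e * ((c - 1 / 2)\<^sup>2 - (real N)\<^sup>2))"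
        using norm_gaussian_strip[OF t(1,2), of e] e t(3) unfolding E_def by (metis less_imp_le power2_abs)
      moreover have "real N - \<bar>Im w\<bar> \<le> norm (t - w)"
        using abs_Im_le_cmod[of "t - w"] t(3) by simp
      ultimately show "norm (f t * E e t / (t - w)) \<le> B (real N)"
        unfolding B_def norm_divide norm_mult using N K
        by (intro frac_le mult_mono) auto
    qed (use w N in auto)
    have "(\<lambda>N. 2 * B (real N) * (2 * c - 1)) \<longlonglongrightarrow> 0"
      unfolding B_def using e by real_asymp
    hence "X \<longlonglongrightarrow> 0"
    proof (rule Lim_null_comparison[rotated])
      obtain N0 :: nat where N0: "\<bar>Im w\<bar> < real N0" using reals_Archimedean2 by blast
      show "\<forall>\<^sub>F N in sequentially. norm (X N) \<le> 2 * B (real N) * (2 * c - 1)"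
        using eventually_ge_at_top[of N0] by eventually_elim (use N0 in \<open>auto intro!: bound\<close>)
    qed
    moreover have "X \<longlonglongrightarrow> integral\<^sup>L lborel (h e w) + integral\<^sup>L lborel (h e (1 - w)) - 2 * pi * (f w * E e w)"
      unfolding X_def using e w
      by (intro tendsto_intros tendsto_symmetric_intervals int_h cont_h) auto
    ultimately show ?thesis using LIMSEQ_unique by force
  qed
  define e where "e n = inverse (real (Suc n))" for n
  have e: "0 < e n" "e n \<le> 1" for n by (auto simp: e_def inverse_le_1_iff)
  have e0: "e \<longlonglongrightarrow> 0" unfolding e_def by (rule LIMSEQ_inverse_real_of_nat)
  have lim: "(\<lambda>n. integral\<^sup>L lborel (h (e n) v)) \<longlonglongrightarrow> integral\<^sup>L lborel (h 0 v)" if v: "Re v \<noteq> c" for v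
  proof (rule integral_dominated_convergence)
    show "integrable lborel (\<lambda>y. A * norm (h 0 v y))" using int_h[of 0 v] v by simp
    show "h 0 v \<in> borel_measurable lborel" using int_h[of 0 v] v by simp
    show "h (e n) v \<in> borel_measurable lborel" for n using int_h[of "e n" v] v e[of n] by simp
    show "AE y in lborel. (\<lambda>n. h (e n) v y) \<longlonglongrightarrow> h 0 v y"
    proof (rule AE_I2)
      fix y
      have ne: "Complex c y - v \<noteq> 0" using v by (auto simp: complex_eq_iff)
      show "(\<lambda>n. h (e n) v y) \<longlonglongrightarrow> h 0 v y"
        unfolding h_def E_def by (intro tendsto_intros e0 ne)
    qed
    show "AE y in lborel. norm (h (e n) v y) \<le> A * norm (h 0 v y)" for n
    proof (rule AE_I2)
      fix y
      have "norm (h (e n) v y) = norm (E (e n) (Complex c y)) * norm (h 0 v y)"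
        by (simp add: h_def norm_mult norm_divide E_def[of 0])
      also have "\<dots> \<le> A * norm (h 0 v y)"
        using e[of n] c by (intro mult_right_mono E_A) auto
      finally show "norm (h (e n) v y) \<le> A * norm (h 0 v y)" .
    qed
  qed
  have "(\<lambda>n. integral\<^sup>L lborel (h (e n) w) + integral\<^sup>L lborel (h (e n) (1 - w))) \<longlonglongrightarrow> integral\<^sup>L lborel (h 0 w) + integral\<^sup>L lborel (h 0 (1 - w))"
    using w by (intro tendsto_add lim) auto
  moreover have "(\<lambda>n. 2 * pi * (f w * E (e n) w)) \<longlonglongrightarrow> 2 * pi * (f w * E 0 w)"
    unfolding E_def by (intro tendsto_intros e0)
  ultimately have "integral\<^sup>L lborel (h 0 w) + integral\<^sup>L lborel (h 0 (1 - w)) = 2 * pi * (f w * E 0 w)"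
    unfolding step[OF e] by (rule LIMSEQ_unique)
  hence "integral\<^sup>L lborel (h 0 w) + integral\<^sup>L lborel (h 0 (1 - w)) = 2 * pi * f w"
    by (simp add: E_def)
  moreover have "line_Cauchy c f v = integral\<^sup>L lborel (h 0 v) / (2 * of_real pi)" for v
    by (simp add: line_Cauchy_def h_def[abs_def] E_def)
  ultimately show ?thesis by (simp add: add_divide_distrib[symmetric])
qed

subsection \<open>The integral formula\<close>

text \<open>Four steps of the recurrence express Gamma z through Gamma (z + 4), bounded by its value
  at the real part; each of the four divisors is at least sqrt (1 + y^2) / 2, where y = Im t. Two of
  these powers pay for the factor t (t - 1) of \<open>Xi\<close>, and two remain for
  integrability.\<close>

lemma norm_Gamma_half_line:
  fixes t :: complex
  assumes c: "Re t > 1"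
  shows "norm (Gamma (t / 2)) \<le> 16 * Gamma (Re t / 2 + 4) / (1 + (Im t)\<^sup>2)\<^sup>2"
proof -
  define z where "z = t / 2"
  define q where "q = 1 + (Im t)\<^sup>2"
  have q: "q > 0" unfolding q_def by (intro add_pos_nonneg) auto
  have Re_z: "Re z > 1 / 2" using c by (simp add: z_def)
  have np: "z + of_nat j \<notin> \<int>\<^sub>\<le>\<^sub>0" for j using Re_z by (auto elim!: nonpos_Ints_cases simp: complex_eq_iff)
  have "Gamma (z + 4) = (z + 3) * ((z + 2) * ((z + 1) * (z * Gamma z)))"
    using Gamma_plus1[OF np[of 0]] Gamma_plus1[OF np[of 1]] Gamma_plus1[OF np[of 2]] Gamma_plus1[OF np[of 3]]
    by (simp add: add.assoc)
  hence "norm (z + 3) * norm (z + 2) * (norm (z + 1) * norm z) * norm (Gamma z) = norm (Gamma (z + 4))"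
    by (simp add: norm_mult mult_ac)
  also have "\<dots> \<le> Gamma (Re (z + 4))"
    using Re_z by (intro norm_Gamma_le) auto
  also have "Re (z + 4) = Re t / 2 + 4" by (simp add: z_def)
  finally have 1: "norm (z + 3) * norm (z + 2) * (norm (z + 1) * norm z) * norm (Gamma z) \<le> Gamma (Re t / 2 + 4)" .
  have lower: "sqrt q / 2 \<le> norm (z + of_nat j)" for j
  proof (rule power2_le_imp_le)
    have "(sqrt q / 2)\<^sup>2 = q / 4" using q by (simp add: power_divide)
    also have "\<dots> = (1 / 2)\<^sup>2 + (Im t / 2)\<^sup>2" by (simp add: q_def power_divide)
    also have "(1 / 2)\<^sup>2 \<le> (Re z + real j)\<^sup>2" using Re_z by (intro power_mono) auto
    finally show "(sqrt q / 2)\<^sup>2 \<le> (norm (z + of_nat j))\<^sup>2"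
      unfolding cmod_power2 by (simp add: z_def)
  qed simp
  have "q\<^sup>2 / 16 = sqrt q / 2 * (sqrt q / 2) * (sqrt q / 2 * (sqrt q / 2))"
    using q by (simp add: power2_eq_square)
  also have "\<dots> \<le> norm (z + 3) * norm (z + 2) * (norm (z + 1) * norm z)"
    using lower[of 0] lower[of 1] lower[of 2] lower[of 3] q by (intro mult_mono) auto
  finally have "q\<^sup>2 / 16 * norm (Gamma z) \<le> norm (z + 3) * norm (z + 2) * (norm (z + 1) * norm z) * norm (Gamma z)"
    by (rule mult_right_mono) simp
  with 1 have "q\<^sup>2 / 16 * norm (Gamma z) \<le> Gamma (Re t / 2 + 4)" by linarith
  thus ?thesis using q by (simp add: z_def q_def[symmetric] field_simps)
qed

text \<open>To the right of 1 the Dirichlet series is bounded by its value at c, so the decay is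
  that of Gamma. The Mellin transform gets (1 + y^2)^(-2), and \<open>Xi\<close> loses one power
  because |t (t - 1)| <= c^2 (1 + y^2); one K covers both.\<close>

lemma Xi_line_decay:
  assumes c: "c > 1"
  obtains K where "\<And>y. norm (Xi (Complex c y)) \<le> K / (1 + y\<^sup>2)"
    and "\<And>y. norm (LBINT u. exp (Complex c y * of_real u) * of_real (psi u)) \<le> K / (1 + y\<^sup>2)"
proof -
  define M where "M t = (LBINT u. exp (t * of_real u) * complex_of_real (psi u))" for t
  define Z where "Z = (\<Sum>n. 1 / real (Suc n) powr c)"
  define A where "A = pi powr (- c / 2) * (16 * Gamma (c / 2 + 4)) / 2 * Z"
  have summ: "summable (\<lambda>n. 1 / real (Suc n) powr c)"
    using psi_Mellin(2)[of "of_real c"] c by simp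
  have Z: "Z \<ge> 0" unfolding Z_def by (intro suminf_nonneg summ) auto
  have M: "norm (M (Complex c y)) \<le> A / (1 + y\<^sup>2)\<^sup>2" for y
  proof -
    define t where "t = Complex c y"
    have t: "Re t = c" "Im t = y" by (simp_all add: t_def)
    have eq: "M t = of_real pi powr (- t / 2) * Gamma (t / 2) / 2 * (\<Sum>n. 1 / of_nat (Suc n) powr t)"
      unfolding M_def by (rule has_bochner_integral_integral_eq[OF psi_Mellin(1)]) (use c t in simp)
    define p where "p = pi powr (- c / 2)"
    define g where "g = 16 * Gamma (c / 2 + 4) / (1 + y\<^sup>2)\<^sup>2"
    have p: "norm (complex_of_real pi powr (- t / 2)) = p" "p \<ge> 0" unfolding p_def
      by (subst norm_powr_real_powr) (auto simp: t)
    have "norm (Gamma (t / 2)) \<le> g"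
      using norm_Gamma_half_line[of t] c t by (simp add: g_def)
    hence pg: "p * norm (Gamma (t / 2)) / 2 \<le> p * g / 2"
      using p(2) by (intro divide_right_mono mult_left_mono) auto
    have pg0: "0 \<le> p * g / 2"
      by (rule order_trans[OF _ pg]) (use p(2) in simp)
    have Zt: "norm (\<Sum>n. 1 / of_nat (Suc n) powr t) \<le> Z"
    proof -
      have *: "norm (1 / of_nat (Suc n) powr t) = 1 / real (Suc n) powr c" for n
        by (simp add: norm_divide norm_powr_real_powr t del: of_nat_Suc)
      show ?thesis
        using summable_norm[of "\<lambda>n. 1 / of_nat (Suc n) powr t"] summ unfolding * Z_def by blast
    qed
    have "norm (M t) = p * norm (Gamma (t / 2)) / 2 * norm (\<Sum>n. 1 / of_nat (Suc n) powr t)"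
      unfolding eq norm_mult norm_divide p(1) by simp
    also have "\<dots> \<le> p * g / 2 * Z"
      by (intro mult_mono pg Zt pg0 norm_ge_zero)
    finally show ?thesis by (simp add: A_def t_def p_def g_def)
  qed
  have A: "A \<ge> 0" using order_trans[OF norm_ge_zero M[of 0]] by simp
  have q: "1 \<le> 1 + y\<^sup>2" for y :: real by simp
  have le: "a / (1 + y\<^sup>2)\<^sup>2 * (1 + y\<^sup>2) = a / (1 + y\<^sup>2)" for a y :: real
    using q[of y] by (simp add: power2_eq_square)
  have K1: "norm (M (Complex c y)) \<le> (A * c\<^sup>2) / (1 + y\<^sup>2)" for y
  proof -
    have "A / (1 + y\<^sup>2)\<^sup>2 * 1 \<le> A / (1 + y\<^sup>2)\<^sup>2 * (1 + y\<^sup>2)" using A by (intro mult_left_mono) auto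
    hence "A / (1 + y\<^sup>2)\<^sup>2 \<le> A / (1 + y\<^sup>2)" unfolding le by simp
    also have "\<dots> \<le> (A * c\<^sup>2) / (1 + y\<^sup>2)"
      using A c by (intro divide_right_mono) (auto simp: mult_le_cancel_left1 one_le_power)
    finally show ?thesis using M[of y] by linarith
  qed
  have K2: "norm (Xi (Complex c y)) \<le> (A * c\<^sup>2) / (1 + y\<^sup>2)" for y
  proof -
    define t where "t = Complex c y"
    have "norm t ^ 2 = c\<^sup>2 + y\<^sup>2" by (simp add: t_def cmod_power2)
    also have "\<dots> \<le> c\<^sup>2 * (1 + y\<^sup>2)" using c by (simp add: algebra_simps mult_le_cancel_right1 one_le_power)
    finally have n1: "norm t * norm t \<le> c\<^sup>2 * (1 + y\<^sup>2)" by (simp add: power2_eq_square)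
    have "norm (t - 1) \<le> norm t"
      unfolding cmod_def t_def using c by (auto intro!: real_sqrt_le_mono power_mono)
    hence "norm t * norm (t - 1) \<le> norm t * norm t" by (intro mult_left_mono) auto
    with n1 have n2: "norm t * norm (t - 1) \<le> c\<^sup>2 * (1 + y\<^sup>2)" by linarith
    have "Xi t = t * (t - 1) * M t" unfolding M_def by (rule Xi_Mellin) (use c in \<open>simp add: t_def\<close>)
    hence "norm (Xi t) = norm t * norm (t - 1) * norm (M t)" by (simp add: norm_mult)
    also have "\<dots> \<le> c\<^sup>2 * (1 + y\<^sup>2) * (A / (1 + y\<^sup>2)\<^sup>2)"
      using M[of y] by (intro mult_mono n2) (auto simp: t_def)
    also have "\<dots> = (A * c\<^sup>2) / (1 + y\<^sup>2)" using le[of "A * c\<^sup>2" y] by (simp add: mult_ac)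
    finally show ?thesis by (simp add: t_def)
  qed
  show ?thesis using that K1 K2 unfolding M_def by blast
qed

text \<open>In the strip both t and 1 - t have real part at most c, so both halves of the Mellin
  transform are bounded by the value at c, and only the factor t (1 - t) grows.\<close>

lemma norm_Xi_strip:
  assumes "1 - c \<le> Re t" "Re t \<le> c"
  shows "norm (Xi t) \<le> (1 / 2 + 2 * Re (half_Mellin (of_real c))) * (1 + norm t)\<^sup>2"
proof -
  define H where "H = Re (half_Mellin (of_real c))"
  have H: "norm (half_Mellin t) \<le> H" "norm (half_Mellin (1 - t)) \<le> H"
    unfolding H_def using assms by (auto intro!: norm_half_Mellin_le)
  hence H0: "H \<ge> 0" using norm_ge_zero order_trans by blast
  have "norm (1 - t) \<le> 1 + norm t" using norm_triangle_ineq4[of 1 t] by simp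
  hence "norm t * norm (1 - t) \<le> (1 + norm t) * (1 + norm t)" by (intro mult_mono) auto
  hence 1: "norm t * norm (1 - t) \<le> (1 + norm t)\<^sup>2" by (simp add: power2_eq_square)
  have "norm (Xi t) \<le> norm (1 / 2 :: complex) + norm (t * (1 - t) * (half_Mellin t + half_Mellin (1 - t)))"
    unfolding Xi_def by (rule norm_triangle_ineq4)
  also have "norm (t * (1 - t) * (half_Mellin t + half_Mellin (1 - t))) = norm t * norm (1 - t) * norm (half_Mellin t + half_Mellin (1 - t))"
    by (simp add: norm_mult)
  also have "\<dots> \<le> (1 + norm t)\<^sup>2 * (2 * H)"
    using H norm_triangle_ineq[of "half_Mellin t" "half_Mellin (1 - t)"] by (intro mult_mono 1) auto
  also have "norm (1 / 2 :: complex) \<le> (1 + norm t)\<^sup>2 * (1 / 2)"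
    using one_le_power[of "1 + norm t" 2] by simp
  finally show ?thesis by (simp add: H_def algebra_simps)
qed

lemma line_Cauchy_Xi_reflect:
  assumes c: "c > 1" and w: "1 - c < Re w" "Re w < c"
  shows "line_Cauchy c Xi w + line_Cauchy c Xi (1 - w) = Xi w"
proof -
  obtain K where K: "\<And>y. norm (Xi (Complex c y)) \<le> K / (1 + y\<^sup>2)"
    using Xi_line_decay[OF c] by metis
  define L where "L = max K (1 / 2 + 2 * Re (half_Mellin (of_real c)))"
  show ?thesis
  proof (rule line_Cauchy_reflect[where K = L])
    show "norm (Xi (Complex c y)) \<le> L / (1 + y\<^sup>2)" for y
      by (rule order_trans[OF K]) (auto simp: L_def intro!: divide_right_mono)
    show "norm (Xi t) \<le> L * (1 + norm t)\<^sup>2" if "1 - c \<le> Re t" "Re t \<le> c" for t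
      by (rule order_trans[OF norm_Xi_strip[OF that]]) (auto simp: L_def intro!: mult_right_mono)
  qed (use w in \<open>auto simp: Xi_reflect holomorphic_Xi\<close>)
qed

text \<open>The difference is the Mellin inversion integral of \<open>psi\<close> at the point 0.\<close>

lemma line_Cauchy_Xi_diff:
  assumes c: "1 < c" "c < 2"
  shows "line_Cauchy c Xi 0 - line_Cauchy c Xi 1 = - of_real (psi 0)"
proof -
  define M where "M y = (LBINT u. exp (Complex c y * of_real u) * complex_of_real (psi u))" for y
  define f where "f u = complex_of_real (exp (c * u) * psi u)" for u
  obtain K where K: "\<And>y. norm (Xi (Complex c y)) \<le> K / (1 + y\<^sup>2)" "\<And>y. norm (M y) \<le> K / (1 + y\<^sup>2)"
    unfolding M_def using Xi_line_decay[OF c(1)] by metis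
  have contX: "continuous_on UNIV Xi"
    by (rule holomorphic_on_imp_continuous_on[OF holomorphic_Xi])
  \<comment> \<open>Since Xi t = t (t - 1) M and 1 / (t (t - 1)) = 1 / (t - 1) - 1 / t, the Mellin
    transform is itself the difference of the two Cauchy kernels. This also gives its
    integrability.\<close>
  have M_eq: "M y = - (Xi (Complex c y) / (Complex c y - 0) - Xi (Complex c y) / (Complex c y - 1))" for y
  proof -
    define t where "t = Complex c y"
    have "t \<noteq> 0" "t - 1 \<noteq> 0" using c by (auto simp: t_def complex_eq_iff)
    moreover have "Xi t = t * (t - 1) * M y"
      unfolding M_def t_def by (rule Xi_Mellin) (use c in simp)
    ultimately show ?thesis unfolding t_def[symmetric] by (simp add: field_simps)
  qed
  have int0: "integrable lborel (\<lambda>y. Xi (Complex c y) / (Complex c y - 0))"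
    by (rule integrable_line_Cauchy[OF contX K(1)]) (use c in auto)
  have int1: "integrable lborel (\<lambda>y. Xi (Complex c y) / (Complex c y - 1))"
    by (rule integrable_line_Cauchy[OF contX K(1)]) (use c in auto)
  have "integral\<^sup>L lborel M = 2 * pi * f 0"
  proof (rule fourier_inversion_at_0[where B = 2])
    show "integrable lborel f"
    proof -
      have "f = (\<lambda>u. exp (of_real c * of_real u) * complex_of_real (psi u))"
        by (simp add: f_def fun_eq_iff flip: exp_of_real)
      thus ?thesis using psi_Mellin(1)[of "of_real c"] c by (simp add: has_bochner_integral_iff)
    qed
    show "isCont f 0"
      unfolding f_def by (intro continuous_intros continuous_psi)
    show "M y = (LBINT u. f u * cis (y * u))" for y
      unfolding M_def
    proof (rule Bochner_Integration.integral_cong[OF refl])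
      fix u :: real
      have "Complex c y * of_real u = of_real (c * u) + \<i> * of_real (y * u)"
        by (simp add: complex_eq_iff)
      thus "exp (Complex c y * of_real u) * of_real (psi u) = f u * cis (y * u)"
        by (simp only: f_def exp_add cis_conv_exp exp_of_real of_real_mult[of "exp (c * u)" "psi u"])
          (simp only: mult_ac)
    qed
    show "integrable lborel M"
      unfolding M_eq[abs_def] using int0 int1 by (intro integrable_minus Bochner_Integration.integrable_diff)
    have norm_f: "norm (f u) = exp (c * u) * psi u" for u
      unfolding f_def norm_of_real using psi_nonneg[of u] by simp
    \<comment> \<open>Both bounds on c enter here: for u >= 0 the factor exp ((c - 2) u) is at most
      1, and for u = - v < 0 reflection of \<open>psi\<close> gives 2 exp ((1 - c) v), which is at
      most 2.\<close>
    show "norm (f u) \<le> 2" for u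
    proof (cases "u \<ge> 0")
      case True
      have "exp (c * u) * psi u \<le> exp (c * u) * exp (- (2 * u))"
        by (intro mult_left_mono psi_le) auto
      also have "\<dots> = exp ((c - 2) * u)" by (simp add: algebra_simps flip: exp_add)
      also have "\<dots> \<le> 1" using True c by (simp add: mult_nonpos_nonneg)
      finally show ?thesis by (simp add: norm_f)
    next
      case False
      define v where "v = - u"
      have v: "v > 0" using False by (simp add: v_def)
      have psi_u: "psi u = exp v * psi v + (exp v - 1) / 2" using psi_reflect[of v] by (simp add: v_def)
      have "psi v \<le> 1" using order_trans[OF psi_le[of v], of 1] v by simp
      hence 1: "exp v * psi v \<le> exp v" by (simp add: mult_left_le)
      have "-1 \<le> exp v" by (rule order_trans[OF _ exp_ge_zero]) simp
      hence 2: "(exp v - 1) / 2 \<le> exp v" by simp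
      have "psi u \<le> 2 * exp v" unfolding psi_u mult_2 by (rule add_mono[OF 1 2])
      hence "exp (c * u) * psi u \<le> exp (c * u) * (2 * exp v)" by (intro mult_left_mono) auto
      also have "\<dots> = 2 * exp ((1 - c) * v)" by (simp add: v_def algebra_simps flip: exp_add)
      also have "\<dots> \<le> 2" using v c by (simp add: mult_nonpos_nonneg)
      finally show ?thesis by (simp add: norm_f)
    qed
  qed
  note inv = this
  have M_diff: "integral\<^sup>L lborel M = - ((LBINT y. Xi (Complex c y) / (Complex c y - 0)) - (LBINT y. Xi (Complex c y) / (Complex c y - 1)))"
    unfolding M_eq[abs_def] Bochner_Integration.integral_diff[OF int0 int1, symmetric] by (rule integral_minus)
  have "(LBINT y. Xi (Complex c y) / (Complex c y - 0)) - (LBINT y. Xi (Complex c y) / (Complex c y - 1)) = - (2 * pi * f 0)"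
    unfolding inv[symmetric] M_diff by (simp only: minus_minus)
  hence "line_Cauchy c Xi 0 - line_Cauchy c Xi 1 = - (2 * pi * f 0) / (2 * of_real pi)"
    unfolding line_Cauchy_def diff_divide_distrib[symmetric] by (simp only:)
  thus ?thesis by (simp add: f_def)
qed

theorem theorem1:
  fixes c :: real and s :: complex
  assumes "1 < c" and "c < 2"
    and "0 < Re s" and "Re s < 1"
  defines "F \<equiv> \<lambda>t. 1 / (2 * of_real pi * \<i>) * (xi t / t) *
      ((2 * s * (1 - s) - t) / (s * (1 - s) - t * (1 - t)))"
    and "G \<equiv> \<lambda>t. 1 / (2 * of_real pi * \<i>) * (xi t / t) *
      (1 / (1 - t) - (2 * s * (1 - s) - t) / (s * (1 - s) - t * (1 - t)))"
  shows "vline_integrable c F \<and>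
         xi s = 1 - of_real (pi powr (1 / 4) / (2 * Gamma (3 / 4))) - vline_integral c F \<and>
         vline_integrable c G \<and>
         xi s = 1 / 2 + vline_integral c G"
proof -
  note c = assms(1,2) and s = assms(3,4)
  obtain K where K: "\<And>y. norm (Xi (Complex c y)) \<le> K / (1 + y\<^sup>2)"
    using Xi_line_decay[OF c(1)] by metis
  have contX: "continuous_on UNIV Xi"
    by (rule holomorphic_on_imp_continuous_on[OF holomorphic_Xi])
  define D where "D w y = Xi (Complex c y) / (Complex c y - w)" for w y
  define P where "P = line_Cauchy c Xi"
  have D: "has_bochner_integral lborel (\<lambda>y. D w y / (2 * of_real pi)) (P w)" if "Re w \<noteq> c" for w
  proof -
    have "integrable lborel (D w)"
      unfolding D_def by (rule integrable_line_Cauchy[OF contX K that])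
    hence "has_bochner_integral lborel (D w) (integral\<^sup>L lborel (D w))"
      by (simp add: has_bochner_integral_iff)
    moreover have "P w = integral\<^sup>L lborel (D w) / (2 * of_real pi)"
      by (simp only: P_def line_Cauchy_def D_def[abs_def])
    ultimately show ?thesis using has_bochner_integral_divide_zero by metis
  qed
  have D0: "has_bochner_integral lborel (\<lambda>y. D 0 y / (2 * of_real pi)) (P 0)"
    and D1: "has_bochner_integral lborel (\<lambda>y. D 1 y / (2 * of_real pi)) (P 1)"
    and Ds: "has_bochner_integral lborel (\<lambda>y. D s y / (2 * of_real pi)) (P s)"
    and Ds': "has_bochner_integral lborel (\<lambda>y. D (1 - s) y / (2 * of_real pi)) (P (1 - s))"
    using c s by (intro D; simp)+
  \<comment> \<open>The denominator factors as (t - s) (t - (1 - s)), and the residue at 0 is 2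
    because the numerator there is 2 s (1 - s). All poles lie off the line, since c > 1 exceeds the
    real parts of 0, 1, s and 1 - s.\<close>
  have kernel: "1 / t * ((2 * s * (1 - s) - t) / (s * (1 - s) - t * (1 - t))) = 2 / t - 1 / (t - s) - 1 / (t - (1 - s))"
    "1 / t * (1 / (1 - t)) = 1 / t - 1 / (t - 1)" if "Re t = c" for t
  proof -
    have nz: "t \<noteq> 0" "t - s \<noteq> 0" "t - (1 - s) \<noteq> 0" "1 - t \<noteq> 0" "t - 1 \<noteq> 0" using that c s by auto
    have fac: "s * (1 - s) - t * (1 - t) = (t - s) * (t - (1 - s))" by (simp add: algebra_simps)
    show "1 / t * ((2 * s * (1 - s) - t) / (s * (1 - s) - t * (1 - t))) = 2 / t - 1 / (t - s) - 1 / (t - (1 - s))"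
    proof -
      have "2 / t - 1 / (t - s) - 1 / (t - (1 - s)) =
          (2 * ((t - s) * (t - (1 - s))) - t * (t - (1 - s)) - t * (t - s)) / (t * ((t - s) * (t - (1 - s))))"
      proof -
        have "2 / x - 1 / a - 1 / b = (2 * (a * b) - x * b - x * a) / (x * (a * b))"
          if "x \<noteq> 0" "a \<noteq> 0" "b \<noteq> 0" for x a b :: complex
          using that by (simp add: field_simps)
        from this[OF nz(1,2,3)] show ?thesis .
      qed
      also have "2 * ((t - s) * (t - (1 - s))) - t * (t - (1 - s)) - t * (t - s) = 2 * s * (1 - s) - t"
        by (simp add: algebra_simps)
      finally show ?thesis unfolding fac by simp
    qed
    show "1 / t * (1 / (1 - t)) = 1 / t - 1 / (t - 1)" using nz by (simp add: field_simps)
  qed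
  have F: "F (Complex c y) * \<i> = 2 * (D 0 y / (2 * of_real pi)) - D s y / (2 * of_real pi) - D (1 - s) y / (2 * of_real pi)" for y
  proof -
    define t where "t = Complex c y"
    have "F t * \<i> = Xi t / (2 * of_real pi) * (1 / t * ((2 * s * (1 - s) - t) / (s * (1 - s) - t * (1 - t))))"
      by (simp add: F_def xi_eq_Xi)
    also have "\<dots> = Xi t / (2 * of_real pi) * (2 / t - 1 / (t - s) - 1 / (t - (1 - s)))"
      by (subst kernel) (simp_all add: t_def)
    also have "\<dots> = 2 * (Xi t / t / (2 * of_real pi)) - Xi t / (t - s) / (2 * of_real pi) - Xi t / (t - (1 - s)) / (2 * of_real pi)"
      by (simp only: divide_inverse algebra_simps mult_1 mult_1_right)
    finally show ?thesis by (simp only: D_def t_def diff_zero)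
  qed
  have G: "G (Complex c y) * \<i> = D 0 y / (2 * of_real pi) - D 1 y / (2 * of_real pi) - F (Complex c y) * \<i>" for y
  proof -
    define t where "t = Complex c y"
    have "G t * \<i> = Xi t / (2 * of_real pi) * (1 / t * (1 / (1 - t))) - F t * \<i>"
    proof -
      define A where "A = 1 / (1 - t)"
      define B where "B = (2 * s * (1 - s) - t) / (s * (1 - s) - t * (1 - t))"
      have "G t = 1 / (2 * of_real pi * \<i>) * (Xi t / t) * (A - B)" "F t = 1 / (2 * of_real pi * \<i>) * (Xi t / t) * B"
        by (simp_all only: G_def F_def A_def B_def xi_eq_Xi)
      hence "G t * \<i> = Xi t / (2 * of_real pi) * (1 / t * A) - F t * \<i>"
        by (simp add: right_diff_distrib left_diff_distrib diff_divide_distrib)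
      thus ?thesis by (simp only: A_def)
    qed
    also have "1 / t * (1 / (1 - t)) = 1 / t - 1 / (t - 1)"
      by (rule kernel) (simp add: t_def)
    also have "Xi t / (2 * of_real pi) * (1 / t - 1 / (t - 1)) = Xi t / t / (2 * of_real pi) - Xi t / (t - 1) / (2 * of_real pi)"
      by (simp only: divide_inverse algebra_simps mult_1 mult_1_right)
    finally show ?thesis by (simp only: D_def t_def diff_zero)
  qed
  have int_F: "has_bochner_integral lborel (\<lambda>y. F (Complex c y) * \<i>) (2 * P 0 - P s - P (1 - s))"
    unfolding F by (intro has_bochner_integral_diff has_bochner_integral_mult_right D0 Ds Ds')
  have int_G: "has_bochner_integral lborel (\<lambda>y. G (Complex c y) * \<i>) (P 0 - P 1 - (2 * P 0 - P s - P (1 - s)))"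
    unfolding G by (intro has_bochner_integral_diff D0 D1 int_F)
  have Ps: "P s + P (1 - s) = xi s"
    unfolding P_def xi_eq_Xi by (rule line_Cauchy_Xi_reflect) (use c s in auto)
  \<comment> \<open>The reflection identity at w = 0, which lies in the open strip because c >
    1.\<close>
  have P01: "P 0 + P 1 = 1 / 2"
    using line_Cauchy_Xi_reflect[of c 0] c by (simp add: P_def Xi_0)
  have "P 0 - P 1 = - of_real (psi 0)"
    unfolding P_def by (rule line_Cauchy_Xi_diff[OF c])
  moreover have "psi 0 = (pi powr (1 / 4) / Gamma (3 / 4) - 1) / 2"
    using psi_theta3[of 0] theta3_1 by simp
  ultimately have diff: "P 0 - P 1 = 1 / 2 - of_real (pi powr (1 / 4) / (2 * Gamma (3 / 4)))"
    by (simp add: diff_divide_distrib)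
  have "2 * P 0 = (P 0 + P 1) + (P 0 - P 1)" by simp
  hence P0: "2 * P 0 = 1 - of_real (pi powr (1 / 4) / (2 * Gamma (3 / 4)))"
    unfolding P01 diff by simp
  have F_val: "vline_integral c F = 2 * P 0 - (P s + P (1 - s))"
    using int_F by (simp add: vline_integral_def has_bochner_integral_iff algebra_simps)
  \<comment> \<open>The extra term 1 / (1 - t) contributes P 0 - P 1, so 2 P 0 turns into the sum P
    0 + P 1, free of theta values.\<close>
  have G_val: "vline_integral c G = (P s + P (1 - s)) - (P 0 + P 1)"
    using int_G by (simp add: vline_integral_def has_bochner_integral_iff algebra_simps)
  show ?thesis
    using int_F int_G F_val G_val
    by (simp only: vline_integrable_def has_bochner_integral_iff P0 Ps P01) simp
qed

end
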